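(* Let $\Omega,\Omega_C,\Omega_I,\Gamma,\sigma,\mu$ satisfy the geometric and coefficient assumptions in the context, let $\omega$ be the angular frequency, and let $\mathbf{H}(\mathbf{curl},\Omega)\supseteq\mathcal{H}=\nabla\mathcal{U}\oplus\mathcal{V}$ be a direct splitting (continuous or discrete, as described in the context) that is compatible with $(\Omega_C,\Omega_I,\Gamma)$. Let the operators, spaces and right-hand sides be as in the context. Then the following two formulations are equivalent. (MQS) Find $(\mathbf{A},\varphi)\in\mathcal{V}\times\mathcal{U}_C$ such that $$\begin{bmatrix} K+\mathrm{i}\omega M & S^T\\ \mathrm{i}\omega S & C\end{bmatrix}\begin{bmatrix}\mathbf{A}\\ \varphi\end{bmatrix}=\begin{bmatrix}J\\ j\end{bmatrix}.$$ (TI) Find $(\mathbf{A}_I,\mathbf{A}_C,\varphi,\boldsymbol{\lambda})\in\mathcal{V}_I\times\mathcal{V}_C\times\mathcal{U}_C\times\mathcal{V}_\Gamma^*$ such that $$\begin{bmatrix} K_I&0&0&B_I^T\\ 0&K_C+\mathrm{i}\omega M_C&S_C^T&B_C^T\\ 0&\mathrm{i}\omega S_C&C_C&0\\ B_I&B_C&0&0\end{bmatrix}\begin{bmatrix}\mathbf{A}_I\\ \mathbf{A}_C\\ \varphi\\ \boldsymbol{\lambda}\end{bmatrix}=\begin{bmatrix}J_I\\ J_C\\ j\\ 0\end{bmatrix}.$$ Here equivalence means: if $(\mathbf{A}_I,\mathbf{A}_C,\varphi,\boldsymbol{\lambda})$ solves (TI), then there is a unique $\mathbf{A}\in\mathcal{V}$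 with $\mathbf{A}_{|\Omega_I}=\mathbf{A}_I$ and $\mathbf{A}_{|\Omega_C}=\mathbf{A}_C$, and $(\mathbf{A},\varphi)$ solves (MQS); conversely, if $(\mathbf{A},\varphi)$ solves (MQS), then there exists $\boldsymbol{\lambda}\in\mathcal{V}_\Gamma^*$ such that $(\mathbf{A}_{|\Omega_I},\mathbf{A}_{|\Omega_C},\varphi,\boldsymbol{\lambda})$ solves (TI).
   Context: Geometry. $\Omega\subset\mathbb{R}^3$ is a bounded Lipschitz domain, split into two non-overlapping subdomains $\Omega_C$ (conductor) and $\Omega_I$ (insulator), with interface $\Gamma=\partial\Omega_C\cap\partial\Omega_I$. Both $\Omega_C$ and $\Omega_I$ are Lipschitz domains of simple topology, in particular simply connected with simply connected boundary. Coefficients. $\sigma\in L^\infty(\Omega)$ is uniformly positive in $\Omega_C$ and zero in $\Omega_I$; $\mu\in L^\infty(\Omega)$ is uniformly positive in $\Omega$. All pairings $\langle\cdot,\cdot\rangle$ below are bilinear (no complex conjugation); $X^*$ denotes the dual of $X$ and $T$ denotes the transpose. Traces. $\mathbf{n}$ is a unit normal on $\Gamma$ with fixed orientation, and $\mathbf{v}_\tau=(\mathbf{n}\times\mathbf{v})\times\mathbf{n}$ is the tangential component (trace) on $\Gamma$ of a field on $\Omega_C$ or $\Omega_I$. $\mathbf{H}(\mathbf{curl}_\Gamma,\Gamma)=\{\mathbf{v}_{\tau|\Gamma}:\mathbf{v}\in\mathbf{H}(\mathbf{curl},\Omega)\}$ is the tangential trace space; the trace operator onto it has a bounded right-inverse,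 and the same trace space results when $\Omega$ is replaced by $\Omega_C$ or $\Omega_I$. Splitting. Either (continuous case) $\mathcal{H}=\mathbf{H}(\mathbf{curl},\Omega)$, $\mathcal{U}=H^1(\Omega)_{/\mathrm{const}}$ and $\mathcal{V}\subset\mathcal{H}$ is a complementary subspace, or (discrete case) $\mathcal{H}\subset\mathbf{H}(\mathbf{curl},\Omega)$, $\mathcal{U}\subset H^1(\Omega)_{/\mathrm{const}}$ and $\mathcal{V}\subset\mathcal{H}$ are discrete (finite-dimensional) subspaces. In both cases $\mathcal{H}=\nabla\mathcal{U}\oplus\mathcal{V}$ is direct (not necessarily orthogonal), and the bilinear form $\int_\Omega\mu^{-1}\mathbf{curl}\,\mathbf{v}\cdot\mathbf{curl}\,\mathbf{w}\,dx$ is coercive on $\mathcal{V}$ (bounded from below by a positive multiple of the squared $\mathbf{H}(\mathbf{curl},\Omega)$-norm). Compatibility. The splitting is compatible with $(\Omega_C,\Omega_I,\Gamma)$ if the following hold. (i) With $\mathcal{H}_\Gamma=\{\mathbf{w}_{\tau|\Gamma}:\mathbf{w}\in\mathcal{H}\}$, $\mathcal{U}_\Gamma=\{u_{|\Gamma}:u\in\mathcal{U}\}$, $\mathcal{V}_\Gamma=\{\mathbf{v}_{\tau|\Gamma}:\mathbf{v}\in\mathcal{V}\}$, one has $\mathcal{H}_\Gamma=\nabla\mathcal{U}_\Gamma\oplus\mathcal{V}_\Gamma$ (here $\nabla$ is the surface gradient). (ii) With $\mathcal{H}_C,\mathcal{U}_C,\mathcal{V}_C$ the spaces of restrictions to $\Omega_C$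 of elements of $\mathcal{H},\mathcal{U},\mathcal{V}$, one has $\mathcal{H}_C=\nabla\mathcal{U}_C\oplus\mathcal{V}_C$. (iii) With $\mathcal{H}_I,\mathcal{U}_I,\mathcal{V}_I$ the spaces of restrictions to $\Omega_I$, one has $\mathcal{H}_I=\nabla\mathcal{U}_I\oplus\mathcal{V}_I$. Functions in $\mathcal{U},\mathcal{U}_C,\mathcal{U}_I,\mathcal{U}_\Gamma$ are understood modulo constants (in the continuous case $\mathcal{U}_C=H^1(\Omega_C)_{/\mathrm{const}}$). Operators on $\mathcal{V}$ and $\mathcal{U}_C$. For $\mathbf{A},\mathbf{w}\in\mathcal{V}$ and $\varphi,q\in\mathcal{U}_C$: $\langle K\mathbf{A},\mathbf{w}\rangle=\int_\Omega\mu^{-1}\mathbf{curl}\,\mathbf{A}\cdot\mathbf{curl}\,\mathbf{w}\,dx$, $\langle M\mathbf{A},\mathbf{w}\rangle=\int_{\Omega_C}\sigma\mathbf{A}\cdot\mathbf{w}\,dx$, $\langle S\mathbf{A},q\rangle=\int_{\Omega_C}\sigma\mathbf{A}\cdot\nabla q\,dx$, $\langle C\varphi,q\rangle=\int_{\Omega_C}\sigma\nabla\varphi\cdot\nabla q\,dx$. Subdomain operators. $K_I:\mathcal{V}_I\to\mathcal{V}_I^*$, $\langle K_I\mathbf{v}_I,\mathbf{w}_I\rangle=\int_{\Omega_I}\mu^{-1}\mathbf{curl}\,\mathbf{v}_I\cdot\mathbf{curl}\,\mathbf{w}_I\,dx$; $K_C,M_C:\mathcal{V}_C\to\mathcal{V}_C^*$,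 $\langle K_C\mathbf{v}_C,\mathbf{w}_C\rangle=\int_{\Omega_C}\mu^{-1}\mathbf{curl}\,\mathbf{v}_C\cdot\mathbf{curl}\,\mathbf{w}_C\,dx$ and $\langle M_C\mathbf{v}_C,\mathbf{w}_C\rangle=\int_{\Omega_C}\sigma\mathbf{v}_C\cdot\mathbf{w}_C\,dx$; $S_C:\mathcal{V}_C\to\mathcal{U}_C^*$, $\langle S_C\mathbf{v}_C,q\rangle=\int_{\Omega_C}\sigma\mathbf{v}_C\cdot\nabla q\,dx$; $C_C:\mathcal{U}_C\to\mathcal{U}_C^*$, $\langle C_Cp,q\rangle=\int_{\Omega_C}\sigma\nabla p\cdot\nabla q\,dx$. The trace operators are $B_C:\mathcal{V}_C\to\mathcal{V}_\Gamma$, $\mathbf{v}_C\mapsto\mathbf{v}_{C,\tau}$, and $B_I:\mathcal{V}_I\to\mathcal{V}_\Gamma$, $\mathbf{v}_I\mapsto-\mathbf{v}_{I,\tau}$. Right-hand sides. $\mathbf{J}\in\mathbf{H}(\mathbf{curl},\Omega)^*$ is a given current satisfying $\langle\mathbf{J},\nabla q\rangle_\Omega=0$ for all $q\in\mathcal{U}$ with $q_{|\overline{\Omega_C}}=0$. Define $\langle J,\mathbf{w}\rangle=\langle\mathbf{J},\mathbf{w}\rangle_\Omega$ for $\mathbf{w}\in\mathcal{V}$, and $j\in\mathcal{U}_C^*$ by $\langle j,q\rangle=\langle\mathbf{J},\nabla(Eq)\rangle_\Omega$ for $q\in\mathcal{U}_C$, where $E:\mathcal{U}_C\to\mathcal{U}$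 is a bounded linear extension operator (the definition does not depend on the choice of $E$). $J_C\in\mathcal{V}_C^*$ and $J_I\in\mathcal{V}_I^*$ are any functionals with $\langle J,\mathbf{v}\rangle=\langle J_C,\mathbf{v}_{|\Omega_C}\rangle+\langle J_I,\mathbf{v}_{|\Omega_I}\rangle$ for all $\mathbf{v}\in\mathcal{V}$.
   Formalization: In the discrete case it is also assumed that fields of H on Ω_C and Ω_I with equal tangential traces on Γ glue to a field of H; for arbitrary finite-dimensional subspaces the claim is false (e.g. U trivial, V spanned by v_C+v_I with v_C, v_I compactly supported in Ω_C, Ω_I). *)

theory Defs
  imports "HOL-Analysis.Analysis" "HOL-Library.Function_Algebras"
begin

text \<open>
  Conventions. Fields are complex valued. A function on an open set X is represented by a total
  function on \<open>real^3\<close> whose values off X are irrelevant, so the restriction of a field to a smaller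
  set is given by the same total function. Equality of elements of \<open>L\<^sup>2(X)\<close> is equality almost
  everywhere in X, and every space of functions on X is a set of representatives that is closed
  under modification on null sets (and, off X, arbitrarily). Addition of functions is the pointwise
  addition of \<^theory>\<open>HOL-Library.Function_Algebras\<close>. All pairings are bilinear.
\<close>

type_synonym point = "real^3"
type_synonym scalar_field = "point \<Rightarrow> complex"
type_synonym vector_field = "point \<Rightarrow> complex^3"

definition cscale :: "complex \<Rightarrow> ('a \<Rightarrow> complex) \<Rightarrow> ('a \<Rightarrow> complex)" where
  "cscale c f = (\<lambda>x. c * f x)"

definition vscale :: "complex \<Rightarrow> vector_field \<Rightarrow> vector_field" where
  "vscale c f = (\<lambda>x. c *s f x)"

definition cdot :: "complex^3 \<Rightarrow> complex^3 \<Rightarrow> complex" where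
  "cdot v w = (\<Sum>i\<in>UNIV. v $ i * w $ i)"

definition conj_field :: "vector_field \<Rightarrow> vector_field" where
  "conj_field v = (\<lambda>x. \<chi> i. cnj (v x $ i))"

definition eq_ae :: "point set \<Rightarrow> (point \<Rightarrow> 'b) \<Rightarrow> (point \<Rightarrow> 'b) \<Rightarrow> bool" where
  "eq_ae X f g \<longleftrightarrow> (AE x in lebesgue_on X. f x = g x)"

definition eq_mod_const :: "point set \<Rightarrow> scalar_field \<Rightarrow> scalar_field \<Rightarrow> bool" where
  "eq_mod_const X f g \<longleftrightarrow> (\<exists>c. AE x in lebesgue_on X. f x = g x + c)"


section \<open>Geometry and coefficients\<close>

text \<open>Bounded and connected open set that lies, near each of its boundary points and in suitable
  Cartesian coordinates, on one side of the graph of a Lipschitz function.\<close>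

definition lipschitz_domain :: "point set \<Rightarrow> bool" where
  "lipschitz_domain X \<longleftrightarrow>
     open X \<and> connected X \<and> bounded X \<and> X \<noteq> {} \<and>
     (\<forall>x\<in>frontier X. \<exists>(Q :: point \<Rightarrow> point) (\<gamma> :: real^2 \<Rightarrow> real) L r.
        orthogonal_transformation Q \<and> L-lipschitz_on UNIV \<gamma> \<and> 0 < r \<and>
        (\<forall>y\<in>ball x r.
           y \<in> X \<longleftrightarrow> Q (y - x) $ 3 < \<gamma> (vector [Q (y - x) $ 1, Q (y - x) $ 2])))"

definition conductor_insulator_geometry ::
    "point set \<Rightarrow> point set \<Rightarrow> point set \<Rightarrow> point set \<Rightarrow> bool" where
  "conductor_insulator_geometry \<Omega> \<Omega>C \<Omega>I \<Gamma> \<longleftrightarrow>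
     lipschitz_domain \<Omega> \<and> lipschitz_domain \<Omega>C \<and> lipschitz_domain \<Omega>I \<and>
     \<Omega>C \<subseteq> \<Omega> \<and> \<Omega>I \<subseteq> \<Omega> \<and> \<Omega>C \<inter> \<Omega>I = {} \<and> closure \<Omega> = closure \<Omega>C \<union> closure \<Omega>I \<and>
     simply_connected \<Omega>C \<and> simply_connected (frontier \<Omega>C) \<and>
     simply_connected \<Omega>I \<and> simply_connected (frontier \<Omega>I) \<and>
     \<Gamma> = frontier \<Omega>C \<inter> frontier \<Omega>I"

definition Linfty :: "point set \<Rightarrow> (point \<Rightarrow> real) \<Rightarrow> bool" where
  "Linfty X f \<longleftrightarrow>
     f \<in> borel_measurable (lebesgue_on X) \<and> (\<exists>B. AE x in lebesgue_on X. \<bar>f x\<bar> \<le> B)"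

definition uniformly_positive :: "point set \<Rightarrow> (point \<Rightarrow> real) \<Rightarrow> bool" where
  "uniformly_positive X f \<longleftrightarrow> (\<exists>c>0. AE x in lebesgue_on X. c \<le> f x)"

definition admissible_coefficients ::
    "point set \<Rightarrow> point set \<Rightarrow> point set \<Rightarrow> (point \<Rightarrow> real) \<Rightarrow> (point \<Rightarrow> real) \<Rightarrow> bool" where
  "admissible_coefficients \<Omega> \<Omega>C \<Omega>I \<sigma> \<mu> \<longleftrightarrow>
     Linfty \<Omega> \<sigma> \<and> uniformly_positive \<Omega>C \<sigma> \<and> (AE x in lebesgue_on \<Omega>I. \<sigma> x = 0) \<and>
     Linfty \<Omega> \<mu> \<and> uniformly_positive \<Omega> \<mu>"


section \<open>Test fields and Sobolev spaces\<close>

definition partial :: "3 \<Rightarrow> (point \<Rightarrow> 'b::real_normed_vector) \<Rightarrow> point \<Rightarrow> 'b" where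
  "partial i f x = frechet_derivative f (at x) (axis i 1)"

definition smooth :: "(point \<Rightarrow> 'b::real_normed_vector) \<Rightarrow> bool" where
  "smooth f \<longleftrightarrow> (\<forall>is x. foldr partial is f differentiable (at x))"

text \<open>\<open>C\<^sub>c\<^sup>\<infinity>(X)\<^sup>3\<close>\<close>

definition test_fields :: "point set \<Rightarrow> vector_field set" where
  "test_fields X = {\<psi>. smooth \<psi> \<and> (\<exists>K. compact K \<and> K \<subseteq> X \<and> (\<forall>x. x \<notin> K \<longrightarrow> \<psi> x = 0))}"

definition classical_curl :: "vector_field \<Rightarrow> vector_field" where
  "classical_curl \<psi> = (\<lambda>x. vector
     [partial 2 \<psi> x $ 3 - partial 3 \<psi> x $ 2,
      partial 3 \<psi> x $ 1 - partial 1 \<psi> x $ 3,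
      partial 1 \<psi> x $ 2 - partial 2 \<psi> x $ 1])"

definition classical_div :: "vector_field \<Rightarrow> scalar_field" where
  "classical_div \<psi> = (\<lambda>x. \<Sum>i\<in>UNIV. partial i \<psi> x $ i)"

definition L2 :: "point set \<Rightarrow> (point \<Rightarrow> 'b::euclidean_space) \<Rightarrow> bool" where
  "L2 X f \<longleftrightarrow>
     f \<in> borel_measurable (lebesgue_on X) \<and> integrable (lebesgue_on X) (\<lambda>x. (norm (f x))\<^sup>2)"

definition L2_norm_on :: "point set \<Rightarrow> (point \<Rightarrow> 'b::euclidean_space) \<Rightarrow> real" where
  "L2_norm_on X f = sqrt (LINT x|lebesgue_on X. (norm (f x))\<^sup>2)"

definition has_weak_curl :: "point set \<Rightarrow> vector_field \<Rightarrow> vector_field \<Rightarrow> bool" where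
  "has_weak_curl X v w \<longleftrightarrow> L2 X w \<and>
     (\<forall>\<psi>\<in>test_fields X.
        (LINT x|lebesgue_on X. cdot (v x) (classical_curl \<psi> x)) =
        (LINT x|lebesgue_on X. cdot (w x) (\<psi> x)))"

definition has_weak_grad :: "point set \<Rightarrow> scalar_field \<Rightarrow> vector_field \<Rightarrow> bool" where
  "has_weak_grad X u g \<longleftrightarrow> L2 X g \<and>
     (\<forall>\<psi>\<in>test_fields X.
        (LINT x|lebesgue_on X. u x * classical_div \<psi> x) =
        - (LINT x|lebesgue_on X. cdot (g x) (\<psi> x)))"

text \<open>The weak curl and the weak gradient are unique only up to null sets; an arbitrary
  representative is selected.\<close>

definition curl :: "point set \<Rightarrow> vector_field \<Rightarrow> vector_field" where
  "curl X v = (SOME w. has_weak_curl X v w)"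

definition grad :: "point set \<Rightarrow> scalar_field \<Rightarrow> vector_field" where
  "grad X u = (SOME g. has_weak_grad X u g)"

definition Hcurl :: "point set \<Rightarrow> vector_field set" where
  "Hcurl X = {v. L2 X v \<and> (\<exists>w. has_weak_curl X v w)}"

definition H1 :: "point set \<Rightarrow> scalar_field set" where
  "H1 X = {u. L2 X u \<and> (\<exists>g. has_weak_grad X u g)}"

definition Hcurl_norm :: "point set \<Rightarrow> vector_field \<Rightarrow> real" where
  "Hcurl_norm X v = sqrt ((L2_norm_on X v)\<^sup>2 + (L2_norm_on X (curl X v))\<^sup>2)"

definition H1_norm :: "point set \<Rightarrow> scalar_field \<Rightarrow> real" where
  "H1_norm X u = sqrt ((L2_norm_on X u)\<^sup>2 + (L2_norm_on X (grad X u))\<^sup>2)"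

text \<open>The norm of the quotient space \<open>H\<^sup>1(X)\<close> modulo constants.\<close>

definition H1_const_norm :: "point set \<Rightarrow> scalar_field \<Rightarrow> real" where
  "H1_const_norm X u = (INF c. H1_norm X (\<lambda>x. u x + c))"


section \<open>Subspaces, duals and direct sums\<close>

definition ae_closed :: "point set \<Rightarrow> (point \<Rightarrow> 'b) set \<Rightarrow> bool" where
  "ae_closed X W \<longleftrightarrow> (\<forall>f\<in>W. \<forall>g. eq_ae X f g \<longrightarrow> g \<in> W)"

definition Hcurl_subspace :: "point set \<Rightarrow> vector_field set \<Rightarrow> bool" where
  "Hcurl_subspace X W \<longleftrightarrow> W \<subseteq> Hcurl X \<and> module.subspace vscale W \<and> ae_closed X W"

text \<open>A subspace of \<open>H\<^sup>1(X)\<close> modulo constants is given by its preimage in \<open>H\<^sup>1(X)\<close>, a subspace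
  containing the constants.\<close>

definition H1_const_subspace :: "point set \<Rightarrow> scalar_field set \<Rightarrow> bool" where
  "H1_const_subspace X W \<longleftrightarrow>
     W \<subseteq> H1 X \<and> module.subspace cscale W \<and> ae_closed X W \<and> (\<forall>c. (\<lambda>x. c) \<in> W)"

definition finite_dim ::
    "(complex \<Rightarrow> (point \<Rightarrow> 'b::ab_group_add) \<Rightarrow> (point \<Rightarrow> 'b)) \<Rightarrow> point set \<Rightarrow>
     (point \<Rightarrow> 'b) set \<Rightarrow> bool" where
  "finite_dim sc X W \<longleftrightarrow>
     (\<exists>B. finite B \<and> B \<subseteq> W \<and> (\<forall>f\<in>W. \<exists>g\<in>module.span sc B. eq_ae X f g))"

definition dual_space ::
    "(complex \<Rightarrow> 'v \<Rightarrow> 'v) \<Rightarrow> ('v \<Rightarrow> real) \<Rightarrow> 'v::plus set \<Rightarrow> ('v \<Rightarrow> complex) set" where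
  "dual_space sc nrm W =
     {l. (\<forall>v\<in>W. \<forall>w\<in>W. l (v + w) = l v + l w) \<and>
         (\<forall>c. \<forall>v\<in>W. l (sc c v) = c * l v) \<and>
         (\<exists>B. \<forall>v\<in>W. cmod (l v) \<le> B * nrm v)}"

text \<open>Z is the set of all representatives of the zero element.\<close>

definition direct_sum :: "'v::plus set \<Rightarrow> 'v set \<Rightarrow> 'v set \<Rightarrow> 'v set \<Rightarrow> bool" where
  "direct_sum Z H A B \<longleftrightarrow> H = {a + b | a b. a \<in> A \<and> b \<in> B} \<and> A \<inter> B = Z"

definition null_fields :: "point set \<Rightarrow> vector_field set" where
  "null_fields X = {v. eq_ae X v 0}"

definition restr_space :: "point set \<Rightarrow> (point \<Rightarrow> 'b) set \<Rightarrow> (point \<Rightarrow> 'b) set" where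
  "restr_space X W = {f. \<exists>g\<in>W. eq_ae X f g}"

definition grads :: "point set \<Rightarrow> scalar_field set \<Rightarrow> vector_field set" where
  "grads X W = {v. \<exists>u\<in>W. eq_ae X v (grad X u)}"


section \<open>Traces on the interface\<close>

text \<open>
  The unit normal n on the interface is oriented from \<open>\<Omega>C\<close> to \<open>\<Omega>I\<close>; the tangential component does
  not depend on the orientation. A field in \<open>H(curl)\<close> has a trace only in the weak sense:
  for fields smooth up to the boundary and \<open>\<psi> \<in> C\<^sub>c\<^sup>\<infinity>(\<Omega>)\<^sup>3\<close>, Green's formula in \<open>\<Omega>C\<close> reads

    \<open>\<integral>\<^bsub>\<Omega>C\<^esub> (curl v \<cdot> \<psi> - v \<cdot> curl \<psi>) dx = \<integral>\<^bsub>\<Gamma>\<^esub> (n \<times> v) \<cdot> \<psi> dS = \<integral>\<^bsub>\<Gamma>\<^esub> v\<^sub>\<tau> \<cdot> (\<psi> \<times> n) dS,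
      v\<^sub>\<tau> = (n \<times> v) \<times> n\<close>,

  and in \<open>\<Omega>I\<close>, whose outer normal is -n, the right-hand side changes sign. The tangential trace
  \<open>v\<^sub>\<tau>\<close> is the functional \<open>\<psi> \<mapsto> \<integral>\<^bsub>\<Gamma>\<^esub> v\<^sub>\<tau> \<cdot> (\<psi> \<times> n) dS\<close>, that is, the distribution \<open>v\<^sub>\<tau>\<close> tested with the
  tangential fields \<open>\<psi> \<times> n\<close>. Similarly, by

    \<open>\<integral>\<^bsub>\<Omega>C\<^esub> (grad u \<cdot> \<psi> + u div \<psi>) dx = \<integral>\<^bsub>\<Gamma>\<^esub> u (\<psi> \<cdot> n) dS\<close>,

  the trace of a scalar function u is the functional \<open>\<psi> \<mapsto> \<integral>\<^bsub>\<Gamma>\<^esub> u (\<psi> \<cdot> n) dS\<close>.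
  Test fields vanish near the boundary of \<open>\<Omega>\<close>, hence on each of the boundaries of \<open>\<Omega>C\<close> and \<open>\<Omega>I\<close>
  they see precisely \<open>\<Gamma> \<inter> \<Omega>\<close>, which is \<open>\<Gamma>\<close> up to a set of surface measure zero. A trace has the
  value 0 on arguments that are not test fields, so that equality of traces is equality of functions.
\<close>

type_synonym trace = "vector_field \<Rightarrow> complex"

definition green_pairing :: "point set \<Rightarrow> vector_field \<Rightarrow> vector_field \<Rightarrow> complex" where
  "green_pairing X v \<psi> =
     (LINT x|lebesgue_on X. cdot (curl X v x) (\<psi> x) - cdot (v x) (classical_curl \<psi> x))"

definition tang_trace_C :: "point set \<Rightarrow> point set \<Rightarrow> vector_field \<Rightarrow> trace" where
  "tang_trace_C \<Omega> \<Omega>C v = (\<lambda>\<psi>. if \<psi> \<in> test_fields \<Omega> then green_pairing \<Omega>C v \<psi> else 0)"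

definition tang_trace_I :: "point set \<Rightarrow> point set \<Rightarrow> vector_field \<Rightarrow> trace" where
  "tang_trace_I \<Omega> \<Omega>I v = (\<lambda>\<psi>. if \<psi> \<in> test_fields \<Omega> then - green_pairing \<Omega>I v \<psi> else 0)"

definition scalar_trace :: "point set \<Rightarrow> point set \<Rightarrow> scalar_field \<Rightarrow> trace" where
  "scalar_trace \<Omega> \<Omega>C u = (\<lambda>\<psi>. if \<psi> \<in> test_fields \<Omega>
     then LINT x|lebesgue_on \<Omega>C. cdot (grad \<Omega>C u x) (\<psi> x) + u x * classical_div \<psi> x else 0)"

text \<open>Distributional surface gradient of a scalar trace g, as a tangential distribution: since the
  surface divergence of \<open>\<psi> \<times> n\<close> is \<open>curl \<psi> \<cdot> n\<close>,

    \<open>\<integral>\<^bsub>\<Gamma>\<^esub> (grad\<^bsub>\<Gamma>\<^esub> g) \<cdot> (\<psi> \<times> n) dS = - \<integral>\<^bsub>\<Gamma>\<^esub> g (curl \<psi> \<cdot> n) dS\<close>.\<close>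

definition surface_grad :: "point set \<Rightarrow> trace \<Rightarrow> trace" where
  "surface_grad \<Omega> g = (\<lambda>\<psi>. if \<psi> \<in> test_fields \<Omega> then - g (classical_curl \<psi>) else 0)"

text \<open>The norm that the trace space inherits from \<open>H(curl,\<Omega>)\<close>. The trace of a field on \<open>\<Omega>\<close> is
  the same from both sides and is taken from \<open>\<Omega>C\<close>.\<close>

definition trace_norm :: "point set \<Rightarrow> point set \<Rightarrow> trace \<Rightarrow> real" where
  "trace_norm \<Omega> \<Omega>C g = (INF w\<in>{w \<in> Hcurl \<Omega>. tang_trace_C \<Omega> \<Omega>C w = g}. Hcurl_norm \<Omega> w)"

definition trace_space :: "point set \<Rightarrow> point set \<Rightarrow> vector_field set \<Rightarrow> trace set" where
  "trace_space \<Omega> \<Omega>C W = tang_trace_C \<Omega> \<Omega>C ` W"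


section \<open>Bilinear forms\<close>

definition curlcurl_form ::
    "point set \<Rightarrow> (point \<Rightarrow> real) \<Rightarrow> vector_field \<Rightarrow> vector_field \<Rightarrow> complex" where
  "curlcurl_form X \<mu> v w =
     (LINT x|lebesgue_on X. of_real (inverse (\<mu> x)) * cdot (curl X v x) (curl X w x))"

definition mass_form ::
    "point set \<Rightarrow> (point \<Rightarrow> real) \<Rightarrow> vector_field \<Rightarrow> vector_field \<Rightarrow> complex" where
  "mass_form X \<sigma> v w = (LINT x|lebesgue_on X. of_real (\<sigma> x) * cdot (v x) (w x))"

definition S_form ::
    "point set \<Rightarrow> (point \<Rightarrow> real) \<Rightarrow> vector_field \<Rightarrow> scalar_field \<Rightarrow> complex" where
  "S_form X \<sigma> v q = mass_form X \<sigma> v (grad X q)"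

definition C_form ::
    "point set \<Rightarrow> (point \<Rightarrow> real) \<Rightarrow> scalar_field \<Rightarrow> scalar_field \<Rightarrow> complex" where
  "C_form X \<sigma> p q = mass_form X \<sigma> (grad X p) (grad X q)"


section \<open>Splittings\<close>

text \<open>Since the form is bilinear, on complex fields its diagonal is \<open>a(v, conj v)\<close>.\<close>

definition coercive_on ::
    "point set \<Rightarrow> (point \<Rightarrow> real) \<Rightarrow> vector_field set \<Rightarrow> bool" where
  "coercive_on \<Omega> \<mu> V \<longleftrightarrow>
     (\<exists>\<alpha>>0. \<forall>v\<in>V. \<alpha> * (Hcurl_norm \<Omega> v)\<^sup>2 \<le> Re (curlcurl_form \<Omega> \<mu> v (conj_field v)))"

definition splitting ::
    "point set \<Rightarrow> (point \<Rightarrow> real) \<Rightarrow> vector_field set \<Rightarrow> scalar_field set \<Rightarrow> vector_field set \<Rightarrow> bool"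
  where
  "splitting \<Omega> \<mu> H U V \<longleftrightarrow>
     Hcurl_subspace \<Omega> H \<and> H1_const_subspace \<Omega> U \<and> Hcurl_subspace \<Omega> V \<and>
     direct_sum (null_fields \<Omega>) H (grads \<Omega> U) V \<and> coercive_on \<Omega> \<mu> V"

definition continuous_case ::
    "point set \<Rightarrow> vector_field set \<Rightarrow> scalar_field set \<Rightarrow> bool" where
  "continuous_case \<Omega> H U \<longleftrightarrow> H = Hcurl \<Omega> \<and> U = H1 \<Omega>"

text \<open>Fields of H on the two subdomains that match tangentially across the interface form a field
  of H. This always holds for \<open>H(curl,\<Omega>)\<close> itself, and for curl-conforming finite elements on a mesh
  that resolves the interface, but not for arbitrary finite-dimensional subspaces.\<close>

definition glues_across_interface ::
    "point set \<Rightarrow> point set \<Rightarrow> point set \<Rightarrow> vector_field set \<Rightarrow> bool" where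
  "glues_across_interface \<Omega> \<Omega>C \<Omega>I H \<longleftrightarrow>
     (\<forall>wC\<in>restr_space \<Omega>C H. \<forall>wI\<in>restr_space \<Omega>I H.
        tang_trace_C \<Omega> \<Omega>C wC = tang_trace_I \<Omega> \<Omega>I wI \<longrightarrow>
        (\<exists>w\<in>H. eq_ae \<Omega>C w wC \<and> eq_ae \<Omega>I w wI))"

definition discrete_case ::
    "point set \<Rightarrow> point set \<Rightarrow> point set \<Rightarrow>
     vector_field set \<Rightarrow> scalar_field set \<Rightarrow> vector_field set \<Rightarrow> bool" where
  "discrete_case \<Omega> \<Omega>C \<Omega>I H U V \<longleftrightarrow>
     finite_dim vscale \<Omega> H \<and> finite_dim cscale \<Omega> U \<and> finite_dim vscale \<Omega> V \<and>
     glues_across_interface \<Omega> \<Omega>C \<Omega>I H"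

definition compatible_splitting ::
    "point set \<Rightarrow> point set \<Rightarrow> point set \<Rightarrow>
     vector_field set \<Rightarrow> scalar_field set \<Rightarrow> vector_field set \<Rightarrow> bool" where
  "compatible_splitting \<Omega> \<Omega>C \<Omega>I H U V \<longleftrightarrow>
     direct_sum {0} (trace_space \<Omega> \<Omega>C H)
       (surface_grad \<Omega> ` scalar_trace \<Omega> \<Omega>C ` U) (trace_space \<Omega> \<Omega>C V) \<and>
     direct_sum (null_fields \<Omega>C) (restr_space \<Omega>C H)
       (grads \<Omega>C (restr_space \<Omega>C U)) (restr_space \<Omega>C V) \<and>
     direct_sum (null_fields \<Omega>I) (restr_space \<Omega>I H)
       (grads \<Omega>I (restr_space \<Omega>I U)) (restr_space \<Omega>I V)"

text \<open>E is linear, bounded and an extension operator on spaces of functions modulo constants.\<close>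

definition extension_operator ::
    "point set \<Rightarrow> point set \<Rightarrow> scalar_field set \<Rightarrow> (scalar_field \<Rightarrow> scalar_field) \<Rightarrow> bool" where
  "extension_operator \<Omega> \<Omega>C U E \<longleftrightarrow>
     (\<forall>q\<in>restr_space \<Omega>C U. E q \<in> U \<and> eq_mod_const \<Omega>C (E q) q) \<and>
     (\<forall>p\<in>restr_space \<Omega>C U. \<forall>q\<in>restr_space \<Omega>C U. eq_mod_const \<Omega> (E (p + q)) (E p + E q)) \<and>
     (\<forall>c. \<forall>q\<in>restr_space \<Omega>C U. eq_mod_const \<Omega> (E (cscale c q)) (cscale c (E q))) \<and>
     (\<exists>B. \<forall>q\<in>restr_space \<Omega>C U. H1_const_norm \<Omega> (E q) \<le> B * H1_const_norm \<Omega>C q)"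


section \<open>The two formulations\<close>

text \<open>Identities in a dual space are tested with all elements of the primal space; a transposed
  operator is the same form with its arguments swapped.\<close>

definition solves_MQS ::
    "point set \<Rightarrow> point set \<Rightarrow> (point \<Rightarrow> real) \<Rightarrow> (point \<Rightarrow> real) \<Rightarrow> real \<Rightarrow>
     scalar_field set \<Rightarrow> vector_field set \<Rightarrow>
     (vector_field \<Rightarrow> complex) \<Rightarrow> (scalar_field \<Rightarrow> complex) \<Rightarrow>
     vector_field \<Rightarrow> scalar_field \<Rightarrow> bool" where
  "solves_MQS \<Omega> \<Omega>C \<sigma> \<mu> \<omega> U V J j A \<phi> \<longleftrightarrow>
     A \<in> V \<and> \<phi> \<in> restr_space \<Omega>C U \<and>
     (\<forall>w\<in>V. curlcurl_form \<Omega> \<mu> A w + \<i> * \<omega> * mass_form \<Omega>C \<sigma> A w + S_form \<Omega>C \<sigma> w \<phi> = J w) \<and>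
     (\<forall>q\<in>restr_space \<Omega>C U. \<i> * \<omega> * S_form \<Omega>C \<sigma> A q + C_form \<Omega>C \<sigma> \<phi> q = j q)"

definition solves_TI ::
    "point set \<Rightarrow> point set \<Rightarrow> point set \<Rightarrow> (point \<Rightarrow> real) \<Rightarrow> (point \<Rightarrow> real) \<Rightarrow> real \<Rightarrow>
     scalar_field set \<Rightarrow> vector_field set \<Rightarrow>
     (vector_field \<Rightarrow> complex) \<Rightarrow> (vector_field \<Rightarrow> complex) \<Rightarrow> (scalar_field \<Rightarrow> complex) \<Rightarrow>
     vector_field \<Rightarrow> vector_field \<Rightarrow> scalar_field \<Rightarrow> (trace \<Rightarrow> complex) \<Rightarrow> bool" where
  "solves_TI \<Omega> \<Omega>C \<Omega>I \<sigma> \<mu> \<omega> U V JI JC j AI AC \<phi> \<Lambda> \<longleftrightarrow>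
     (let VI = restr_space \<Omega>I V; VC = restr_space \<Omega>C V; UC = restr_space \<Omega>C U;
          BI = (\<lambda>v. - tang_trace_I \<Omega> \<Omega>I v); BC = tang_trace_C \<Omega> \<Omega>C
      in AI \<in> VI \<and> AC \<in> VC \<and> \<phi> \<in> UC \<and>
         \<Lambda> \<in> dual_space cscale (trace_norm \<Omega> \<Omega>C) (trace_space \<Omega> \<Omega>C V) \<and>
         (\<forall>w\<in>VI. curlcurl_form \<Omega>I \<mu> AI w + \<Lambda> (BI w) = JI w) \<and>
         (\<forall>w\<in>VC. curlcurl_form \<Omega>C \<mu> AC w + \<i> * \<omega> * mass_form \<Omega>C \<sigma> AC w
                   + S_form \<Omega>C \<sigma> w \<phi> + \<Lambda> (BC w) = JC w) \<and>
         (\<forall>q\<in>UC. \<i> * \<omega> * S_form \<Omega>C \<sigma> AC q + C_form \<Omega>C \<sigma> \<phi> q = j q) \<and>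
         BI AI + BC AC = 0)"

end

theory Submission
  imports Defs "HOL-Computational_Algebra.Polynomial"
begin

text \<open>
  From (TI) to (MQS): two fields with equal tangential traces glue to some \<open>w = \<nabla>u + A\<close> in \<open>H\<close>. On each
  subdomain \<open>\<nabla>u\<close> is a gradient and lies in the restriction of V, so it vanishes there by compatibility;
  hence \<open>w = A \<in> V\<close>. Testing with restrictions of one \<open>w \<in> V\<close> the multiplier terms cancel.

  From (MQS) to (TI): let \<open>F\<close> be the residual of the conductor equation. If \<open>v \<in> V\<close> has zero trace,
  then v on \<open>\<Omega>C\<close> and 0 on \<open>\<Omega>I\<close> glue to an element of V, and (MQS) gives \<open>F v = 0\<close>. So \<open>F\<close> factors
  through the trace, and the multiplier is the induced functional. Its boundedness follows from
  coercivity in the continuous case and from finite dimension in the discrete case.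

  Since curl and grad are arbitrary representatives of weak derivatives, everything relies on the
  uniqueness of weak derivatives up to null sets, that is, on the fundamental lemma of the calculus
  of variations.
\<close>

section \<open>Null sets and square-integrable functions\<close>

text \<open>The row tested with scalar functions is the same in both systems, so only the rows for
  the vector potential need comparison. The obstacle is the boundedness of the multiplier:
  \<open>trace_norm\<close> is an infimum over all extensions in H(curl), which need not lie in
  \<open>V\<close> nor, in the discrete case, even in \<open>H\<close>. In the continuous case an
  arbitrary extension can be exchanged for an element of \<open>V\<close>, because the gradient that
  is split off carries no curl. In the discrete case no such exchange is at hand; instead, the value
  of a trace at one fixed test field is controlled by every extension, and such values separate
  traces. Three facts connect \<open>\<Omega>\<close> with its parts. The interface is a null set,
  because Lipschitz graphs are. A test field of a subdomain is also a test field of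
  \<open>\<Omega>\<close>. Gradients are weakly curl-free, which by duality is the identity div curl
  = 0 for test fields and thus rests on the symmetry of mixed partial derivatives.\<close>

lemma AE_lebesgue_on_iff:
  "X \<in> sets lebesgue \<Longrightarrow> (AE x in lebesgue_on X. P x) \<longleftrightarrow> (AE x in lebesgue. x \<in> X \<longrightarrow> P x)"
  by (subst AE_restrict_space_iff) auto

lemma AE_lebesgue_on_subset:
  assumes "X \<in> sets lebesgue" "Y \<in> sets lebesgue" "Y \<subseteq> X" "AE x in lebesgue_on X. P x"
  shows "AE x in lebesgue_on Y. P x"
  using assms(4) unfolding AE_lebesgue_on_iff[OF assms(1)] AE_lebesgue_on_iff[OF assms(2)]
  by (rule eventually_mono) (use assms(3) in auto)

lemma eq_ae_refl [simp]: "eq_ae X f f"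
  by (simp add: eq_ae_def)

lemma eq_ae_sym: "eq_ae X f g \<Longrightarrow> eq_ae X g f"
  unfolding eq_ae_def by (auto elim: eventually_mono)

lemma eq_ae_trans: "eq_ae X f g \<Longrightarrow> eq_ae X g h \<Longrightarrow> eq_ae X f h"
  unfolding eq_ae_def by (auto elim: eventually_elim2)

lemma eq_ae_subset:
  "X \<in> sets lebesgue \<Longrightarrow> Y \<in> sets lebesgue \<Longrightarrow> Y \<subseteq> X \<Longrightarrow> eq_ae X f g \<Longrightarrow> eq_ae Y f g"
  unfolding eq_ae_def by (rule AE_lebesgue_on_subset)

lemma eq_ae_add: "eq_ae X f g \<Longrightarrow> eq_ae X f' g' \<Longrightarrow> eq_ae X (f + f') (g + g')"
  unfolding eq_ae_def by (auto elim: eventually_elim2)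

lemma eq_ae_diff: "eq_ae X f g \<Longrightarrow> eq_ae X f' g' \<Longrightarrow> eq_ae X (f - f') (g - g')"
  for f g :: "point \<Rightarrow> 'a::ab_group_add"
  unfolding eq_ae_def by (auto elim: eventually_elim2)

lemma eq_ae_vscale: "eq_ae X f g \<Longrightarrow> eq_ae X (vscale c f) (vscale c g)"
  unfolding eq_ae_def vscale_def by (auto elim: eventually_mono)

section \<open>Integrals over subsets\<close>

lemma integrable_lebesgue_on_iff:
  fixes f :: "'a::euclidean_space \<Rightarrow> 'b::{banach, second_countable_topology}"
  assumes "X \<in> sets lebesgue"
  shows "integrable (lebesgue_on X) f \<longleftrightarrow> integrable lebesgue (\<lambda>x. indicator X x *\<^sub>R f x)"
  using assms by (simp add: integrable_restrict_space)

lemma integral_lebesgue_on_eq: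
  fixes f :: "'a::euclidean_space \<Rightarrow> 'b::{banach, second_countable_topology}"
  assumes "X \<in> sets lebesgue"
  shows "(LINT x|lebesgue_on X. f x) = (LINT x|lebesgue. indicator X x *\<^sub>R f x)"
  using assms by (simp add: integral_restrict_space)

lemma integral_lebesgue_on_superset:
  fixes f :: "'a::euclidean_space \<Rightarrow> 'b::{banach, second_countable_topology}"
  assumes "X \<in> sets lebesgue" "Y \<in> sets lebesgue" "Y \<subseteq> X" "\<And>x. x \<notin> Y \<Longrightarrow> f x = 0"
  shows "(LINT x|lebesgue_on X. f x) = (LINT x|lebesgue_on Y. f x)"
proof -
  have "indicator X x *\<^sub>R f x = indicator Y x *\<^sub>R f x" for x
    using assms(3,4) by (auto simp: indicator_def)
  then show ?thesis
    unfolding integral_lebesgue_on_eq[OF assms(1)] integral_lebesgue_on_eq[OF assms(2)] by presburger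
qed

lemma integrable_lebesgue_on_subset:
  fixes f :: "'a::euclidean_space \<Rightarrow> 'b::{banach, second_countable_topology}"
  assumes "X \<in> sets lebesgue" "Y \<in> sets lebesgue" "Y \<subseteq> X" "integrable (lebesgue_on X) f"
  shows "integrable (lebesgue_on Y) f"
proof -
  have "integrable lebesgue (\<lambda>x. indicator Y x *\<^sub>R (indicator X x *\<^sub>R f x))"
    using assms(2,4) unfolding integrable_lebesgue_on_iff[OF assms(1)]
    by (rule integrable_mult_indicator)
  moreover have "indicator Y x *\<^sub>R (indicator X x *\<^sub>R f x) = indicator Y x *\<^sub>R f x" for x
    using assms(3) by (auto simp: indicator_def)
  ultimately show ?thesis
    unfolding integrable_lebesgue_on_iff[OF assms(2)] by (simp only:)
qed

text \<open>Lebesgue measure is complete, so measurability survives a change on a null set;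
  extension by zero moves the question from \<open>X\<close> to the whole space.\<close>

lemma borel_measurable_lebesgue_on_AE:
  fixes f :: "'a::euclidean_space \<Rightarrow> 'b::euclidean_space"
  assumes X: "X \<in> sets lebesgue" and f: "f \<in> borel_measurable (lebesgue_on X)"
    and ae: "AE x in lebesgue_on X. f x = g x"
  shows "g \<in> borel_measurable (lebesgue_on X)"
proof -
  have "AE x in lebesgue. (if x \<in> X then f x else 0) = (if x \<in> X then g x else 0)"
    using ae by (auto simp: AE_lebesgue_on_iff X elim: eventually_mono)
  with f show ?thesis
    unfolding borel_measurable_if[OF X, symmetric] by (rule borel_measurable_AE)
qed

section \<open>Square-integrable functions and their representatives\<close>

lemma L2_cong_ae:
  assumes X: "X \<in> sets lebesgue" and f: "L2 X f" and ae: "eq_ae X f g"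
  shows "L2 X g"
proof -
  have ae': "AE x in lebesgue_on X. f x = g x"
    using ae by (simp add: eq_ae_def)
  have m: "g \<in> borel_measurable (lebesgue_on X)"
    using borel_measurable_lebesgue_on_AE[OF X _ ae'] f by (auto simp: L2_def)
  have "integrable (lebesgue_on X) (\<lambda>x. (norm (g x))\<^sup>2)"
  proof (rule integrable_cong_AE_imp)
    show "integrable (lebesgue_on X) (\<lambda>x. (norm (f x))\<^sup>2)"
      using f by (simp add: L2_def)
    show "AE x in lebesgue_on X. (norm (f x))\<^sup>2 = (norm (g x))\<^sup>2"
      using ae' by (rule eventually_mono) simp
  qed (use m in measurable)
  with m show ?thesis by (simp add: L2_def)
qed

lemma L2_norm_on_cong_ae:
  assumes "L2 X f" "L2 X g" "eq_ae X f g"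
  shows "L2_norm_on X f = L2_norm_on X g"
proof -
  have "(LINT x|lebesgue_on X. (norm (f x))\<^sup>2) = (LINT x|lebesgue_on X. (norm (g x))\<^sup>2)"
    using assms by (intro integral_cong_AE) (auto simp: eq_ae_def L2_def elim: eventually_mono)
  then show ?thesis by (simp add: L2_norm_on_def)
qed

lemma L2_norm_on_nonneg: "0 \<le> L2_norm_on X f"
  by (simp add: L2_norm_on_def)

lemma L2_zero: "L2 X 0"
  by (simp add: L2_def zero_fun_def)

lemma L2_norm_on_zero: "L2_norm_on X 0 = 0"
  by (simp add: L2_norm_on_def)

lemma L2_subset:
  assumes "X \<in> sets lebesgue" "Y \<in> sets lebesgue" "Y \<subseteq> X" "L2 X f"
  shows "L2 Y f"
proof -
  have "integrable (lebesgue_on Y) (\<lambda>x. (norm (f x))\<^sup>2)"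
    by (rule integrable_lebesgue_on_subset[OF assms(1-3)]) (use assms(4) in \<open>simp add: L2_def\<close>)
  moreover have "f \<in> borel_measurable (lebesgue_on Y)"
    by (rule measurable_restrict_mono[OF _ assms(3)]) (use assms(4) in \<open>simp add: L2_def\<close>)
  ultimately show ?thesis by (simp add: L2_def)
qed

lemma L2_norm_on_mono:
  assumes "X \<in> sets lebesgue" "Y \<in> sets lebesgue" "Y \<subseteq> X" "L2 X f"
  shows "L2_norm_on Y f \<le> L2_norm_on X f"
proof -
  have 1: "integrable (lebesgue_on Y) (\<lambda>x. (norm (f x))\<^sup>2)"
    using L2_subset[OF assms] by (simp add: L2_def)
  have "(LINT x|lebesgue_on Y. (norm (f x))\<^sup>2) \<le> (LINT x|lebesgue_on X. (norm (f x))\<^sup>2)"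
    unfolding integral_lebesgue_on_eq[OF assms(1)] integral_lebesgue_on_eq[OF assms(2)]
    using assms(3,4) 1
    by (intro integral_mono)
      (auto simp: integrable_lebesgue_on_iff[OF assms(1), symmetric]
        integrable_lebesgue_on_iff[OF assms(2), symmetric] L2_def
        simp del: real_scaleR_def split: split_indicator)
  then show ?thesis
    by (simp add: L2_norm_on_def)
qed

text \<open>One tool for components, negation, complex multiples and complex conjugation; the last
  is only real-linear, which is all that \<open>bounded_linear\<close> asks.\<close>

lemma L2_bounded_linear:
  fixes f :: "point \<Rightarrow> 'b::euclidean_space" and h :: "'b \<Rightarrow> 'c::euclidean_space"
  assumes "L2 X f" "bounded_linear h"
  shows "L2 X (\<lambda>x. h (f x))"
proof -
  obtain K where K: "\<And>y. norm (h y) \<le> norm y * K"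
    using bounded_linear.bounded[OF assms(2)] by blast
  have m: "h \<in> borel_measurable borel"
    using assms(2) by (intro borel_measurable_continuous_onI linear_continuous_on)
  have m': "(\<lambda>x. h (f x)) \<in> borel_measurable (lebesgue_on X)"
    using assms m by (auto simp: L2_def)
  have "integrable (lebesgue_on X) (\<lambda>x. (norm (h (f x)))\<^sup>2)"
  proof (rule Bochner_Integration.integrable_bound)
    show "integrable (lebesgue_on X) (\<lambda>x. K\<^sup>2 * (norm (f x))\<^sup>2)"
      using assms by (simp add: L2_def)
    have "(norm (h (f x)))\<^sup>2 \<le> K\<^sup>2 * (norm (f x))\<^sup>2" for x
      using power_mono[OF K[of "f x"], of 2] by (simp add: power_mult_distrib mult.commute)
    then show "AE x in lebesgue_on X. norm ((norm (h (f x)))\<^sup>2) \<le> norm (K\<^sup>2 * (norm (f x))\<^sup>2)"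
      by simp
  qed (use m' in simp)
  with m' show ?thesis by (simp add: L2_def)
qed

lemma L2_add:
  fixes f g :: "point \<Rightarrow> 'b::euclidean_space"
  assumes "L2 X f" "L2 X g"
  shows "L2 X (f + g)"
proof -
  have m: "(\<lambda>x. f x + g x) \<in> borel_measurable (lebesgue_on X)"
    using assms by (auto simp: L2_def)
  have "integrable (lebesgue_on X) (\<lambda>x. (norm (f x + g x))\<^sup>2)"
  proof (rule Bochner_Integration.integrable_bound)
    show "integrable (lebesgue_on X) (\<lambda>x. 2 * (norm (f x))\<^sup>2 + 2 * (norm (g x))\<^sup>2)"
      using assms by (simp add: L2_def)
    have "(norm (a + b))\<^sup>2 \<le> 2 * (norm a)\<^sup>2 + 2 * (norm b)\<^sup>2" for a b :: 'b
      using power_mono[OF norm_triangle_ineq[of a b], of 2] sum_squares_bound[of "norm a" "norm b"]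
      by (simp add: power2_sum)
    then show "AE x in lebesgue_on X.
        norm ((norm (f x + g x))\<^sup>2) \<le> norm (2 * (norm (f x))\<^sup>2 + 2 * (norm (g x))\<^sup>2)"
      by (auto intro: order_trans[OF _ abs_ge_self])
  qed (use m in simp)
  with m show ?thesis by (simp add: L2_def plus_fun_def)
qed

section \<open>Cauchy-Schwarz and the bilinear pairing of complex fields\<close>

lemma integrable_mult_of_squares:
  fixes a b :: "'a \<Rightarrow> real"
  assumes [measurable]: "a \<in> borel_measurable M" "b \<in> borel_measurable M"
    and a: "integrable M (\<lambda>x. (a x)\<^sup>2)" and b: "integrable M (\<lambda>x. (b x)\<^sup>2)"
  shows "integrable M (\<lambda>x. a x * b x)"
proof (rule Bochner_Integration.integrable_bound)
  show "integrable M (\<lambda>x. (a x)\<^sup>2 + (b x)\<^sup>2)"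
    using a b by simp
  have "\<bar>s * t\<bar> \<le> s\<^sup>2 + t\<^sup>2" for s t :: real
  proof -
    have "2 * (\<bar>s\<bar> * \<bar>t\<bar>) \<le> s\<^sup>2 + t\<^sup>2"
      using sum_squares_bound[of "\<bar>s\<bar>" "\<bar>t\<bar>"] by simp
    moreover have "0 \<le> \<bar>s\<bar> * \<bar>t\<bar>" by simp
    ultimately show ?thesis
      unfolding abs_mult by linarith
  qed
  then show "AE x in M. norm (a x * b x) \<le> norm ((a x)\<^sup>2 + (b x)\<^sup>2)"
    by simp
qed simp

text \<open>The integral of (s a - t b)^2 is a nonnegative quadratic form in s and t; special values
  of s and t yield the discriminant inequality.\<close>

lemma integral_Cauchy_Schwarz:
  fixes a b :: "'a \<Rightarrow> real"
  assumes [measurable]: "a \<in> borel_measurable M" "b \<in> borel_measurable M"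
    and a: "integrable M (\<lambda>x. (a x)\<^sup>2)" and b: "integrable M (\<lambda>x. (b x)\<^sup>2)"
  shows "(LINT x|M. a x * b x) \<le> sqrt (LINT x|M. (a x)\<^sup>2) * sqrt (LINT x|M. (b x)\<^sup>2)"
proof -
  define p q r where "p = (LINT x|M. (a x)\<^sup>2)" and "q = (LINT x|M. (b x)\<^sup>2)"
    and "r = (LINT x|M. a x * b x)"
  have ab: "integrable M (\<lambda>x. a x * b x)"
    by (rule integrable_mult_of_squares) (use assms in auto)
  have pq: "0 \<le> p" "0 \<le> q" by (simp_all add: p_def q_def)
  have quad: "0 \<le> s\<^sup>2 * p - 2 * s * t * r + t\<^sup>2 * q" for s t
  proof -
    have "0 \<le> (LINT x|M. (s * a x - t * b x)\<^sup>2)" by simp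
    also have "\<dots> = (LINT x|M. s\<^sup>2 * (a x)\<^sup>2 - 2 * s * t * (a x * b x) + t\<^sup>2 * (b x)\<^sup>2)"
      by (intro Bochner_Integration.integral_cong) (auto simp: power2_eq_square algebra_simps)
    also have "\<dots> = s\<^sup>2 * p - 2 * s * t * r + t\<^sup>2 * q"
      using a b ab by (simp add: p_def q_def r_def)
    finally show ?thesis .
  qed
  have "r\<^sup>2 \<le> p * q"
  proof (cases "p = 0")
    case True
    have "r = 0"
    proof (rule ccontr)
      assume "r \<noteq> 0"
      \<comment> \<open>For p = 0 and t = 1 the form is q - 2 s r, and this s brings it down to
        -1.\<close>
      then have "2 * ((q + 1) / (2 * r)) * r = q + 1"
        by simp
      then show False
        using quad[of "(q + 1) / (2 * r)" 1] True by simp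
    qed
    then show ?thesis using pq by simp
  next
    case False
    \<comment> \<open>At s = r, t = p the form factors into p and the discriminant.\<close>
    have "0 \<le> p * (p * q - r\<^sup>2)"
      using quad[of r p] by (simp add: power2_eq_square algebra_simps)
    then show ?thesis
      using False pq by (simp add: zero_le_mult_iff)
  qed
  then have "r \<le> sqrt (p * q)"
    using real_le_rsqrt by blast
  then show ?thesis
    by (simp add: p_def q_def r_def real_sqrt_mult)
qed

lemma norm_cdot_le: "norm (cdot v w) \<le> norm v * norm w"
proof -
  have "norm (cdot v w) \<le> (\<Sum>i\<in>UNIV. \<bar>norm (v $ i)\<bar> * \<bar>norm (w $ i)\<bar>)"
    unfolding cdot_def by (rule order_trans[OF norm_sum]) (simp add: norm_mult)
  also have "\<dots> \<le> norm v * norm w"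
    unfolding norm_vec_def by (rule L2_set_mult_ineq)
  finally show ?thesis .
qed

lemma cdot_add_left: "cdot (u + v) w = cdot u w + cdot v w"
  and cdot_add_right: "cdot w (u + v) = cdot w u + cdot w v"
  and cdot_diff_left: "cdot (u - v) w = cdot u w - cdot v w"
  and cdot_scale_left: "cdot (c *s u) w = c * cdot u w"
  and cdot_scale_right: "cdot w (c *s u) = c * cdot w u"
  and cdot_zero_left [simp]: "cdot 0 w = 0"
  and cdot_zero_right [simp]: "cdot w 0 = 0"
  by (simp_all add: cdot_def algebra_simps sum.distrib sum_distrib_left sum_subtractf)

lemma borel_measurable_vec_nth:
  fixes f :: "'a \<Rightarrow> 'b::euclidean_space ^ 'n"
  assumes "f \<in> borel_measurable M"
  shows "(\<lambda>x. f x $ i) \<in> borel_measurable M"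
  using assms
  by (rule borel_measurable_continuous_on[rotated]) (intro continuous_intros)

lemma cdot_measurable [measurable]:
  assumes "f \<in> borel_measurable M" "g \<in> borel_measurable M"
  shows "(\<lambda>x. cdot (f x) (g x)) \<in> borel_measurable M"
proof -
  have "(\<lambda>x. f x $ i) \<in> borel_measurable M" "(\<lambda>x. g x $ i) \<in> borel_measurable M" for i
    using assms by (auto intro: borel_measurable_vec_nth)
  then show ?thesis
    unfolding cdot_def by (intro borel_measurable_sum borel_measurable_times)
qed

text \<open>A bounded weight \<open>m\<close> covers both \<open>\<sigma>\<close> and the inverse of
  \<open>\<mu>\<close>. On a null set an almost everywhere bound may be negative, hence
  \<open>\<bar>B\<bar>\<close>.\<close>

lemma
  fixes f g :: vector_field
  assumes f: "L2 X f" and g: "L2 X g"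
    and m: "m \<in> borel_measurable (lebesgue_on X)" and B: "AE x in lebesgue_on X. \<bar>m x\<bar> \<le> B"
  shows integrable_weighted_cdot:
      "integrable (lebesgue_on X) (\<lambda>x. of_real (m x) * cdot (f x) (g x))" (is ?int)
    and norm_integral_weighted_cdot_le:
      "norm (LINT x|lebesgue_on X. of_real (m x) * cdot (f x) (g x))
         \<le> \<bar>B\<bar> * (L2_norm_on X f * L2_norm_on X g)" (is ?bd)
proof -
  let ?M = "lebesgue_on X"
  have [measurable]: "f \<in> borel_measurable ?M" "g \<in> borel_measurable ?M" "m \<in> borel_measurable ?M"
    using f g m by (auto simp: L2_def)
  have fg: "integrable ?M (\<lambda>x. norm (f x) * norm (g x))"
    by (rule integrable_mult_of_squares) (use f g in \<open>auto simp: L2_def\<close>)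
  have bd: "AE x in ?M. norm (of_real (m x) * cdot (f x) (g x)) \<le> \<bar>B\<bar> * (norm (f x) * norm (g x))"
    using B
  proof (rule eventually_mono)
    fix x assume "\<bar>m x\<bar> \<le> B"
    then have "\<bar>m x\<bar> \<le> \<bar>B\<bar>" by linarith
    then have "\<bar>m x\<bar> * norm (cdot (f x) (g x)) \<le> \<bar>B\<bar> * (norm (f x) * norm (g x))"
      by (intro mult_mono norm_cdot_le) auto
    then show "norm (of_real (m x) * cdot (f x) (g x)) \<le> \<bar>B\<bar> * (norm (f x) * norm (g x))"
      by (simp add: norm_mult)
  qed
  show ?int
    by (rule Bochner_Integration.integrable_bound[where f="\<lambda>x. \<bar>B\<bar> * (norm (f x) * norm (g x))"])
      (use fg bd in \<open>auto elim: eventually_mono\<close>)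
  have "norm (LINT x|?M. of_real (m x) * cdot (f x) (g x))
      \<le> (LINT x|?M. norm (of_real (m x) * cdot (f x) (g x)))"
    by (rule integral_norm_bound)
  also have "\<dots> \<le> (LINT x|?M. \<bar>B\<bar> * (norm (f x) * norm (g x)))"
    using \<open>?int\<close> fg bd by (intro integral_mono_AE) auto
  also have "\<dots> = \<bar>B\<bar> * (LINT x|?M. norm (f x) * norm (g x))"
    by simp
  also have "\<dots> \<le> \<bar>B\<bar> * (L2_norm_on X f * L2_norm_on X g)"
    unfolding L2_norm_on_def
    using f g by (intro mult_left_mono integral_Cauchy_Schwarz) (auto simp: L2_def)
  finally show ?bd .
qed

lemma integrable_cdot:
  assumes "L2 X f" "L2 X g"
  shows "integrable (lebesgue_on X) (\<lambda>x. cdot (f x) (g x))"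
  using integrable_weighted_cdot[OF assms, of "\<lambda>_. 1" 1] by simp

lemma norm_integral_cdot_le:
  assumes "L2 X f" "L2 X g"
  shows "norm (LINT x|lebesgue_on X. cdot (f x) (g x)) \<le> L2_norm_on X f * L2_norm_on X g"
  using norm_integral_weighted_cdot_le[OF assms, of "\<lambda>_. 1" 1] by simp


section \<open>Lipschitz domains have null boundary\<close>

text \<open>The graph lies in the image of the null plane z_3 = 0 under a Lipschitz map. The map is
  defined on all of R^3 and not on R^2, so that Lipschitz invariance of null sets within one space
  applies.\<close>

lemma negligible_Lipschitz_graph:
  fixes \<gamma> :: "real^2 \<Rightarrow> real"
  assumes Q: "orthogonal_transformation (Q :: point \<Rightarrow> point)" and L: "L-lipschitz_on UNIV \<gamma>"
  shows "negligible {y::point. Q (y - x) $ 3 = \<gamma> (vector [Q (y - x) $ 1, Q (y - x) $ 2])}"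
proof -
  \<comment> \<open>Vertical projection of z onto the graph in the rotated coordinates; the inverse
    \<open>R\<close> of \<open>Q\<close> then leads back to the original ones.\<close>
  define g :: "point \<Rightarrow> point" where
    "g = (\<lambda>z. z - (z $ 3) *\<^sub>R axis 3 1 + \<gamma> (vector [z $ 1, z $ 2]) *\<^sub>R axis 3 1)"
  obtain R where R: "orthogonal_transformation R" "\<And>z. R (Q z) = z"
    using orthogonal_transformation_inv[OF Q] inv_f_f orthogonal_transformation_inj[OF Q] by metis
  have comp: "norm ((vector [u $ 1, u $ 2] :: real^2) - vector [v $ 1, v $ 2]) \<le> 2 * norm (u - v)"
    for u v :: point
  proof -
    have "norm ((vector [u $ 1, u $ 2] :: real^2) - vector [v $ 1, v $ 2])
        \<le> (\<Sum>i\<in>UNIV. \<bar>((vector [u $ 1, u $ 2] :: real^2) - vector [v $ 1, v $ 2]) $ i\<bar>)"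
      by (rule norm_le_l1_cart)
    also have "\<dots> = \<bar>(u - v) $ 1\<bar> + \<bar>(u - v) $ 2\<bar>"
      by (simp add: sum_2)
    also have "\<dots> \<le> 2 * norm (u - v)"
      using component_le_norm_cart[of "u - v" 1] component_le_norm_cart[of "u - v" 2] by linarith
    finally show ?thesis .
  qed
  \<comment> \<open>In the constant, 1 comes from u - v, 1 from its third component, and 2 L from
    \<open>\<gamma>\<close>, whose two arguments differ by at most twice the norm of u - v.\<close>
  have gLip: "norm (g u - g v) \<le> (2 + 2 * L) * norm (u - v)" for u v
  proof -
    have "g u - g v = (u - v) - ((u - v) $ 3) *\<^sub>R axis 3 1
        + (\<gamma> (vector [u $ 1, u $ 2]) - \<gamma> (vector [v $ 1, v $ 2])) *\<^sub>R axis 3 1"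
      by (simp add: g_def algebra_simps)
    moreover have "norm (a - b *\<^sub>R axis 3 1 + c *\<^sub>R axis 3 1) \<le> norm a + \<bar>b\<bar> + \<bar>c\<bar>"
      for a :: point and b c
      using norm_triangle_ineq[of "a - b *\<^sub>R axis 3 1" "c *\<^sub>R axis 3 1"]
        norm_triangle_ineq4[of a "b *\<^sub>R axis 3 1"] by (simp add: norm_axis_1)
    ultimately have "norm (g u - g v) \<le> norm (u - v) + \<bar>(u - v) $ 3\<bar>
        + \<bar>\<gamma> (vector [u $ 1, u $ 2]) - \<gamma> (vector [v $ 1, v $ 2])\<bar>"
      by metis
    moreover have "\<bar>\<gamma> (vector [u $ 1, u $ 2]) - \<gamma> (vector [v $ 1, v $ 2])\<bar> \<le> L * (2 * norm (u - v))"
      using lipschitz_onD[OF L, of "vector [u $ 1, u $ 2]" "vector [v $ 1, v $ 2]"]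
        mult_left_mono[OF comp[of u v] lipschitz_on_nonneg[OF L]]
      by (simp add: dist_norm)
    moreover have "\<bar>(u - v) $ 3\<bar> \<le> norm (u - v)"
      by (rule component_le_norm_cart)
    ultimately show ?thesis
      by (simp add: algebra_simps)
  qed
  let ?f = "\<lambda>z. x + R (g z)"
  have fLip: "norm (?f u - ?f v) \<le> (2 + 2 * L) * norm (u - v)" for u v
  proof -
    have "?f u - ?f v = R (g u - g v)"
      using R(1) by (simp add: orthogonal_transformation_def linear_diff)
    then show ?thesis
      using gLip R(1) by (simp add: orthogonal_transformation_norm)
  qed
  have "negligible {z::point. z $ 3 = 0}"
    by (rule negligible_standard_hyperplane_cart)
  then have "negligible (?f ` {z. z $ 3 = 0})"
    using fLip by (intro negligible_locally_Lipschitz_image) auto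
  moreover have "{y. Q (y - x) $ 3 = \<gamma> (vector [Q (y - x) $ 1, Q (y - x) $ 2])} \<subseteq> ?f ` {z. z $ 3 = 0}"
  proof
    fix y assume "y \<in> {y. Q (y - x) $ 3 = \<gamma> (vector [Q (y - x) $ 1, Q (y - x) $ 2])}"
    then have *: "\<gamma> (vector [Q (y - x) $ 1, Q (y - x) $ 2]) = Q (y - x) $ 3" by simp
    define z :: point where "z = Q (y - x) - (Q (y - x) $ 3) *\<^sub>R axis 3 1"
    have z: "z $ 3 = 0" "z $ 1 = Q (y - x) $ 1" "z $ 2 = Q (y - x) $ 2"
      by (simp_all add: z_def axis_def)
    have "g z = Q (y - x)"
      unfolding g_def z * by (simp add: z_def)
    then have "y = ?f z"
      using R(2) by simp
    with z show "y \<in> ?f ` {z. z $ 3 = 0}" by blast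
  qed
  ultimately show ?thesis
    using negligible_subset by blast
qed

text \<open>Negligibility is local. With \<open>d\<close> the height above the graph, a frontier
  point near \<open>x\<close> has d \<ge> 0, since it is not in the open set \<open>X\<close>, and d
  \<le> 0, since otherwise an open neighbourhood of it would miss \<open>X\<close>. So it lies on
  the graph.\<close>

lemma negligible_frontier_lipschitz_domain:
  assumes "lipschitz_domain X"
  shows "negligible (frontier X)"
  unfolding locally_negligible_alt[of "frontier X"]
proof
  fix x assume "x \<in> frontier X"
  then obtain Q :: "point \<Rightarrow> point" and \<gamma> :: "real^2 \<Rightarrow> real" and L r where
    Q: "orthogonal_transformation Q" and L: "L-lipschitz_on UNIV \<gamma>" and r: "0 < r"
    and loc: "\<And>y. y \<in> ball x r \<Longrightarrow>
      y \<in> X \<longleftrightarrow> Q (y - x) $ 3 < \<gamma> (vector [Q (y - x) $ 1, Q (y - x) $ 2])"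
    using assms unfolding lipschitz_domain_def by blast
  have oX: "open X"
    using assms by (simp add: lipschitz_domain_def)
  define d where "d = (\<lambda>y. Q (y - x) $ 3 - \<gamma> (vector [Q (y - x) $ 1, Q (y - x) $ 2]))"
  have "linear Q"
    using Q by (simp add: orthogonal_transformation_def)
  have cQ: "continuous_on UNIV (\<lambda>y. Q (y - x))"
    by (rule linear_continuous_on_compose[OF _ \<open>linear Q\<close>]) (intro continuous_intros)
  have cQc: "continuous_on UNIV (\<lambda>y. Q (y - x) $ i)" for i
    using cQ by (intro continuous_intros)
  have "continuous_on UNIV (\<lambda>y. vector [Q (y - x) $ 1, Q (y - x) $ 2] :: real^2)"
  proof -
    have "(\<lambda>y. vector [Q (y - x) $ 1, Q (y - x) $ 2] :: real^2)
        = (\<lambda>y. \<chi> i. if i = 1 then Q (y - x) $ 1 else Q (y - x) $ 2)"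
      by (auto simp: vec_eq_iff forall_2)
    moreover have "continuous_on UNIV (\<lambda>y. (\<chi> i::2. if i = 1 then Q (y - x) $ 1 else Q (y - x) $ 2))"
    proof (rule continuous_on_vec_lambda)
      show "continuous_on UNIV (\<lambda>y. if i = 1 then Q (y - x) $ 1 else Q (y - x) $ 2)" for i :: 2
        using cQc by (cases "i = 1") simp_all
    qed
    ultimately show ?thesis by (simp only:)
  qed
  then have "continuous_on UNIV (\<lambda>y. \<gamma> (vector [Q (y - x) $ 1, Q (y - x) $ 2]))"
    by (rule continuous_on_compose2[OF lipschitz_on_continuous_on[OF L]]) simp
  then have cd: "continuous_on UNIV d"
    unfolding d_def by (rule continuous_on_diff[OF cQc])
  have "ball x r \<inter> frontier X \<subseteq> {y. Q (y - x) $ 3 = \<gamma> (vector [Q (y - x) $ 1, Q (y - x) $ 2])}"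
  proof
    fix y assume y: "y \<in> ball x r \<inter> frontier X"
    have "\<not> d y < 0"
      using y loc[of y] oX by (auto simp: d_def frontier_def interior_open)
    moreover have "\<not> 0 < d y"
    proof
      assume "0 < d y"
      define T where "T = ball x r \<inter> {y. 0 < d y}"
      have "open T"
        using cd by (auto simp: T_def intro!: open_Int open_Collect_less continuous_intros)
      moreover have "y \<in> T"
        using y \<open>0 < d y\<close> by (simp add: T_def)
      moreover have "y \<in> closure X"
        using y by (simp add: frontier_def)
      ultimately obtain z where "z \<in> X" "z \<in> T"
        using open_Int_closure_eq_empty[of T X] by blast
      then show False
        using loc[of z] by (auto simp: T_def d_def)
    qed
    ultimately show "y \<in> {y. Q (y - x) $ 3 = \<gamma> (vector [Q (y - x) $ 1, Q (y - x) $ 2])}"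
      by (simp add: d_def)
  qed
  then have "negligible (frontier X \<inter> ball x r)"
    by (subst Int_commute) (rule negligible_subset[OF negligible_Lipschitz_graph[OF Q L]])
  then show "\<exists>N. openin (top_of_set (frontier X)) N \<and> x \<in> N \<and> negligible N"
    using \<open>x \<in> frontier X\<close> r by (intro exI[of _ "frontier X \<inter> ball x r"]) (auto intro: openin_open_Int)
qed


section \<open>Smooth functions and test fields\<close>

lemma partial_eqI: "(f has_derivative f') (at x) \<Longrightarrow> partial i f x = f' (axis i 1)"
  unfolding partial_def by (metis frechet_derivative_at)

text \<open>Smoothness is shown by exhibiting a class of differentiable functions that is closed
  under \<open>partial\<close>. As \<open>foldr\<close> applies the last list entry first, the
  induction takes entries off the end.\<close>

lemma smooth_coinduct:
  assumes "P f"
    and "\<And>g x. P g \<Longrightarrow> g differentiable (at x)"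
    and "\<And>g i. P g \<Longrightarrow> P (partial i g)"
  shows "smooth f"
  unfolding smooth_def
proof (intro allI)
  fix js :: "3 list" and x
  show "foldr partial js f differentiable (at x)"
    using \<open>P f\<close>
  proof (induction js arbitrary: f rule: rev_induct)
    case Nil
    then show ?case using assms(2) by simp
  next
    case (snoc i js)
    then show ?case using assms(3) by simp
  qed
qed

lemma smooth_differentiable: "smooth f \<Longrightarrow> f differentiable (at x)"
  unfolding smooth_def by (metis foldr_Nil id_apply)

lemma smooth_partial:
  assumes "smooth f"
  shows "smooth (partial i f)"
  unfolding smooth_def
proof (intro allI)
  fix js :: "3 list" and x
  show "foldr partial js (partial i f) differentiable (at x)"
    using assms[unfolded smooth_def, rule_format, of "js @ [i]" x] by simp
qed

lemma smooth_has_derivative: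
  "smooth f \<Longrightarrow> (f has_derivative frechet_derivative f (at x)) (at x)"
  using smooth_differentiable frechet_derivative_works by blast

lemma smooth_continuous_on: "smooth f \<Longrightarrow> continuous_on S f"
  by (meson continuous_at_imp_continuous_on differentiable_imp_continuous_within smooth_differentiable)

lemma partial_bounded_linear:
  assumes "bounded_linear h" "f differentiable (at x)"
  shows "partial i (\<lambda>x. h (f x)) x = h (partial i f x)"
proof -
  have "((\<lambda>x. h (f x)) has_derivative (\<lambda>y. h (frechet_derivative f (at x) y))) (at x)"
    using assms(2)[unfolded frechet_derivative_works] by (rule bounded_linear.has_derivative[OF assms(1)])
  from partial_eqI[OF this] show ?thesis
    by (simp add: partial_def)
qed

lemma smooth_bounded_linear:
  assumes "bounded_linear h" "smooth f"
  shows "smooth (\<lambda>x. h (f x))"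
proof (rule smooth_coinduct[where P="\<lambda>g. \<exists>f. smooth f \<and> g = (\<lambda>x. h (f x))"])
  show "\<exists>f'. smooth f' \<and> (\<lambda>x. h (f x)) = (\<lambda>x. h (f' x))"
    using assms by blast
next
  fix g x assume "\<exists>f. smooth f \<and> g = (\<lambda>x. h (f x))"
  then show "g differentiable at x"
    using bounded_linear.has_derivative[OF assms(1)] smooth_has_derivative
    unfolding differentiable_def by blast
next
  fix g i assume "\<exists>f. smooth f \<and> g = (\<lambda>x. h (f x))"
  then obtain f where f: "smooth f" "g = (\<lambda>x. h (f x))" by blast
  have "partial i g = (\<lambda>x. h (partial i f x))"
    using partial_bounded_linear[OF assms(1)] f smooth_differentiable by blast
  then show "\<exists>f. smooth f \<and> partial i g = (\<lambda>x. h (f x))"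
    using smooth_partial[OF f(1)] by blast
qed

lemma partial_add:
  assumes "f differentiable (at x)" "g differentiable (at x)"
  shows "partial i (\<lambda>x. f x + g x) x = partial i f x + partial i g x"
proof -
  have "((\<lambda>x. f x + g x) has_derivative
      (\<lambda>y. frechet_derivative f (at x) y + frechet_derivative g (at x) y)) (at x)"
    using assms[unfolded frechet_derivative_works] by (rule has_derivative_add)
  from partial_eqI[OF this] show ?thesis
    by (simp add: partial_def)
qed

lemma smooth_add:
  assumes "smooth f" "smooth g"
  shows "smooth (\<lambda>x. f x + g x)"
proof (rule smooth_coinduct[where P="\<lambda>h. \<exists>f g. smooth f \<and> smooth g \<and> h = (\<lambda>x. f x + g x)"])
  show "\<exists>f' g'. smooth f' \<and> smooth g' \<and> (\<lambda>x. f x + g x) = (\<lambda>x. f' x + g' x)"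
    using assms by blast
next
  fix h x assume "\<exists>f g. smooth f \<and> smooth g \<and> h = (\<lambda>x. f x + g x)"
  then show "h differentiable at x"
    using smooth_differentiable by (auto intro!: differentiable_add)
next
  fix h i assume "\<exists>f g. smooth f \<and> smooth g \<and> h = (\<lambda>x. f x + g x)"
  then obtain f g where f: "smooth f" "smooth g" "h = (\<lambda>x. f x + g x)" by blast
  have "partial i h = (\<lambda>x. partial i f x + partial i g x)"
    using partial_add f smooth_differentiable by blast
  then show "\<exists>f g. smooth f \<and> smooth g \<and> partial i h = (\<lambda>x. f x + g x)"
    using smooth_partial f by blast
qed

text \<open>The derivative of a product is a sum of two products; closure under sums makes the class
  invariant under \<open>partial\<close>, as \<open>smooth_coinduct\<close> demands.\<close>

inductive sum_of_smooth_products :: "(point \<Rightarrow> real) \<Rightarrow> bool" where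
  product: "smooth f \<Longrightarrow> smooth g \<Longrightarrow> sum_of_smooth_products (\<lambda>x. f x * g x)"
| sum: "sum_of_smooth_products f \<Longrightarrow> sum_of_smooth_products g \<Longrightarrow>
    sum_of_smooth_products (\<lambda>x. f x + g x)"

lemma sum_of_smooth_products_partial:
  "sum_of_smooth_products f \<Longrightarrow>
    (\<forall>x. f differentiable (at x)) \<and> (\<forall>i. sum_of_smooth_products (partial i f))"
proof (induction rule: sum_of_smooth_products.induct)
  case (product f g)
  have d: "((\<lambda>x. f x * g x) has_derivative (\<lambda>y. f x * frechet_derivative g (at x) y
      + frechet_derivative f (at x) y * g x)) (at x)" for x
    using product by (intro has_derivative_mult smooth_has_derivative)
  have "partial i (\<lambda>x. f x * g x) = (\<lambda>x. f x * partial i g x + partial i f x * g x)" for i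
    using partial_eqI[OF d] by (simp add: partial_def fun_eq_iff)
  then show ?case
    using d product smooth_partial
    by (auto simp: differentiable_def intro!: sum_of_smooth_products.intros)
next
  case (sum f g)
  have "partial i (\<lambda>x. f x + g x) = (\<lambda>x. partial i f x + partial i g x)" for i
    using sum partial_add by blast
  then show ?case
    using sum by (auto intro!: sum_of_smooth_products.intros)
qed

lemma smooth_mult:
  fixes f g :: "point \<Rightarrow> real"
  assumes "smooth f" "smooth g"
  shows "smooth (\<lambda>x. f x * g x)"
  using sum_of_smooth_products.product[OF assms]
  by (rule smooth_coinduct) (use sum_of_smooth_products_partial in blast)+

lemma smooth_const: "smooth (\<lambda>x. c)"
proof (rule smooth_coinduct[where P="\<lambda>g. \<exists>c. g = (\<lambda>x. c)"])
  fix g i assume "\<exists>c. g = (\<lambda>x::point. c :: 'a)"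
  then obtain c where "g = (\<lambda>x. c)" by blast
  then have "partial i g = (\<lambda>x. 0)"
    using partial_eqI[OF has_derivative_const[of c]] by auto
  then show "\<exists>c. partial i g = (\<lambda>x. c)" by blast
qed auto

lemma smooth_prod:
  fixes f :: "'i \<Rightarrow> point \<Rightarrow> real"
  assumes "finite I" "\<And>k. k \<in> I \<Longrightarrow> smooth (f k)"
  shows "smooth (\<lambda>x. \<Prod>k\<in>I. f k x)"
  using assms by (induction I rule: finite_induct) (simp_all add: smooth_const smooth_mult)


subsection \<open>Bump functions\<close>

text \<open>Functions of this form are closed under differentiation, and all of them are flat at 0.\<close>

definition flat :: "real poly \<Rightarrow> real \<Rightarrow> real" where
  "flat p t = (if 0 < t then poly p (1 / t) * exp (- (1 / t)) else 0)"

text \<open>With u = 1 / t and du/dt = - u^2, the derivative of p(u) exp(-u) in t is u^2 (p(u) -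
  p'(u)) exp(-u).\<close>

definition flat_deriv :: "real poly \<Rightarrow> real poly" where
  "flat_deriv p = [:0, 0, 1:] * (p - pderiv p)"

lemma poly_times_exp_tendsto_0:
  "((\<lambda>u::real. poly p u * exp (- u)) \<longlongrightarrow> 0) at_top"
proof -
  have "((\<lambda>u::real. \<Sum>k\<le>degree p. coeff p k * (u ^ k / exp u)) \<longlongrightarrow> (\<Sum>k\<le>degree p. coeff p k * 0)) at_top"
    by (intro tendsto_sum tendsto_mult tendsto_const tendsto_power_div_exp_0)
  then show ?thesis
    by (simp add: poly_altdef sum_distrib_right exp_minus divide_inverse mult.assoc)
qed

lemma flat_has_derivative: "(flat p has_real_derivative flat (flat_deriv p) t) (at t)"
proof -
  consider "t < 0" | "t = 0" | "0 < t" by linarith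
  then show ?thesis
  proof cases
    case 1
    then have "((\<lambda>t. 0) has_real_derivative flat (flat_deriv p) t) (at t)"
      by (simp add: flat_def)
    then show ?thesis
      by (rule has_field_derivative_transform_within_open[of _ _ _ "{..<0}"])
        (use 1 in \<open>auto simp: flat_def\<close>)
  next
    case 2
    \<comment> \<open>With u = 1 / h the right difference quotient at 0 becomes u p(u) exp(-u),
      which explains the extra factor \<open>[:0, 1:]\<close>.\<close>
    have "((\<lambda>u. poly ([:0, 1:] * p) u * exp (- u)) \<longlongrightarrow> 0) at_top"
      by (rule poly_times_exp_tendsto_0)
    then have "((\<lambda>h. poly ([:0, 1:] * p) (inverse h) * exp (- inverse h)) \<longlongrightarrow> 0) (at_right 0)"
      by (rule filterlim_compose) (rule filterlim_inverse_at_top_right)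
    then have "((\<lambda>h. flat p h / h) \<longlongrightarrow> 0) (at_right 0)"
      by (rule Lim_transform_eventually)
        (auto simp: eventually_at_filter flat_def field_simps intro!: always_eventually)
    moreover have "((\<lambda>h. flat p h / h) \<longlongrightarrow> 0) (at_left 0)"
      by (rule Lim_transform_eventually[OF tendsto_const])
        (auto simp: eventually_at_filter flat_def intro!: always_eventually)
    ultimately have "((\<lambda>h. flat p h / h) \<longlongrightarrow> 0) (at 0)"
      by (intro filterlim_split_at)
    then show ?thesis
      using 2 by (simp add: DERIV_def flat_def)
  next
    case 3
    have "((\<lambda>t. poly p (1 / t) * exp (- (1 / t))) has_real_derivative
        poly (pderiv p) (1 / t) * (- 1 / t\<^sup>2) * exp (- (1 / t))
          + poly p (1 / t) * (exp (- (1 / t)) * (1 / t\<^sup>2))) (at t)"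
      using 3 by (auto intro!: derivative_eq_intros DERIV_chain2[OF poly_DERIV] simp: power2_eq_square)
    also have "poly (pderiv p) (1 / t) * (- 1 / t\<^sup>2) * exp (- (1 / t))
          + poly p (1 / t) * (exp (- (1 / t)) * (1 / t\<^sup>2)) = flat (flat_deriv p) t"
      using 3 by (simp add: flat_def flat_deriv_def power2_eq_square field_simps)
    finally show ?thesis
      by (rule has_field_derivative_transform_within_open[of _ _ _ "{0<..}"])
        (use 3 in \<open>auto simp: flat_def\<close>)
  qed
qed

lemma flat_affine_has_derivative:
  fixes x :: point
  shows "((\<lambda>x. flat p (s * x $ k + d)) has_derivative
      (\<lambda>y. s * y $ k * flat (flat_deriv p) (s * x $ k + d))) (at x)"
proof -
  have "((\<lambda>x::point. s * x $ k + d) has_derivative (\<lambda>y. s * y $ k)) (at x)"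
    by (auto intro!: derivative_eq_intros bounded_linear.has_derivative[OF bounded_linear_vec_nth])
  from has_derivative_compose[OF this flat_has_derivative[of p, unfolded has_field_derivative_def]]
  show ?thesis by (simp add: mult.commute)
qed

lemma smooth_flat_affine: "smooth (\<lambda>x::point. flat p (s * x $ k + d))"
proof (rule smooth_coinduct[where P="\<lambda>g. \<exists>p. g = (\<lambda>x. flat p (s * x $ k + d))"])
  fix g x assume "\<exists>p. g = (\<lambda>x::point. flat p (s * x $ k + d))"
  then show "g differentiable at x"
    using flat_affine_has_derivative unfolding differentiable_def by blast
next
  fix g and i :: 3 assume "\<exists>p. g = (\<lambda>x::point. flat p (s * x $ k + d))"
  then obtain p where g: "g = (\<lambda>x. flat p (s * x $ k + d))" by blast
  \<comment> \<open>The chain rule factor, zero unless i = k, is absorbed into the polynomial, so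
    the class of functions is left unchanged.\<close>
  have "partial i g = (\<lambda>x. flat (smult (s * axis i 1 $ k) (flat_deriv p)) (s * x $ k + d))"
    using partial_eqI[OF flat_affine_has_derivative] by (auto simp: g flat_def fun_eq_iff)
  then show "\<exists>p. partial i g = (\<lambda>x. flat p (s * x $ k + d))" by blast
qed blast

lemma flat_one_bounds: "0 \<le> flat 1 t" "flat 1 t \<le> 1"
  by (auto simp: flat_def)

lemma flat_one_scaled_tendsto:
  "(\<lambda>n. flat 1 (real n * t)) \<longlonglongrightarrow> (if 0 < t then 1 else 0)"
proof (cases "0 < t")
  case True
  have "(\<lambda>n. exp (- ((1 / t) * (1 / real n)))) \<longlonglongrightarrow> exp (- ((1 / t) * 0))"
    by (intro tendsto_intros lim_1_over_n)
  then have "(\<lambda>n. exp (- (1 / (real n * t)))) \<longlonglongrightarrow> 1"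
    by (simp add: mult.commute)
  \<comment> \<open>Only eventually: at n = 0 division by zero makes the left side 1, while the
    right side is 0.\<close>
  moreover have "\<forall>\<^sub>F n in sequentially. exp (- (1 / (real n * t))) = flat 1 (real n * t)"
    using eventually_gt_at_top[of 0] by eventually_elim (use True in \<open>auto simp: flat_def\<close>)
  ultimately show ?thesis
    using True by (simp add: Lim_transform_eventually)
next
  case False
  then have "flat 1 (real n * t) = 0" for n
    by (simp add: flat_def zero_less_mult_iff)
  then show ?thesis using False by simp
qed

text \<open>Each factor is exp(-1/t) evaluated at n times the signed distance to one face. Growing n
  sharpens the product to the indicator of the open box.\<close>

definition box_bump :: "point \<Rightarrow> point \<Rightarrow> nat \<Rightarrow> point \<Rightarrow> real" where
  "box_bump a b n x = (\<Prod>k\<in>UNIV. flat 1 (real n * (x $ k - a $ k)) * flat 1 (real n * (b $ k - x $ k)))"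

lemma smooth_box_bump: "smooth (box_bump a b n)"
proof -
  have "smooth (\<lambda>x. flat 1 (real n * x $ k + - real n * a $ k) * flat 1 (- real n * x $ k + real n * b $ k))"
    for k
    by (intro smooth_mult smooth_flat_affine)
  then have "smooth (\<lambda>x. \<Prod>k\<in>UNIV.
      flat 1 (real n * x $ k + - real n * a $ k) * flat 1 (- real n * x $ k + real n * b $ k))"
    by (intro smooth_prod) auto
  also have "(\<lambda>x. \<Prod>k\<in>UNIV.
      flat 1 (real n * x $ k + - real n * a $ k) * flat 1 (- real n * x $ k + real n * b $ k)) = box_bump a b n"
    by (simp add: fun_eq_iff box_bump_def algebra_simps)
  finally show ?thesis .
qed

lemma box_bump_bounds: "0 \<le> box_bump a b n x" "box_bump a b n x \<le> 1"
  by (auto simp: box_bump_def flat_one_bounds mult_le_one intro!: prod_nonneg prod_le_1)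

lemma box_bump_eq_0: "x \<notin> box a b \<Longrightarrow> box_bump a b n x = 0"
proof -
  assume "x \<notin> box a b"
  then obtain k where "\<not> (a $ k < x $ k \<and> x $ k < b $ k)"
    by (auto simp: mem_box_cart)
  then have "flat 1 (real n * (x $ k - a $ k)) * flat 1 (real n * (b $ k - x $ k)) = 0"
    by (auto simp: flat_def zero_less_mult_iff)
  then show ?thesis
    unfolding box_bump_def by (intro prod_zero) auto
qed

lemma box_bump_tendsto: "(\<lambda>n. box_bump a b n x) \<longlonglongrightarrow> indicator (box a b) x"
proof (cases "x \<in> box a b")
  case True
  then have "(if 0 < x $ k - a $ k then 1 else (0::real)) * (if 0 < b $ k - x $ k then 1 else 0) = 1" for k
    by (simp add: mem_box_cart)
  moreover have "(\<lambda>n. box_bump a b n x) \<longlonglongrightarrow>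
      (\<Prod>k\<in>UNIV. (if 0 < x $ k - a $ k then 1 else 0) * (if 0 < b $ k - x $ k then 1 else 0))"
    unfolding box_bump_def by (intro tendsto_prod tendsto_mult flat_one_scaled_tendsto)
  ultimately show ?thesis using True by simp
next
  case False
  then show ?thesis by (simp add: box_bump_eq_0)
qed


subsection \<open>Symmetry of second derivatives\<close>

lemma partial_line:
  fixes f :: "point \<Rightarrow> real"
  assumes "smooth f"
  shows "((\<lambda>s. f (x + s *\<^sub>R axis i 1)) has_real_derivative partial i f (x + s *\<^sub>R axis i 1)) (at s)"
proof -
  have "((\<lambda>s. x + s *\<^sub>R axis i 1) has_derivative (\<lambda>h. h *\<^sub>R axis i 1)) (at s)"
    by (auto intro!: derivative_eq_intros)
  from has_derivative_compose[OF this smooth_has_derivative[OF assms]]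
  have "((\<lambda>s. f (x + s *\<^sub>R axis i 1)) has_derivative
      (\<lambda>h. frechet_derivative f (at (x + s *\<^sub>R axis i 1)) (h *\<^sub>R axis i 1))) (at s)" .
  moreover have "linear (frechet_derivative f (at (x + s *\<^sub>R axis i 1)))"
    using assms by (simp add: linear_frechet_derivative smooth_differentiable)
  ultimately show ?thesis
    by (simp add: has_field_derivative_def partial_def linear_scale mult.commute[of _ "frechet_derivative f _ _"])
qed

text \<open>The mean value theorem is applied twice: in direction i to the difference
  \<open>D\<close> of two parallel lines, then in direction j to the partial derivative so
  obtained.\<close>

lemma second_difference_mean_value:
  fixes f :: "point \<Rightarrow> real"
  assumes f: "smooth f" and h: "0 < h"
  shows "\<exists>s t. 0 \<le> s \<and> s \<le> h \<and> 0 \<le> t \<and> t \<le> h \<and>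
    f (x + h *\<^sub>R axis i 1 + h *\<^sub>R axis j 1) - f (x + h *\<^sub>R axis i 1) - f (x + h *\<^sub>R axis j 1) + f x
      = h * h * partial j (partial i f) (x + s *\<^sub>R axis i 1 + t *\<^sub>R axis j 1)"
proof -
  define D where "D s = f ((x + h *\<^sub>R axis j 1) + s *\<^sub>R axis i 1) - f (x + s *\<^sub>R axis i 1)" for s
  have "(D has_real_derivative (partial i f ((x + h *\<^sub>R axis j 1) + s *\<^sub>R axis i 1)
      - partial i f (x + s *\<^sub>R axis i 1))) (at s)" for s
    unfolding D_def by (intro DERIV_diff partial_line f)
  then obtain s where s: "0 < s" "s < h" "D h - D 0 =
      (h - 0) * (partial i f ((x + h *\<^sub>R axis j 1) + s *\<^sub>R axis i 1) - partial i f (x + s *\<^sub>R axis i 1))"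
    using MVT2[OF h, of D "\<lambda>s. partial i f ((x + h *\<^sub>R axis j 1) + s *\<^sub>R axis i 1)
      - partial i f (x + s *\<^sub>R axis i 1)"] by blast
  let ?x = "x + s *\<^sub>R axis i 1"
  obtain t where t: "0 < t" "t < h" "partial i f (?x + h *\<^sub>R axis j 1) - partial i f (?x + 0 *\<^sub>R axis j 1)
      = (h - 0) * partial j (partial i f) (?x + t *\<^sub>R axis j 1)"
    using MVT2[OF h, of "\<lambda>t. partial i f (?x + t *\<^sub>R axis j 1)"
      "\<lambda>t. partial j (partial i f) (?x + t *\<^sub>R axis j 1)"] partial_line[OF smooth_partial[OF f]]
    by blast
  have "f (x + h *\<^sub>R axis i 1 + h *\<^sub>R axis j 1) - f (x + h *\<^sub>R axis i 1) - f (x + h *\<^sub>R axis j 1) + f x = D h - D 0"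
    by (simp add: D_def add_ac)
  also have "\<dots> = h * h * partial j (partial i f) (?x + t *\<^sub>R axis j 1)"
    using s(3) t(3) by (simp add: add_ac)
  finally show ?thesis
    using s t by (intro exI[of _ s] exI[of _ t]) auto
qed

text \<open>The second difference is symmetric in i and j. Its two mean value forms, divided by h^2,
  converge by continuity to the two mixed derivatives.\<close>

lemma partial_commute_real:
  fixes f :: "point \<Rightarrow> real"
  assumes f: "smooth f"
  shows "partial i (partial j f) x = partial j (partial i f) x"
proof -
  define h where "h n = inverse (real (Suc n))" for n
  have h: "0 < h n" for n by (simp add: h_def)
  have h0: "h \<longlonglongrightarrow> 0"
    unfolding h_def by (rule LIMSEQ_inverse_real_of_nat)
  have lim: "(\<lambda>n. g (x + s n *\<^sub>R axis i 1 + t n *\<^sub>R axis j 1)) \<longlonglongrightarrow> g x"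
    if "smooth g" "\<And>n. 0 \<le> s n \<and> s n \<le> h n \<and> 0 \<le> t n \<and> t n \<le> h n" for g :: "point \<Rightarrow> real" and s t i j
  proof -
    have "s \<longlonglongrightarrow> 0" "t \<longlonglongrightarrow> 0"
      by (rule tendsto_sandwich[OF _ _ tendsto_const h0]; use that(2) in simp)+
    then have "(\<lambda>n. x + s n *\<^sub>R axis i 1 + t n *\<^sub>R axis j 1) \<longlonglongrightarrow> x + 0 *\<^sub>R axis i 1 + 0 *\<^sub>R axis j 1"
      by (intro tendsto_intros)
    moreover have "isCont g x"
      using smooth_continuous_on[OF that(1), of UNIV] by (simp add: continuous_on_eq_continuous_at)
    ultimately show ?thesis
      by (intro isCont_tendsto_compose[of x g]) simp_all
  qed
  define d where "d n = f (x + h n *\<^sub>R axis i 1 + h n *\<^sub>R axis j 1)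
      - f (x + h n *\<^sub>R axis i 1) - f (x + h n *\<^sub>R axis j 1) + f x" for n
  have "\<exists>s t. 0 \<le> s \<and> s \<le> h n \<and> 0 \<le> t \<and> t \<le> h n \<and>
      d n = h n * h n * partial j (partial i f) (x + s *\<^sub>R axis i 1 + t *\<^sub>R axis j 1)" for n
    using second_difference_mean_value[OF f h[of n], of x i j] by (simp add: d_def)
  then obtain s t where st: "\<And>n. 0 \<le> s n \<and> s n \<le> h n \<and> 0 \<le> t n \<and> t n \<le> h n"
      "\<And>n. d n = h n * h n * partial j (partial i f) (x + s n *\<^sub>R axis i 1 + t n *\<^sub>R axis j 1)"
    by metis
  have "\<exists>s t. 0 \<le> s \<and> s \<le> h n \<and> 0 \<le> t \<and> t \<le> h n \<and>
      d n = h n * h n * partial i (partial j f) (x + s *\<^sub>R axis j 1 + t *\<^sub>R axis i 1)" for n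
    using second_difference_mean_value[OF f h[of n], of x j i] by (simp add: d_def algebra_simps)
  then obtain s' t' where st': "\<And>n. 0 \<le> s' n \<and> s' n \<le> h n \<and> 0 \<le> t' n \<and> t' n \<le> h n"
      "\<And>n. d n = h n * h n * partial i (partial j f) (x + s' n *\<^sub>R axis j 1 + t' n *\<^sub>R axis i 1)"
    by metis
  have "(\<lambda>n. partial j (partial i f) (x + s n *\<^sub>R axis i 1 + t n *\<^sub>R axis j 1))
      \<longlonglongrightarrow> partial j (partial i f) x"
    by (intro lim smooth_partial f st(1))
  moreover have "(\<lambda>n. partial i (partial j f) (x + s' n *\<^sub>R axis j 1 + t' n *\<^sub>R axis i 1))
      \<longlonglongrightarrow> partial i (partial j f) x"
    by (intro lim smooth_partial f st'(1))
  moreover have "partial j (partial i f) (x + s n *\<^sub>R axis i 1 + t n *\<^sub>R axis j 1)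
      = partial i (partial j f) (x + s' n *\<^sub>R axis j 1 + t' n *\<^sub>R axis i 1)" for n
    using st(2)[of n] st'(2)[of n] h[of n] by simp
  ultimately show ?thesis
    using LIMSEQ_unique by (metis (no_types, lifting) ext)
qed

lemma partial_commute:
  fixes f :: "point \<Rightarrow> 'b::euclidean_space"
  assumes f: "smooth f"
  shows "partial i (partial j f) x = partial j (partial i f) x"
proof (rule euclidean_eqI)
  fix b :: 'b assume "b \<in> Basis"
  have bl: "bounded_linear (\<lambda>y. y \<bullet> b)"
    by (rule bounded_linear_inner_left)
  have 1: "partial i (\<lambda>x. g x \<bullet> b) = (\<lambda>x. partial i g x \<bullet> b)" if "smooth g" for g i
    using partial_bounded_linear[OF bl] that smooth_differentiable by blast
  have "partial i (partial j (\<lambda>x. f x \<bullet> b)) x = partial j (partial i (\<lambda>x. f x \<bullet> b)) x"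
    by (intro partial_commute_real smooth_bounded_linear[OF bl] f)
  then show "partial i (partial j f) x \<bullet> b = partial j (partial i f) x \<bullet> b"
    by (simp add: 1 f smooth_partial)
qed


subsection \<open>Test fields\<close>

lemma test_fields_mono: "Y \<subseteq> X \<Longrightarrow> test_fields Y \<subseteq> test_fields X"
  unfolding test_fields_def by blast

lemma test_fields_zero_outside: "\<psi> \<in> test_fields X \<Longrightarrow> x \<notin> X \<Longrightarrow> \<psi> x = 0"
  unfolding test_fields_def by blast

lemma partial_zero_outside:
  assumes "closed K" "\<And>x. x \<notin> K \<Longrightarrow> f x = 0" "x \<notin> K"
  shows "partial i f x = 0"
proof -
  have "(f has_derivative (\<lambda>y. 0)) (at x)"
    by (rule has_derivative_transform_within_open[OF has_derivative_const[of 0], where s="- K"])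
      (use assms in auto)
  from partial_eqI[OF this] show ?thesis .
qed

lemma partial_test_field_zero_outside:
  assumes "\<psi> \<in> test_fields X" "x \<notin> X"
  shows "partial i \<psi> x = 0"
proof -
  obtain K where K: "compact K" "K \<subseteq> X" "\<And>x. x \<notin> K \<Longrightarrow> \<psi> x = 0"
    using assms(1) by (auto simp: test_fields_def)
  show ?thesis
    by (rule partial_zero_outside[of K]) (use K assms(2) compact_imp_closed in auto)
qed

lemma classical_curl_zero_outside: "\<psi> \<in> test_fields X \<Longrightarrow> x \<notin> X \<Longrightarrow> classical_curl \<psi> x = 0"
  by (simp add: classical_curl_def partial_test_field_zero_outside vec_eq_iff forall_3)

lemma classical_div_zero_outside: "\<psi> \<in> test_fields X \<Longrightarrow> x \<notin> X \<Longrightarrow> classical_div \<psi> x = 0"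
  by (simp add: classical_div_def partial_test_field_zero_outside)

text \<open>The cross product of the i-th unit vector with y. Thus the curl becomes a sum of fixed
  linear maps of partial derivatives, to which smoothness and further differentiation pass
  directly.\<close>

definition curl_part :: "3 \<Rightarrow> complex^3 \<Rightarrow> complex^3" where
  "curl_part i y = (if i = 1 then vector [0, - y $ 3, y $ 2]
     else if i = 2 then vector [y $ 3, 0, - y $ 1] else vector [- y $ 2, y $ 1, 0])"

lemma bounded_linear_curl_part: "bounded_linear (curl_part i)"
  by (intro linear_conv_bounded_linear[THEN iffD1] linearI)
    (auto simp: curl_part_def vec_eq_iff forall_3)

lemma classical_curl_eq_sum: "classical_curl \<psi> = (\<lambda>x. curl_part 1 (partial 1 \<psi> x)
    + curl_part 2 (partial 2 \<psi> x) + curl_part 3 (partial 3 \<psi> x))"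
  by (simp add: fun_eq_iff classical_curl_def curl_part_def vec_eq_iff forall_3)

lemma smooth_classical_curl: "smooth \<psi> \<Longrightarrow> smooth (classical_curl \<psi>)"
  unfolding classical_curl_eq_sum
  by (intro smooth_add smooth_bounded_linear[OF bounded_linear_curl_part] smooth_partial)

lemma classical_curl_test_fields:
  assumes "\<psi> \<in> test_fields X"
  shows "classical_curl \<psi> \<in> test_fields X"
proof -
  obtain K where K: "smooth \<psi>" "compact K" "K \<subseteq> X" "\<forall>x. x \<notin> K \<longrightarrow> \<psi> x = 0"
    using assms by (auto simp: test_fields_def)
  \<comment> \<open>Shrinking the domain to the compact set itself shows that the curl vanishes off
    that same set.\<close>
  then have "\<psi> \<in> test_fields K"
    unfolding test_fields_def by blast
  then have "\<forall>x. x \<notin> K \<longrightarrow> classical_curl \<psi> x = 0"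
    using classical_curl_zero_outside by blast
  then show ?thesis
    using K smooth_classical_curl unfolding test_fields_def by blast
qed

lemma partial_classical_curl:
  assumes "smooth \<psi>"
  shows "partial i (classical_curl \<psi>) = (\<lambda>x. curl_part 1 (partial i (partial 1 \<psi>) x)
    + curl_part 2 (partial i (partial 2 \<psi>) x) + curl_part 3 (partial i (partial 3 \<psi>) x))"
  unfolding classical_curl_eq_sum
  using assms
  by (simp add: fun_eq_iff partial_add partial_bounded_linear[OF bounded_linear_curl_part]
      smooth_differentiable smooth_add smooth_partial smooth_bounded_linear[OF bounded_linear_curl_part])

text \<open>Mixed partial derivatives cancel in pairs; by duality this is what makes weak gradients
  curl-free.\<close>

lemma classical_div_classical_curl:
  assumes "smooth \<psi>"
  shows "classical_div (classical_curl \<psi>) x = 0"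
  using partial_commute[OF assms, of 1 2 x] partial_commute[OF assms, of 1 3 x]
    partial_commute[OF assms, of 2 3 x]
  by (simp add: classical_div_def partial_classical_curl[OF assms] sum_3 curl_part_def)

lemma bounded_linear_cnj_vec: "bounded_linear (\<lambda>v::complex^3. \<chi> i. cnj (v $ i))"
  by (intro linear_conv_bounded_linear[THEN iffD1] linearI) (simp_all add: vec_eq_iff)

lemma conj_field_test_fields: "\<psi> \<in> test_fields X \<Longrightarrow> conj_field \<psi> \<in> test_fields X"
  using smooth_bounded_linear[OF bounded_linear_cnj_vec, of \<psi>]
  by (auto simp: test_fields_def conj_field_def vec_eq_iff)

lemma classical_curl_conj_field:
  assumes "smooth \<psi>"
  shows "classical_curl (conj_field \<psi>) = conj_field (classical_curl \<psi>)"
proof -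
  have "partial i (conj_field \<psi>) x = (\<chi> j. cnj (partial i \<psi> x $ j))" for i x
    unfolding conj_field_def
    using partial_bounded_linear[OF bounded_linear_cnj_vec smooth_differentiable[OF assms]] .
  then show ?thesis
    by (simp add: fun_eq_iff classical_curl_def conj_field_def vec_eq_iff forall_3)
qed

text \<open>Compact support gives square integrability on the whole space. \<open>X\<close> and
  \<open>Y\<close> are kept apart because test fields of \<open>\<Omega>\<close> are integrated over
  the subdomains.\<close>

lemma L2_test_field:
  assumes X: "X \<in> sets lebesgue" and \<psi>: "\<psi> \<in> test_fields Y"
  shows "L2 X \<psi>"
proof -
  obtain K where K: "smooth \<psi>" "compact K" "\<And>x. x \<notin> K \<Longrightarrow> \<psi> x = 0"
    using \<psi> by (auto simp: test_fields_def)
  have c: "continuous_on UNIV \<psi>"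
    using K(1) by (rule smooth_continuous_on)
  have m: "\<psi> \<in> borel_measurable lebesgue"
    using borel_measurable_continuous_onI[OF c] by (intro measurable_completion) simp
  have "continuous_on K (\<lambda>x. (norm (\<psi> x))\<^sup>2)"
    using c by (intro continuous_intros) (auto intro: continuous_on_subset)
  then have "integrable lborel (\<lambda>x. indicator K x *\<^sub>R (norm (\<psi> x))\<^sup>2)"
    using K(2) by (intro borel_integrable_compact) auto
  moreover have "(\<lambda>x. indicator K x *\<^sub>R (norm (\<psi> x))\<^sup>2) = (\<lambda>x. (norm (\<psi> x))\<^sup>2)"
    using K(3) by (auto simp: indicator_def fun_eq_iff)
  ultimately have "integrable lborel (\<lambda>x. (norm (\<psi> x))\<^sup>2)"
    by metis
  then have "integrable lebesgue (\<lambda>x. (norm (\<psi> x))\<^sup>2)"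
    by (simp add: integrable_completion)
  then have "L2 UNIV \<psi>"
    using m by (simp add: L2_def lebesgue_on_UNIV_eq)
  then show ?thesis
    by (rule L2_subset[rotated 3]) (use X in auto)
qed

text \<open>The support has to be a compact subset of \<open>X\<close>, so it is the closed box that
  must fit into \<open>X\<close>.\<close>

lemma box_bump_test_field:
  assumes "cbox a b \<subseteq> X"
  shows "(\<lambda>x. axis i (complex_of_real (box_bump a b n x))) \<in> test_fields X"
proof -
  have "bounded_linear (\<lambda>t. axis i (complex_of_real t) :: complex^3)"
    by (intro linear_conv_bounded_linear[THEN iffD1] linearI)
      (auto simp: axis_def vec_eq_iff, simp add: scaleR_conv_of_real)
  then have "smooth (\<lambda>x. axis i (complex_of_real (box_bump a b n x)) :: complex^3)"
    by (rule smooth_bounded_linear) (rule smooth_box_bump)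
  moreover have "axis i (complex_of_real (box_bump a b n x)) = 0" if "x \<notin> cbox a b" for x
    using that box_subset_cbox[of a b] box_bump_eq_0[of x a b n] by (auto simp: axis_def vec_eq_iff)
  ultimately show ?thesis
    unfolding test_fields_def using assms compact_cbox[of a b] by blast
qed


subsection \<open>The fundamental lemma of the calculus of variations\<close>

text \<open>Dominated convergence along the bumps, which are test fields. A square-integrable
  function is integrable on a bounded box since t \<le> t^2 + 1, and that supplies the dominating
  function.\<close>

lemma integral_box_zero:
  assumes X: "open X" and f: "L2 X f"
    and orth: "\<And>\<psi>. \<psi> \<in> test_fields X \<Longrightarrow> (LINT x|lebesgue_on X. cdot (f x) (\<psi> x)) = 0"
    and ab: "cbox a b \<subseteq> X"
  shows "integrable lebesgue (\<lambda>x. indicator (cbox a b) x *\<^sub>R f x $ i)"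
    and "(LINT x|lebesgue. indicator (box a b) x *\<^sub>R f x $ i) = 0"
proof -
  have Xs: "X \<in> sets lebesgue" using X by simp
  have f': "L2 (cbox a b) (\<lambda>x. f x $ i)"
    by (rule L2_bounded_linear[OF L2_subset[OF Xs _ ab f] bounded_linear_vec_nth]) simp
  have fin: "integrable (lebesgue_on (cbox a b)) (\<lambda>x. 1 :: real)"
    using lmeasurable_cbox[of a b] by (intro finite_measure.integrable_const finite_measure_lebesgue_on)
  have "integrable (lebesgue_on (cbox a b)) (\<lambda>x. f x $ i)"
  proof (rule Bochner_Integration.integrable_bound)
    show "integrable (lebesgue_on (cbox a b)) (\<lambda>x. (norm (f x $ i))\<^sup>2 + 1)"
      using f' fin by (simp add: L2_def)
    have "t \<le> t\<^sup>2 + 1" for t :: real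
      using zero_le_power2[of "t - 1/2"] by (simp add: power2_eq_square algebra_simps)
    then show "AE x in lebesgue_on (cbox a b). norm (f x $ i) \<le> norm ((norm (f x $ i))\<^sup>2 + 1)"
      by (auto intro: order_trans[OF _ abs_ge_self])
  qed (use f' in \<open>simp add: L2_def\<close>)
  then show 1: "integrable lebesgue (\<lambda>x. indicator (cbox a b) x *\<^sub>R f x $ i)"
    by (simp add: integrable_lebesgue_on_iff)
  let ?F = "\<lambda>x. indicator (cbox a b) x *\<^sub>R f x $ i"
  have "(\<lambda>n. LINT x|lebesgue. box_bump a b n x *\<^sub>R ?F x)
      \<longlonglongrightarrow> (LINT x|lebesgue. indicator (box a b) x *\<^sub>R ?F x)"
  proof (rule integral_dominated_convergence[where w="\<lambda>x. norm (?F x)"])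
    show m: "(\<lambda>x. box_bump a b n x *\<^sub>R ?F x) \<in> borel_measurable lebesgue" for n
      using borel_measurable_continuous_onI[OF smooth_continuous_on[OF smooth_box_bump[of a b n]]]
      by (intro borel_measurable_scaleR[OF measurable_completion borel_measurable_integrable[OF 1]]) simp
    show "(\<lambda>x. indicator (box a b) x *\<^sub>R ?F x) \<in> borel_measurable lebesgue"
      by (intro borel_measurable_scaleR[OF borel_measurable_indicator borel_measurable_integrable[OF 1]]) simp
    show "AE x in lebesgue. (\<lambda>n. box_bump a b n x *\<^sub>R ?F x) \<longlonglongrightarrow> indicator (box a b) x *\<^sub>R ?F x"
      by (intro always_eventually allI tendsto_scaleR box_bump_tendsto tendsto_const)
    have "norm (t *\<^sub>R v) \<le> norm v" if "0 \<le> t" "t \<le> 1" for t and v :: complex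
      using that by (simp add: mult_left_le_one_le)
    then show "AE x in lebesgue. norm (box_bump a b n x *\<^sub>R ?F x) \<le> norm (?F x)" for n
      by (intro always_eventually allI) (metis box_bump_bounds)
  qed (rule integrable_norm[OF 1])
  moreover have "(LINT x|lebesgue. box_bump a b n x *\<^sub>R ?F x) = 0" for n
  proof -
    have "box_bump a b n x *\<^sub>R ?F x
        = indicator X x *\<^sub>R cdot (f x) (axis i (complex_of_real (box_bump a b n x)))" for x
    proof (cases "x \<in> cbox a b")
      case True
      have "cdot (f x) (axis i c) = f x $ i * c" for c
      proof -
        have "cdot (f x) (axis i c) = (\<Sum>j\<in>UNIV. if j = i then f x $ j * c else 0)"
          unfolding cdot_def by (intro sum.cong) (auto simp: axis_def)
        then show ?thesis by simp
      qed
      then show ?thesis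
        using True ab by (auto simp: scaleR_conv_of_real)
    next
      case False
      then have "box_bump a b n x = 0"
        using box_bump_eq_0 box_subset_cbox by blast
      moreover have "cdot (f x) (axis i 0) = 0"
        by (simp add: cdot_def axis_def)
      ultimately show ?thesis by simp
    qed
    then show ?thesis
      using orth[OF box_bump_test_field[OF ab, of i n]] by (simp add: integral_lebesgue_on_eq[OF Xs])
  qed
  moreover have "indicator (box a b) x *\<^sub>R ?F x = indicator (box a b) x *\<^sub>R f x $ i" for x
    using box_subset_cbox[of a b] by (auto simp: indicator_def)
  ultimately have "(\<lambda>n. 0) \<longlonglongrightarrow> (LINT x|lebesgue. indicator (box a b) x *\<^sub>R f x $ i)"
    by (simp only:)
  then show "(LINT x|lebesgue. indicator (box a b) x *\<^sub>R f x $ i) = 0"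
    using LIMSEQ_unique tendsto_const by blast
qed

text \<open>Open boxes form an intersection-stable generator of the Borel sets, so the integrals
  vanish on every Borel set by a Dynkin argument, then on every Lebesgue set, which differs from a
  Borel set by a null set. Vanishing on all measurable sets forces the function to be null.\<close>

lemma AE_zero_if_box_integrals_zero:
  fixes g :: "'a::euclidean_space \<Rightarrow> 'b::{banach, second_countable_topology}"
  assumes g: "integrable lebesgue g"
    and box: "\<And>a b. (LINT x|lebesgue. indicator (box a b) x *\<^sub>R g x) = 0"
    and univ: "(LINT x|lebesgue. g x) = 0"
  shows "AE x in lebesgue. g x = 0"
proof -
  let ?I = "\<lambda>A. LINT x|lebesgue. indicator A x *\<^sub>R g x"
  have int: "integrable lebesgue (\<lambda>x. indicator A x *\<^sub>R g x)" if "A \<in> sets lebesgue" for A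
    using that g by (rule integrable_mult_indicator)
  have borel: "?I A = 0" if "A \<in> sets borel" for A
  proof -
    have "Int_stable (range (\<lambda>(a, b). box a b :: 'a set))"
      by (auto simp: Int_stable_def box_Int_box)
    moreover have "range (\<lambda>(a, b). box a b :: 'a set) \<subseteq> Pow UNIV" by simp
    moreover have "A \<in> sigma_sets UNIV (range (\<lambda>(a, b). box a b :: 'a set))"
      using that unfolding borel_eq_box by simp
    ultimately show ?thesis
    proof (induction rule: sigma_sets_induct_disjoint)
      case (basic A)
      then show ?case using box by auto
    next
      case empty
      then show ?case by simp
    next
      case (compl A)
      have A: "A \<in> sets borel"
        using compl.hyps unfolding borel_eq_box by simp
      \<comment> \<open>The whole space is not a box, so its zero integral enters as the separate
        hypothesis \<open>univ\<close>.\<close>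
      have "?I (UNIV - A) = (LINT x|lebesgue. g x - indicator A x *\<^sub>R g x)"
        by (intro Bochner_Integration.integral_cong) (auto simp: indicator_def)
      also have "\<dots> = 0"
        using compl.IH univ g int[of A] A by simp
      finally show ?case .
    next
      case (union F)
      have F: "F i \<in> sets lebesgue" for i
        using union.hyps(2) unfolding borel_eq_box[symmetric]
        by (metis (no_types, lifting) borel_eq_box range_subsetD sets_completionI_sets sets_lborel sets_measure_of top.extremum subset_UNIV Pow_UNIV)
      have "?I (\<Union>i. F i) = (\<Sum>i. ?I (F i))"
        using lebesgue_integral_countable_add[of F lebesgue g] F union.hyps(1) int[of "\<Union>i. F i"]
        by (simp add: set_lebesgue_integral_def set_integrable_def disjoint_family_on_def)
      then show ?case using union.IH by simp
    qed
  qed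
  have "set_lebesgue_integral lebesgue A g = 0" if "A \<in> sets lebesgue" for A
  proof -
    obtain S N N' where A: "A = S \<union> N" "N \<subseteq> N'" "N' \<in> null_sets lborel" "S \<in> sets lborel"
      using \<open>A \<in> sets lebesgue\<close> by (rule sets_completionE)
    have "AE x in lebesgue. x \<notin> N'"
      using A(3) by (intro AE_not_in) (simp add: null_sets_completionI)
    then have "AE x in lebesgue. indicator A x *\<^sub>R g x = indicator S x *\<^sub>R g x"
      by (rule eventually_mono) (use A in \<open>auto simp: indicator_def\<close>)
    then have "?I A = ?I S"
      using int[OF that] int[of S] A(4) by (intro integral_cong_AE) auto
    then show ?thesis
      using borel[of S] A(4) by (simp add: set_lebesgue_integral_def)
  qed
  \<comment> \<open>A countable cover by Borel sets of finite measure also serves for the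
    completion.\<close>
  moreover have "sigma_finite_measure (lebesgue :: 'a measure)"
  proof
    obtain A where "countable A" "A \<subseteq> sets (lborel :: 'a measure)" "\<Union>A = space (lborel :: 'a measure)"
        "\<forall>a\<in>A. emeasure (lborel :: 'a measure) a \<noteq> \<infinity>"
      using lborel.sigma_finite_countable by blast
    then show "\<exists>A. countable A \<and> A \<subseteq> sets (lebesgue :: 'a measure) \<and>
        \<Union>A = space (lebesgue :: 'a measure) \<and> (\<forall>a\<in>A. emeasure (lebesgue :: 'a measure) a \<noteq> \<infinity>)"
      by (intro exI[of _ A]) (auto simp: subset_eq)
  qed
  ultimately show ?thesis
    using sigma_finite_measure.density_zero[OF _ g] by blast
qed

text \<open>Orthogonality controls only boxes whose closure lies in \<open>X\<close>. So
  \<open>f\<close> is cut off to such a box, where every component vanishes almost everywhere, and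
  negligibility, being local, extends this to all of \<open>X\<close>.\<close>

lemma fundamental_lemma:
  assumes X: "open X" and f: "L2 X f"
    and orth: "\<And>\<psi>. \<psi> \<in> test_fields X \<Longrightarrow> (LINT x|lebesgue_on X. cdot (f x) (\<psi> x)) = 0"
  shows "AE x in lebesgue_on X. f x = 0"
proof -
  have loc: "negligible {x \<in> box c d. f x $ i \<noteq> 0}" if cd: "cbox c d \<subseteq> X" for c d i
  proof -
    let ?g = "\<lambda>x. indicator (box c d) x *\<^sub>R f x $ i"
    have "integrable lebesgue (\<lambda>x. indicator (box c d) x *\<^sub>R (indicator (cbox c d) x *\<^sub>R f x $ i))"
      by (intro integrable_mult_indicator integral_box_zero(1)[OF X f orth cd]) simp
    moreover have "indicator (box c d) x *\<^sub>R (indicator (cbox c d) x *\<^sub>R f x $ i) = ?g x" for x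
      using box_subset_cbox[of c d] by (auto simp: indicator_def)
    ultimately have "integrable lebesgue ?g"
      by (simp only:)
    then have "AE x in lebesgue. ?g x = 0"
    proof (rule AE_zero_if_box_integrals_zero)
      fix a b :: point
      \<comment> \<open>Corners of the intersection of two boxes. The closed boxes intersect in the
        same pattern, so the smaller closed box stays inside \<open>X\<close>.\<close>
      define a' b' where "a' = (\<Sum>i\<in>Basis. max (a \<bullet> i) (c \<bullet> i) *\<^sub>R i)"
        and "b' = (\<Sum>i\<in>Basis. min (b \<bullet> i) (d \<bullet> i) *\<^sub>R i)"
      have box: "box a b \<inter> box c d = box a' b'" and "cbox a b \<inter> cbox c d = cbox a' b'"
        by (simp_all only: a'_def b'_def box_Int_box Int_interval)
      with cd have "cbox a' b' \<subseteq> X" by blast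
      from integral_box_zero(2)[OF X f orth this, of i]
      show "(LINT x|lebesgue. indicator (box a b) x *\<^sub>R ?g x) = 0"
        by (simp add: box[symmetric] indicator_inter_arith)
    qed (rule integral_box_zero(2)[OF X f orth cd])
    then have "{x. ?g x \<noteq> 0} \<in> null_sets lebesgue"
      by (simp add: completion.AE_iff_null_sets)
    then show ?thesis
      unfolding negligible_iff_null_sets[symmetric] by (rule negligible_subset) auto
  qed
  have "negligible {x \<in> X. f x \<noteq> 0}"
    unfolding locally_negligible_alt[of "{x \<in> X. f x \<noteq> 0}"]
  proof
    fix x assume "x \<in> {x \<in> X. f x \<noteq> 0}"
    then obtain c d where cd: "x \<in> box c d" "cbox c d \<subseteq> X"
      using open_contains_cbox[OF X] by (metis (mono_tags, lifting) mem_Collect_eq)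
    have "{x \<in> X. f x \<noteq> 0} \<inter> box c d \<subseteq> (\<Union>i. {x \<in> box c d. f x $ i \<noteq> 0})"
      by (auto simp: vec_eq_iff)
    moreover have "negligible (\<Union>i. {x \<in> box c d. f x $ i \<noteq> 0})"
      using loc[OF cd(2)] by (intro negligible_Union) auto
    ultimately have "negligible ({x \<in> X. f x \<noteq> 0} \<inter> box c d)"
      using negligible_subset by blast
    then show "\<exists>N. openin (top_of_set {x \<in> X. f x \<noteq> 0}) N \<and> x \<in> N \<and> negligible N"
      using cd(1) \<open>x \<in> {x \<in> X. f x \<noteq> 0}\<close>
      by (intro exI[of _ "{x \<in> X. f x \<noteq> 0} \<inter> box c d"]) (auto intro: openin_open_Int)
  qed
  then have "AE x in lebesgue. x \<notin> {x \<in> X. f x \<noteq> 0}"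
    by (intro AE_not_in) (simp add: negligible_iff_null_sets)
  then show ?thesis
    using X by (auto simp: AE_lebesgue_on_iff elim: eventually_mono)
qed


section \<open>Weak derivatives\<close>

lemma L2_diff:
  fixes f g :: "point \<Rightarrow> 'b::euclidean_space"
  assumes "L2 X f" "L2 X g"
  shows "L2 X (f - g)"
proof -
  have "L2 X (\<lambda>x. - g x)"
    by (rule L2_bounded_linear[OF assms(2)]) (rule bounded_linear_minus[OF bounded_linear_ident])
  from L2_add[OF assms(1) this] show ?thesis
    by (simp add: plus_fun_def fun_diff_def)
qed

lemma bounded_linear_vec_scale: "bounded_linear (\<lambda>y::complex^3. c *s y)"
  by (intro linear_conv_bounded_linear[THEN iffD1] linearI) (simp_all add: vec_eq_iff algebra_simps)

lemma L2_vscale: "L2 X f \<Longrightarrow> L2 X (vscale c f)"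
  unfolding vscale_def by (rule L2_bounded_linear[OF _ bounded_linear_vec_scale])

lemma L2_conj_field: "L2 X f \<Longrightarrow> L2 X (conj_field f)"
  unfolding conj_field_def by (rule L2_bounded_linear[OF _ bounded_linear_cnj_vec])

lemma norm_conj_vec: "norm ((\<chi> i. cnj (v $ i)) :: complex^3) = norm v"
  by (simp add: norm_vec_def L2_set_def)

lemma integral_cdot_cong_ae:
  assumes "X \<in> sets lebesgue" "L2 X f" "L2 X g" "eq_ae X f f'" "eq_ae X g g'"
  shows "(LINT x|lebesgue_on X. cdot (f x) (g x)) = (LINT x|lebesgue_on X. cdot (f' x) (g' x))"
proof (rule integral_cong_AE)
  have "L2 X f'" "L2 X g'"
    using assms L2_cong_ae by blast+
  then show "(\<lambda>x. cdot (f x) (g x)) \<in> borel_measurable (lebesgue_on X)"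
    "(\<lambda>x. cdot (f' x) (g' x)) \<in> borel_measurable (lebesgue_on X)"
    using assms by (auto simp: L2_def)
  show "AE x in lebesgue_on X. cdot (f x) (g x) = cdot (f' x) (g' x)"
    using assms(4,5) unfolding eq_ae_def by eventually_elim simp
qed

lemma open_lebesgue: "open X \<Longrightarrow> X \<in> sets lebesgue"
  by simp

lemma eq_ae_if_orthogonal:
  assumes X: "open X" and fg: "L2 X f" "L2 X g"
    and eq: "\<And>\<psi>. \<psi> \<in> test_fields X \<Longrightarrow>
      (LINT x|lebesgue_on X. cdot (f x) (\<psi> x)) = (LINT x|lebesgue_on X. cdot (g x) (\<psi> x))"
  shows "eq_ae X f g"
proof -
  have "(LINT x|lebesgue_on X. cdot ((f - g) x) (\<psi> x)) = 0" if "\<psi> \<in> test_fields X" for \<psi>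
  proof -
    have \<psi>: "L2 X \<psi>"
      using L2_test_field[OF open_lebesgue[OF X] that] .
    show ?thesis
      using eq[OF that] integrable_cdot[OF fg(1) \<psi>] integrable_cdot[OF fg(2) \<psi>]
      by (simp add: cdot_diff_left)
  qed
  from fundamental_lemma[OF X L2_diff[OF fg] this] show ?thesis
    by (simp add: eq_ae_def)
qed

lemma has_weak_curl_unique:
  assumes "open X" "has_weak_curl X v w" "has_weak_curl X v w'"
  shows "eq_ae X w w'"
  by (rule eq_ae_if_orthogonal[OF assms(1)]) (use assms(2,3) in \<open>auto simp: has_weak_curl_def\<close>)

lemma has_weak_grad_unique:
  assumes "open X" "has_weak_grad X u g" "has_weak_grad X u g'"
  shows "eq_ae X g g'"
  by (rule eq_ae_if_orthogonal[OF assms(1)]) (use assms(2,3) in \<open>auto simp: has_weak_grad_def\<close>)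

lemma HcurlD:
  assumes "v \<in> Hcurl X"
  shows "L2 X v" "has_weak_curl X v (curl X v)" "L2 X (curl X v)"
proof -
  show "L2 X v" using assms by (simp add: Hcurl_def)
  show 1: "has_weak_curl X v (curl X v)"
    using assms someI_ex[of "has_weak_curl X v"] by (simp add: Hcurl_def curl_def)
  show "L2 X (curl X v)" using 1 by (simp add: has_weak_curl_def)
qed

lemma H1D:
  assumes "u \<in> H1 X"
  shows "L2 X u" "has_weak_grad X u (grad X u)" "L2 X (grad X u)"
proof -
  show "L2 X u" using assms by (simp add: H1_def)
  show 1: "has_weak_grad X u (grad X u)"
    using assms someI_ex[of "has_weak_grad X u"] by (simp add: H1_def grad_def)
  show "L2 X (grad X u)" using 1 by (simp add: has_weak_grad_def)
qed

lemma HcurlI: "L2 X v \<Longrightarrow> has_weak_curl X v w \<Longrightarrow> v \<in> Hcurl X"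
  by (auto simp: Hcurl_def)

lemma curl_eq_ae: "open X \<Longrightarrow> L2 X v \<Longrightarrow> has_weak_curl X v w \<Longrightarrow> eq_ae X (curl X v) w"
  using has_weak_curl_unique HcurlD(2) HcurlI by blast

lemma has_weak_curl_cong:
  assumes X: "open X" and v: "L2 X v" "eq_ae X v v'" and w: "has_weak_curl X v w"
  shows "has_weak_curl X v' w"
  unfolding has_weak_curl_def
proof (intro conjI ballI)
  show "L2 X w" using w by (simp add: has_weak_curl_def)
  fix \<psi> assume \<psi>: "\<psi> \<in> test_fields X"
  have "L2 X (classical_curl \<psi>)"
    by (rule L2_test_field[OF open_lebesgue[OF X] classical_curl_test_fields[OF \<psi>]])
  from integral_cdot_cong_ae[OF open_lebesgue[OF X] v(1) this v(2) eq_ae_refl]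
  show "(LINT x|lebesgue_on X. cdot (v' x) (classical_curl \<psi> x)) = (LINT x|lebesgue_on X. cdot (w x) (\<psi> x))"
    using w \<psi> by (simp add: has_weak_curl_def)
qed

lemma
  assumes X: "open X" and v: "v \<in> Hcurl X" "eq_ae X v v'"
  shows Hcurl_cong: "v' \<in> Hcurl X" and curl_cong: "eq_ae X (curl X v) (curl X v')"
proof -
  have 1: "has_weak_curl X v' (curl X v)"
    using has_weak_curl_cong[OF X HcurlD(1)[OF v(1)] v(2) HcurlD(2)[OF v(1)]] .
  have 2: "L2 X v'"
    using L2_cong_ae[OF open_lebesgue[OF X] HcurlD(1)[OF v(1)] v(2)] .
  show "v' \<in> Hcurl X" using 1 2 by (rule HcurlI[rotated])
  show "eq_ae X (curl X v) (curl X v')"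
    using curl_eq_ae[OF X 2 1] by (rule eq_ae_sym)
qed

lemma has_weak_curl_add:
  assumes X: "open X" and L2: "L2 X v" "L2 X v'"
    and w: "has_weak_curl X v w" "has_weak_curl X v' w'"
  shows "has_weak_curl X (v + v') (w + w')"
  unfolding has_weak_curl_def
proof (intro conjI ballI)
  have W: "L2 X w" "L2 X w'" using w by (simp_all add: has_weak_curl_def)
  then show "L2 X (w + w')" by (rule L2_add)
  fix \<psi> assume \<psi>: "\<psi> \<in> test_fields X"
  have c: "L2 X \<psi>" "L2 X (classical_curl \<psi>)"
    using L2_test_field[OF open_lebesgue[OF X]] classical_curl_test_fields \<psi> by blast+
  show "(LINT x|lebesgue_on X. cdot ((v + v') x) (classical_curl \<psi> x))
      = (LINT x|lebesgue_on X. cdot ((w + w') x) (\<psi> x))"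
    using w \<psi> W L2 c by (simp add: cdot_add_left integrable_cdot has_weak_curl_def)
qed

lemma has_weak_curl_vscale:
  assumes "has_weak_curl X v w"
  shows "has_weak_curl X (vscale c v) (vscale c w)"
  using assms by (auto simp: has_weak_curl_def L2_vscale) (auto simp: vscale_def cdot_scale_left)

lemma has_weak_curl_zero: "has_weak_curl X 0 0"
  by (simp add: has_weak_curl_def L2_zero)

lemma
  assumes X: "open X" and uv: "u \<in> Hcurl X" "v \<in> Hcurl X"
  shows Hcurl_add: "u + v \<in> Hcurl X"
    and curl_add: "eq_ae X (curl X (u + v)) (curl X u + curl X v)"
proof -
  have 1: "has_weak_curl X (u + v) (curl X u + curl X v)"
    using uv by (intro has_weak_curl_add[OF X] HcurlD)
  have 2: "L2 X (u + v)"
    using uv by (intro L2_add HcurlD)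
  show "u + v \<in> Hcurl X" using 1 2 by (rule HcurlI[rotated])
  show "eq_ae X (curl X (u + v)) (curl X u + curl X v)"
    by (rule curl_eq_ae[OF X 2 1])
qed

lemma
  assumes X: "open X" and v: "v \<in> Hcurl X"
  shows Hcurl_vscale: "vscale c v \<in> Hcurl X"
    and curl_vscale: "eq_ae X (curl X (vscale c v)) (vscale c (curl X v))"
proof -
  have 1: "has_weak_curl X (vscale c v) (vscale c (curl X v))"
    using v by (intro has_weak_curl_vscale HcurlD)
  have 2: "L2 X (vscale c v)"
    using v by (intro L2_vscale HcurlD)
  show "vscale c v \<in> Hcurl X" using 1 2 by (rule HcurlI[rotated])
  show "eq_ae X (curl X (vscale c v)) (vscale c (curl X v))"
    by (rule curl_eq_ae[OF X 2 1])
qed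

lemma zero_Hcurl: "0 \<in> Hcurl X"
  by (rule HcurlI[OF L2_zero has_weak_curl_zero])

lemma curl_null:
  assumes X: "open X" and v: "eq_ae X v 0"
  shows "eq_ae X (curl X v) 0"
proof -
  have "eq_ae X (curl X 0) 0"
    by (rule curl_eq_ae[OF X L2_zero has_weak_curl_zero])
  moreover have "eq_ae X (curl X 0) (curl X v)"
    by (rule curl_cong[OF X zero_Hcurl eq_ae_sym[OF v]])
  ultimately show ?thesis
    using eq_ae_sym eq_ae_trans by blast
qed

text \<open>Conjugates of test fields are test fields, so conjugation can be moved across the
  bilinear pairing. It is required because coercivity is expressed through
  \<open>conj_field\<close>.\<close>

lemma
  assumes X: "open X" and v: "v \<in> Hcurl X"
  shows Hcurl_conj_field: "conj_field v \<in> Hcurl X"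
    and curl_conj_field: "eq_ae X (curl X (conj_field v)) (conj_field (curl X v))"
proof -
  have c: "cdot (conj_field u x) y = cnj (cdot (u x) (\<chi> i. cnj (y $ i)))" for u x y
    by (simp add: cdot_def conj_field_def)
  have 1: "has_weak_curl X (conj_field v) (conj_field (curl X v))"
    unfolding has_weak_curl_def
  proof (intro conjI ballI)
    show "L2 X (conj_field (curl X v))"
      using v by (intro L2_conj_field HcurlD)
    fix \<psi> assume \<psi>: "\<psi> \<in> test_fields X"
    then have s: "smooth \<psi>" by (simp add: test_fields_def)
    have "(LINT x|lebesgue_on X. cdot (conj_field v x) (classical_curl \<psi> x))
        = cnj (LINT x|lebesgue_on X. cdot (v x) (conj_field (classical_curl \<psi>) x))"
      unfolding c by (simp add: conj_field_def)
    also have "\<dots> = cnj (LINT x|lebesgue_on X. cdot (curl X v x) (conj_field \<psi> x))"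
      using HcurlD(2)[OF v] conj_field_test_fields[OF \<psi>]
      by (simp add: has_weak_curl_def flip: classical_curl_conj_field[OF s])
    also have "\<dots> = (LINT x|lebesgue_on X. cdot (conj_field (curl X v) x) (\<psi> x))"
      unfolding c by (simp add: conj_field_def)
    finally show "(LINT x|lebesgue_on X. cdot (conj_field v x) (classical_curl \<psi> x))
        = (LINT x|lebesgue_on X. cdot (conj_field (curl X v) x) (\<psi> x))" .
  qed
  have 2: "L2 X (conj_field v)"
    using v by (intro L2_conj_field HcurlD)
  show "conj_field v \<in> Hcurl X" using 1 2 by (rule HcurlI[rotated])
  show "eq_ae X (curl X (conj_field v)) (conj_field (curl X v))"
    by (rule curl_eq_ae[OF X 2 1])
qed

text \<open>A test field of \<open>Y\<close>, together with its derivatives, vanishes off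
  \<open>Y\<close>, so its integrals over \<open>X\<close> and over \<open>Y\<close> agree and the
  weak curl on \<open>X\<close> restricts to one on \<open>Y\<close>.\<close>

lemma
  assumes X: "open X" and Y: "open Y" "Y \<subseteq> X" and v: "v \<in> Hcurl X"
  shows Hcurl_subset: "v \<in> Hcurl Y"
    and curl_subset: "eq_ae Y (curl Y v) (curl X v)"
proof -
  note s = open_lebesgue[OF X] open_lebesgue[OF Y(1)] Y(2)
  have 1: "has_weak_curl Y v (curl X v)"
    unfolding has_weak_curl_def
  proof (intro conjI ballI)
    show "L2 Y (curl X v)"
      by (rule L2_subset[OF s HcurlD(3)[OF v]])
    fix \<psi> assume \<psi>: "\<psi> \<in> test_fields Y"
    then have "\<psi> \<in> test_fields X"
      using test_fields_mono[OF Y(2)] by blast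
    moreover have "(LINT x|lebesgue_on X. cdot (v x) (classical_curl \<psi> x))
        = (LINT x|lebesgue_on Y. cdot (v x) (classical_curl \<psi> x))"
      by (rule integral_lebesgue_on_superset[OF s]) (simp add: classical_curl_zero_outside[OF \<psi>])
    moreover have "(LINT x|lebesgue_on X. cdot (curl X v x) (\<psi> x))
        = (LINT x|lebesgue_on Y. cdot (curl X v x) (\<psi> x))"
      by (rule integral_lebesgue_on_superset[OF s]) (simp add: test_fields_zero_outside[OF \<psi>])
    ultimately show "(LINT x|lebesgue_on Y. cdot (v x) (classical_curl \<psi> x))
        = (LINT x|lebesgue_on Y. cdot (curl X v x) (\<psi> x))"
      using HcurlD(2)[OF v] by (simp add: has_weak_curl_def)
  qed
  have 2: "L2 Y v"
    by (rule L2_subset[OF s HcurlD(1)[OF v]])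
  show "v \<in> Hcurl Y" using 1 2 by (rule HcurlI[rotated])
  show "eq_ae Y (curl Y v) (curl X v)"
    by (rule curl_eq_ae[OF Y(1) 2 1])
qed

lemma
  assumes X: "open X" and Y: "open Y" "Y \<subseteq> X" and u: "u \<in> H1 X"
  shows H1_subset: "u \<in> H1 Y"
    and grad_subset: "eq_ae Y (grad Y u) (grad X u)"
proof -
  note s = open_lebesgue[OF X] open_lebesgue[OF Y(1)] Y(2)
  have 1: "has_weak_grad Y u (grad X u)"
    unfolding has_weak_grad_def
  proof (intro conjI ballI)
    show "L2 Y (grad X u)"
      by (rule L2_subset[OF s H1D(3)[OF u]])
    fix \<psi> assume \<psi>: "\<psi> \<in> test_fields Y"
    then have "\<psi> \<in> test_fields X"
      using test_fields_mono[OF Y(2)] by blast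
    moreover have "(LINT x|lebesgue_on X. u x * classical_div \<psi> x)
        = (LINT x|lebesgue_on Y. u x * classical_div \<psi> x)"
      by (rule integral_lebesgue_on_superset[OF s]) (simp add: classical_div_zero_outside[OF \<psi>])
    moreover have "(LINT x|lebesgue_on X. cdot (grad X u x) (\<psi> x))
        = (LINT x|lebesgue_on Y. cdot (grad X u x) (\<psi> x))"
      by (rule integral_lebesgue_on_superset[OF s]) (simp add: test_fields_zero_outside[OF \<psi>])
    ultimately show "(LINT x|lebesgue_on Y. u x * classical_div \<psi> x)
        = - (LINT x|lebesgue_on Y. cdot (grad X u x) (\<psi> x))"
      using H1D(2)[OF u] by (simp add: has_weak_grad_def)
  qed
  have 2: "L2 Y u"
    by (rule L2_subset[OF s H1D(1)[OF u]])
  show Y': "u \<in> H1 Y" using 1 2 by (auto simp: H1_def)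
  show "eq_ae Y (grad Y u) (grad X u)"
    by (rule has_weak_grad_unique[OF Y(1) H1D(2)[OF Y'] 1])
qed

lemma H1_cong:
  assumes X: "open X" and u: "u \<in> H1 X" "eq_ae X u u'"
  shows "u' \<in> H1 X"
proof -
  have u': "L2 X u'"
    using L2_cong_ae[OF open_lebesgue[OF X] H1D(1)[OF u(1)] u(2)] .
  have "has_weak_grad X u' (grad X u)"
    unfolding has_weak_grad_def
  proof (intro conjI ballI)
    show "L2 X (grad X u)" using u(1) by (rule H1D)
    fix \<psi> assume \<psi>: "\<psi> \<in> test_fields X"
    have m: "classical_div \<psi> \<in> borel_measurable (lebesgue_on X)"
    proof -
      have s: "smooth \<psi>" using \<psi> by (simp add: test_fields_def)
      have "continuous_on UNIV (classical_div \<psi>)"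
        unfolding classical_div_def using smooth_continuous_on[OF smooth_partial[OF s]]
        by (intro continuous_intros)
      then show ?thesis
        by (intro measurable_restrict_space1 measurable_completion) (simp add: borel_measurable_continuous_onI)
    qed
    have "(LINT x|lebesgue_on X. u' x * classical_div \<psi> x) = (LINT x|lebesgue_on X. u x * classical_div \<psi> x)"
      using u(2) m u' H1D(1)[OF u(1)]
      by (intro integral_cong_AE) (auto simp: eq_ae_def L2_def elim: eventually_mono)
    then show "(LINT x|lebesgue_on X. u' x * classical_div \<psi> x) = - (LINT x|lebesgue_on X. cdot (grad X u x) (\<psi> x))"
      using H1D(2)[OF u(1)] \<psi> by (simp add: has_weak_grad_def)
  qed
  with u' show ?thesis by (auto simp: H1_def)
qed

text \<open>The weak gradient is tested with the field \<open>classical_curl \<psi>\<close>, which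
  is itself a test field and has no divergence.\<close>

lemma has_weak_curl_grad:
  assumes "u \<in> H1 X"
  shows "has_weak_curl X (grad X u) 0"
  unfolding has_weak_curl_def
proof (intro conjI ballI)
  show "L2 X (0 :: vector_field)" by (rule L2_zero)
  fix \<psi> assume \<psi>: "\<psi> \<in> test_fields X"
  then have s: "smooth \<psi>" by (simp add: test_fields_def)
  have "(LINT x|lebesgue_on X. u x * classical_div (classical_curl \<psi>) x)
      = - (LINT x|lebesgue_on X. cdot (grad X u x) (classical_curl \<psi> x))"
    using H1D(2)[OF assms] classical_curl_test_fields[OF \<psi>] by (simp add: has_weak_grad_def)
  then show "(LINT x|lebesgue_on X. cdot (grad X u x) (classical_curl \<psi> x))
      = (LINT x|lebesgue_on X. cdot (0 x) (\<psi> x))"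
    by (simp add: classical_div_classical_curl[OF s])
qed

lemma
  assumes X: "open X" and u: "u \<in> H1 X"
  shows grad_Hcurl: "grad X u \<in> Hcurl X"
    and curl_grad: "eq_ae X (curl X (grad X u)) 0"
  by (rule HcurlI[OF H1D(3)[OF u] has_weak_curl_grad[OF u]],
      rule curl_eq_ae[OF X H1D(3)[OF u] has_weak_curl_grad[OF u]])


subsection \<open>The norm of \<open>H(curl)\<close>\<close>

lemma Hcurl_norm_nonneg: "0 \<le> Hcurl_norm X v"
  by (simp add: Hcurl_norm_def)

lemma L2_norm_le_Hcurl_norm: "L2_norm_on X v \<le> Hcurl_norm X v"
  and L2_norm_curl_le_Hcurl_norm: "L2_norm_on X (curl X v) \<le> Hcurl_norm X v"
  unfolding Hcurl_norm_def by (auto intro!: real_le_rsqrt)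

lemma Hcurl_norm_null:
  assumes "open X" "eq_ae X v 0"
  shows "Hcurl_norm X v = 0"
proof -
  have n: "L2_norm_on X w = 0" if "eq_ae X w 0" for w :: vector_field
    using L2_norm_on_cong_ae[OF L2_zero _ eq_ae_sym[OF that]] L2_norm_on_zero[of X]
      L2_cong_ae[OF open_lebesgue[OF assms(1)] L2_zero eq_ae_sym[OF that]] by metis
  show ?thesis
    using n[OF assms(2)] n[OF curl_null[OF assms]] by (simp add: Hcurl_norm_def)
qed

lemma Hcurl_norm_mono:
  assumes X: "open X" and Y: "open Y" "Y \<subseteq> X" and v: "v \<in> Hcurl X"
  shows "Hcurl_norm Y v \<le> Hcurl_norm X v"
proof -
  note s = open_lebesgue[OF X] open_lebesgue[OF Y(1)] Y(2)
  have "L2_norm_on Y (curl Y v) = L2_norm_on Y (curl X v)"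
    using HcurlD(3)[OF Hcurl_subset[OF assms]] L2_subset[OF s HcurlD(3)[OF v]] curl_subset[OF assms]
    by (rule L2_norm_on_cong_ae)
  also have "\<dots> \<le> L2_norm_on X (curl X v)"
    by (rule L2_norm_on_mono[OF s HcurlD(3)[OF v]])
  finally have "L2_norm_on Y (curl Y v) \<le> L2_norm_on X (curl X v)" .
  moreover have "L2_norm_on Y v \<le> L2_norm_on X v"
    by (rule L2_norm_on_mono[OF s HcurlD(1)[OF v]])
  ultimately show ?thesis
    unfolding Hcurl_norm_def by (intro real_sqrt_le_mono add_mono power_mono L2_norm_on_nonneg)
qed


subsection \<open>Bounded bilinear forms\<close>

lemma Linfty_subset:
  assumes "X \<in> sets lebesgue" "Y \<in> sets lebesgue" "Y \<subseteq> X" "Linfty X m"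
  shows "Linfty Y m"
proof -
  obtain B where "AE x in lebesgue_on X. \<bar>m x\<bar> \<le> B"
    using assms(4) by (auto simp: Linfty_def)
  then have "AE x in lebesgue_on Y. \<bar>m x\<bar> \<le> B"
    using assms(1-3) AE_lebesgue_on_subset by blast
  moreover have "m \<in> borel_measurable (lebesgue_on Y)"
    by (rule measurable_restrict_mono[OF _ assms(3)]) (use assms(4) in \<open>simp add: Linfty_def\<close>)
  ultimately show ?thesis
    by (auto simp: Linfty_def)
qed

lemma Linfty_inverse:
  assumes "Linfty X m" "uniformly_positive X m"
  shows "Linfty X (\<lambda>x. inverse (m x))"
proof -
  obtain c where c: "0 < c" "AE x in lebesgue_on X. c \<le> m x"
    using assms(2) by (auto simp: uniformly_positive_def)
  have "AE x in lebesgue_on X. \<bar>inverse (m x)\<bar> \<le> inverse c"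
    using c(2) by (rule eventually_mono) (use c(1) in \<open>auto intro: le_imp_inverse_le\<close>)
  then show ?thesis
    using assms(1) unfolding Linfty_def by (blast intro: borel_measurable_inverse)
qed

lemma cdot_commute: "cdot v w = cdot w v"
  by (simp add: cdot_def mult.commute)

lemma mass_form_commute: "mass_form X m f g = mass_form X m g f"
  by (simp add: mass_form_def cdot_commute)

lemma curlcurl_form_eq_mass_form:
  "curlcurl_form X \<mu> v w = mass_form X (\<lambda>x. inverse (\<mu> x)) (curl X v) (curl X w)"
  by (simp add: curlcurl_form_def mass_form_def)

lemma integrable_mass_form:
  assumes "Linfty X m" "L2 X f" "L2 X g"
  shows "integrable (lebesgue_on X) (\<lambda>x. of_real (m x) * cdot (f x) (g x))"
  using assms integrable_weighted_cdot unfolding Linfty_def by blast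

lemma mass_form_add_right:
  assumes "Linfty X m" "L2 X f" "L2 X g" "L2 X h"
  shows "mass_form X m f (g + h) = mass_form X m f g + mass_form X m f h"
  using integrable_mass_form[OF assms(1,2,3)] integrable_mass_form[OF assms(1,2,4)]
  by (simp add: mass_form_def cdot_add_right distrib_left)

lemma mass_form_vscale_right: "mass_form X m f (vscale c g) = c * mass_form X m f g"
  by (simp add: mass_form_def vscale_def cdot_scale_right mult.left_commute[of _ c])

lemma mass_form_bound:
  assumes "Linfty X m"
  obtains B where "0 \<le> B"
    "\<And>f g. L2 X f \<Longrightarrow> L2 X g \<Longrightarrow> norm (mass_form X m f g) \<le> B * (L2_norm_on X f * L2_norm_on X g)"
proof -
  obtain B where m: "m \<in> borel_measurable (lebesgue_on X)" and B: "AE x in lebesgue_on X. \<bar>m x\<bar> \<le> B"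
    using assms by (auto simp: Linfty_def)
  show ?thesis
    by (rule that[of "\<bar>B\<bar>"]) (use norm_integral_weighted_cdot_le[OF _ _ m B] in \<open>auto simp: mass_form_def\<close>)
qed

lemma mass_form_cong:
  assumes X: "X \<in> sets lebesgue" and m: "Linfty X m" and "L2 X f" "L2 X g" "eq_ae X f f'" "eq_ae X g g'"
  shows "mass_form X m f g = mass_form X m f' g'"
  unfolding mass_form_def
proof (rule integral_cong_AE)
  have "L2 X f'" "L2 X g'"
    using assms L2_cong_ae by blast+
  then show "(\<lambda>x. of_real (m x) * cdot (f' x) (g' x)) \<in> borel_measurable (lebesgue_on X)"
    by (intro borel_measurable_integrable integrable_mass_form m)
  show "(\<lambda>x. of_real (m x) * cdot (f x) (g x)) \<in> borel_measurable (lebesgue_on X)"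
    by (intro borel_measurable_integrable integrable_mass_form assms)
  show "AE x in lebesgue_on X. of_real (m x) * cdot (f x) (g x) = of_real (m x) * cdot (f' x) (g' x)"
    using assms(5,6) unfolding eq_ae_def by eventually_elim simp
qed

lemma curlcurl_form_cong:
  assumes X: "open X" and m: "Linfty X (\<lambda>x. inverse (\<mu> x))"
    and v: "v \<in> Hcurl X" "eq_ae X v v'" and w: "w \<in> Hcurl X" "eq_ae X w w'"
  shows "curlcurl_form X \<mu> v w = curlcurl_form X \<mu> v' w'"
  unfolding curlcurl_form_eq_mass_form
  by (rule mass_form_cong[OF open_lebesgue[OF X] m HcurlD(3)[OF v(1)] HcurlD(3)[OF w(1)]
        curl_cong[OF X v] curl_cong[OF X w]])


subsection \<open>Dual spaces\<close>

lemma module_vscale: "module vscale"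
  by unfold_locales (auto simp: vscale_def fun_eq_iff vec_eq_iff algebra_simps)

lemma subspaceD:
  assumes "module.subspace vscale W"
  shows "0 \<in> W" "u \<in> W \<Longrightarrow> v \<in> W \<Longrightarrow> u + v \<in> W" "u \<in> W \<Longrightarrow> vscale c u \<in> W"
    "u \<in> W \<Longrightarrow> v \<in> W \<Longrightarrow> u - v \<in> W"
  by (rule module.subspace_0[OF module_vscale assms],
      rule module.subspace_add[OF module_vscale assms], assumption+,
      rule module.subspace_scale[OF module_vscale assms], assumption+,
      rule module.subspace_diff[OF module_vscale assms])

text \<open>Functionals act on representatives. The bound makes them vanish on null fields, which
  have norm 0, so they descend to classes of fields.\<close>

lemma dual_space_cong:
  assumes X: "open X" and W: "Hcurl_subspace X W"
    and l: "l \<in> dual_space vscale (Hcurl_norm X) W" and v: "v \<in> W" "eq_ae X v v'"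
  shows "l v' = l v"
proof -
  have sub: "module.subspace vscale W" and v': "v' \<in> W"
    using W v by (auto simp: Hcurl_subspace_def ae_closed_def)
  let ?d = "v' - v"
  have d: "?d \<in> W"
    using subspaceD(4)[OF sub v' v(1)] .
  obtain B where "\<forall>w\<in>W. cmod (l w) \<le> B * Hcurl_norm X w"
    using l by (auto simp: dual_space_def)
  moreover have "eq_ae X ?d 0"
    using eq_ae_diff[OF eq_ae_sym[OF v(2)] eq_ae_refl[of X v]] by simp
  ultimately have "l ?d = 0"
    using d Hcurl_norm_null[OF X] by fastforce
  moreover have "l (?d + v) = l ?d + l v"
    using l d v(1) unfolding dual_space_def by blast
  moreover have "?d + v = v'" by simp
  ultimately show ?thesis by (simp only: add_0)
qed

text \<open>Multiplying estimates requires a nonnegative constant, whereas the bound in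
  \<open>dual_space\<close> has no prescribed sign.\<close>

lemma dual_space_bound:
  assumes "l \<in> dual_space sc N W" "\<And>v. v \<in> W \<Longrightarrow> 0 \<le> N v"
  obtains B where "0 \<le> B" "\<And>v. v \<in> W \<Longrightarrow> cmod (l v) \<le> B * N v"
proof -
  obtain B where "\<forall>v\<in>W. cmod (l v) \<le> B * N v"
    using assms(1) by (auto simp: dual_space_def)
  moreover have "B * N v \<le> \<bar>B\<bar> * N v" if "v \<in> W" for v
    using assms(2)[OF that] by (intro mult_right_mono) auto
  ultimately show ?thesis
    using that[of "\<bar>B\<bar>"] by force
qed

lemma dual_space_diff:
  assumes "k \<in> dual_space sc N W" "l \<in> dual_space sc N W" "\<And>v. v \<in> W \<Longrightarrow> 0 \<le> N v"
  shows "(\<lambda>v. k v - l v) \<in> dual_space sc N W"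
proof -
  obtain B where B: "0 \<le> B" "\<And>v. v \<in> W \<Longrightarrow> cmod (k v) \<le> B * N v"
    using dual_space_bound[OF assms(1,3)] by blast
  obtain B' where B': "0 \<le> B'" "\<And>v. v \<in> W \<Longrightarrow> cmod (l v) \<le> B' * N v"
    using dual_space_bound[OF assms(2,3)] by blast
  have "cmod (k v - l v) \<le> (B + B') * N v" if "v \<in> W" for v
    using norm_triangle_ineq4[of "k v" "l v"] B(2)[OF that] B'(2)[OF that] by (simp add: distrib_right)
  then show ?thesis
    using assms(1,2) by (auto simp: dual_space_def right_diff_distrib)
qed

lemma dual_space_add:
  assumes "k \<in> dual_space sc N W" "l \<in> dual_space sc N W" "\<And>v. v \<in> W \<Longrightarrow> 0 \<le> N v"
  shows "(\<lambda>v. k v + l v) \<in> dual_space sc N W"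
proof -
  obtain B where B: "0 \<le> B" "\<And>v. v \<in> W \<Longrightarrow> cmod (k v) \<le> B * N v"
    using dual_space_bound[OF assms(1,3)] by blast
  obtain B' where B': "0 \<le> B'" "\<And>v. v \<in> W \<Longrightarrow> cmod (l v) \<le> B' * N v"
    using dual_space_bound[OF assms(2,3)] by blast
  have "cmod (k v + l v) \<le> (B + B') * N v" if "v \<in> W" for v
    using norm_triangle_ineq[of "k v" "l v"] B(2)[OF that] B'(2)[OF that] by (simp add: distrib_right)
  then show ?thesis
    using assms(1,2) by (auto simp: dual_space_def distrib_left)
qed

lemma dual_space_mult:
  assumes "l \<in> dual_space sc N W"
  shows "(\<lambda>v. c * l v) \<in> dual_space sc N W"
proof -
  obtain B where "\<forall>v\<in>W. cmod (l v) \<le> B * N v"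
    using assms by (auto simp: dual_space_def)
  then have "\<forall>v\<in>W. cmod (c * l v) \<le> (cmod c * B) * N v"
    by (simp add: norm_mult mult.assoc mult_left_mono)
  then show ?thesis
    using assms by (auto simp: dual_space_def distrib_left)
qed

lemma mass_form_dual_space:
  assumes X: "open X" and W: "W \<subseteq> Hcurl X" and m: "Linfty X m" and f: "L2 X f"
  shows "mass_form X m f \<in> dual_space vscale (Hcurl_norm X) W"
proof -
  have L2: "L2 X v" if "v \<in> W" for v
    using that W HcurlD(1) by blast
  obtain B where B: "0 \<le> B"
    "\<And>f g. L2 X f \<Longrightarrow> L2 X g \<Longrightarrow> norm (mass_form X m f g) \<le> B * (L2_norm_on X f * L2_norm_on X g)"
    using mass_form_bound[OF m] by blast
  have "cmod (mass_form X m f v) \<le> (B * L2_norm_on X f) * Hcurl_norm X v" if "v \<in> W" for v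
    by (rule order_trans[OF B(2)[OF f L2[OF that]]])
      (simp add: mult.assoc B(1) L2_norm_on_nonneg L2_norm_le_Hcurl_norm mult_left_mono)
  then show ?thesis
    using L2 by (auto simp: dual_space_def mass_form_add_right[OF m f] mass_form_vscale_right)
qed

text \<open>\<open>curl\<close> selects a representative and is therefore linear only up to null
  sets; \<open>mass_form_cong\<close> turns this into exact linearity of the form.\<close>

lemma curlcurl_form_dual_space:
  assumes X: "open X" and W: "W \<subseteq> Hcurl X" and m: "Linfty X (\<lambda>x. inverse (\<mu> x))" and A: "A \<in> Hcurl X"
  shows "curlcurl_form X \<mu> A \<in> dual_space vscale (Hcurl_norm X) W"
proof -
  let ?a = "mass_form X (\<lambda>x. inverse (\<mu> x)) (curl X A)"
  note cA = HcurlD(3)[OF A] and Xs = open_lebesgue[OF X]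
  obtain B where B: "0 \<le> B"
    "\<And>f g. L2 X f \<Longrightarrow> L2 X g \<Longrightarrow>
      norm (mass_form X (\<lambda>x. inverse (\<mu> x)) f g) \<le> B * (L2_norm_on X f * L2_norm_on X g)"
    using mass_form_bound[OF m] by blast
  have bd: "cmod (?a (curl X v)) \<le> (B * L2_norm_on X (curl X A)) * Hcurl_norm X v" if "v \<in> W" for v
    by (rule order_trans[OF B(2)[OF cA HcurlD(3)]])
      (use that W in \<open>auto simp: mult.assoc B(1) L2_norm_on_nonneg L2_norm_curl_le_Hcurl_norm mult_left_mono\<close>)
  have add: "?a (curl X (v + w)) = ?a (curl X v) + ?a (curl X w)" if "v \<in> W" "w \<in> W" for v w
  proof -
    have vw: "v \<in> Hcurl X" "w \<in> Hcurl X" using that W by auto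
    have "?a (curl X (v + w)) = ?a (curl X v + curl X w)"
      by (rule mass_form_cong[OF Xs m cA HcurlD(3)[OF Hcurl_add[OF X vw]] eq_ae_refl curl_add[OF X vw]])
    then show ?thesis
      using mass_form_add_right[OF m cA HcurlD(3)[OF vw(1)] HcurlD(3)[OF vw(2)]] by simp
  qed
  have scale: "?a (curl X (vscale c v)) = c * ?a (curl X v)" if "v \<in> W" for c v
  proof -
    have v: "v \<in> Hcurl X" using that W by auto
    have "?a (curl X (vscale c v)) = ?a (vscale c (curl X v))"
      by (rule mass_form_cong[OF Xs m cA HcurlD(3)[OF Hcurl_vscale[OF X v]] eq_ae_refl curl_vscale[OF X v]])
    then show ?thesis
      by (simp add: mass_form_vscale_right)
  qed
  show ?thesis
    using bd by (auto simp: dual_space_def curlcurl_form_eq_mass_form add scale)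
qed


section \<open>The interface\<close>

lemma green_pairing_eq:
  assumes X: "open X" and v: "v \<in> Hcurl X" and \<psi>: "\<psi> \<in> test_fields Y"
  shows "green_pairing X v \<psi> = (LINT x|lebesgue_on X. cdot (curl X v x) (\<psi> x))
    - (LINT x|lebesgue_on X. cdot (v x) (classical_curl \<psi> x))"
  unfolding green_pairing_def
  using L2_test_field[OF open_lebesgue[OF X]] classical_curl_test_fields[OF \<psi>] \<psi>
  by (intro Bochner_Integration.integral_diff integrable_cdot HcurlD[OF v]) blast+

lemma green_pairing_cong:
  assumes X: "open X" and v: "v \<in> Hcurl X" "eq_ae X v v'" and \<psi>: "\<psi> \<in> test_fields Y"
  shows "green_pairing X v' \<psi> = green_pairing X v \<psi>"
proof -
  note Xs = open_lebesgue[OF X]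
  note L2 = L2_test_field[OF Xs \<psi>] L2_test_field[OF Xs classical_curl_test_fields[OF \<psi>]]
  show ?thesis
    unfolding green_pairing_eq[OF X v(1) \<psi>] green_pairing_eq[OF X Hcurl_cong[OF X v] \<psi>]
    using integral_cdot_cong_ae[OF Xs HcurlD(3)[OF v(1)] L2(1) curl_cong[OF X v] eq_ae_refl]
      integral_cdot_cong_ae[OF Xs HcurlD(1)[OF v(1)] L2(2) v(2) eq_ae_refl] by simp
qed

lemma green_pairing_add:
  assumes X: "open X" and v: "v \<in> Hcurl X" "w \<in> Hcurl X" and \<psi>: "\<psi> \<in> test_fields Y"
  shows "green_pairing X (v + w) \<psi> = green_pairing X v \<psi> + green_pairing X w \<psi>"
proof -
  note Xs = open_lebesgue[OF X]
  note L2 = L2_test_field[OF Xs \<psi>] L2_test_field[OF Xs classical_curl_test_fields[OF \<psi>]]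
  have "(LINT x|lebesgue_on X. cdot (curl X (v + w) x) (\<psi> x))
      = (LINT x|lebesgue_on X. cdot ((curl X v + curl X w) x) (\<psi> x))"
    by (rule integral_cdot_cong_ae[OF Xs HcurlD(3)[OF Hcurl_add[OF X v]] L2(1) curl_add[OF X v] eq_ae_refl])
  then show ?thesis
    unfolding green_pairing_eq[OF X v(1) \<psi>] green_pairing_eq[OF X v(2) \<psi>]
      green_pairing_eq[OF X Hcurl_add[OF X v] \<psi>]
    using HcurlD[OF v(1)] HcurlD[OF v(2)] L2 by (simp add: cdot_add_left integrable_cdot)
qed

lemma green_pairing_vscale:
  assumes X: "open X" and v: "v \<in> Hcurl X" and \<psi>: "\<psi> \<in> test_fields Y"
  shows "green_pairing X (vscale c v) \<psi> = c * green_pairing X v \<psi>"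
proof -
  note Xs = open_lebesgue[OF X]
  note L2 = L2_test_field[OF Xs \<psi>] L2_test_field[OF Xs classical_curl_test_fields[OF \<psi>]]
  have "(LINT x|lebesgue_on X. cdot (curl X (vscale c v) x) (\<psi> x))
      = (LINT x|lebesgue_on X. cdot (vscale c (curl X v) x) (\<psi> x))"
    by (rule integral_cdot_cong_ae[OF Xs HcurlD(3)[OF Hcurl_vscale[OF X v]] L2(1) curl_vscale[OF X v] eq_ae_refl])
  then show ?thesis
    unfolding green_pairing_eq[OF X v \<psi>] green_pairing_eq[OF X Hcurl_vscale[OF X v] \<psi>]
    by (simp add: vscale_def cdot_scale_left algebra_simps)
qed

text \<open>What gluing asks of the geometry: open disjoint parts that exhaust
  \<open>\<Omega>\<close> up to a null set, so that integrals over \<open>\<Omega>\<close>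
  split.\<close>

locale interface =
  fixes \<Omega> \<Omega>C \<Omega>I :: "point set"
  assumes open_domains: "open \<Omega>" "open \<Omega>C" "open \<Omega>I"
    and subdomains: "\<Omega>C \<subseteq> \<Omega>" "\<Omega>I \<subseteq> \<Omega>" "\<Omega>C \<inter> \<Omega>I = {}"
    and negligible_interface: "negligible (\<Omega> - (\<Omega>C \<union> \<Omega>I))"
begin

lemma domains_lebesgue: "\<Omega> \<in> sets lebesgue" "\<Omega>C \<in> sets lebesgue" "\<Omega>I \<in> sets lebesgue"
  using open_domains by auto

lemma AE_outside_interface: "AE x in lebesgue. x \<in> \<Omega> \<longrightarrow> x \<in> \<Omega>C \<or> x \<in> \<Omega>I"
proof -
  have "AE x in lebesgue. x \<notin> \<Omega> - (\<Omega>C \<union> \<Omega>I)"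
    using negligible_interface by (intro AE_not_in) (simp add: negligible_iff_null_sets)
  then show ?thesis
    by (rule eventually_mono) auto
qed

lemma eq_ae_combine: "eq_ae \<Omega>C f g \<Longrightarrow> eq_ae \<Omega>I f g \<Longrightarrow> eq_ae \<Omega> f g"
  unfolding eq_ae_def AE_lebesgue_on_iff[OF domains_lebesgue(1)]
    AE_lebesgue_on_iff[OF domains_lebesgue(2)] AE_lebesgue_on_iff[OF domains_lebesgue(3)]
proof -
  assume "AE x\<in>\<Omega>C in lebesgue. f x = g x" "AE x\<in>\<Omega>I in lebesgue. f x = g x"
  then show "AE x\<in>\<Omega> in lebesgue. f x = g x"
    using AE_outside_interface by eventually_elim auto
qed

lemma integral_combine:
  fixes f :: "point \<Rightarrow> 'b::{banach, second_countable_topology}"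
  assumes f: "integrable (lebesgue_on \<Omega>) f"
  shows "(LINT x|lebesgue_on \<Omega>. f x) = (LINT x|lebesgue_on \<Omega>C. f x) + (LINT x|lebesgue_on \<Omega>I. f x)"
proof -
  have C: "integrable lebesgue (\<lambda>x. indicator \<Omega>C x *\<^sub>R f x)"
    using integrable_lebesgue_on_subset[OF domains_lebesgue(1,2) subdomains(1) f]
    by (simp only: integrable_lebesgue_on_iff[OF domains_lebesgue(2)])
  have I: "integrable lebesgue (\<lambda>x. indicator \<Omega>I x *\<^sub>R f x)"
    using integrable_lebesgue_on_subset[OF domains_lebesgue(1,3) subdomains(2) f]
    by (simp only: integrable_lebesgue_on_iff[OF domains_lebesgue(3)])
  have "(LINT x|lebesgue. indicator \<Omega> x *\<^sub>R f x)
      = (LINT x|lebesgue. indicator \<Omega>C x *\<^sub>R f x + indicator \<Omega>I x *\<^sub>R f x)"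
  proof (rule integral_cong_AE)
    show "(\<lambda>x. indicator \<Omega> x *\<^sub>R f x) \<in> borel_measurable lebesgue"
      using f unfolding integrable_lebesgue_on_iff[OF domains_lebesgue(1)]
      by (rule borel_measurable_integrable)
    show "(\<lambda>x. indicator \<Omega>C x *\<^sub>R f x + indicator \<Omega>I x *\<^sub>R f x) \<in> borel_measurable lebesgue"
      using C I by (intro borel_measurable_integrable Bochner_Integration.integrable_add)
    show "AE x in lebesgue. indicator \<Omega> x *\<^sub>R f x = indicator \<Omega>C x *\<^sub>R f x + indicator \<Omega>I x *\<^sub>R f x"
      using AE_outside_interface
      by (rule eventually_mono) (use subdomains in \<open>auto simp: indicator_def\<close>)
  qed
  then show ?thesis
    unfolding integral_lebesgue_on_eq[OF domains_lebesgue(1)] integral_lebesgue_on_eq[OF domains_lebesgue(2)]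
      integral_lebesgue_on_eq[OF domains_lebesgue(3)]
    using Bochner_Integration.integral_add[OF C I] by simp
qed

section \<open>Gluing and one-sided traces\<close>

definition glued :: "vector_field \<Rightarrow> vector_field \<Rightarrow> vector_field" where
  "glued f g = (\<lambda>x. if x \<in> \<Omega>C then f x else if x \<in> \<Omega>I then g x else 0)"

lemma glued_eq: "x \<in> \<Omega>C \<Longrightarrow> glued f g x = f x" "x \<in> \<Omega>I \<Longrightarrow> glued f g x = g x"
  using subdomains(3) by (auto simp: glued_def)

lemma L2_glued:
  assumes f: "L2 \<Omega>C f" and g: "L2 \<Omega>I g"
  shows "L2 \<Omega> (glued f g)"
proof -
  have "glued f g = (\<lambda>x. (if x \<in> \<Omega>C then f x else 0) + (if x \<in> \<Omega>I then g x else 0))"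
    using subdomains(3) by (auto simp: glued_def fun_eq_iff)
  moreover have "(\<lambda>x. (if x \<in> \<Omega>C then f x else 0) + (if x \<in> \<Omega>I then g x else 0)) \<in> borel_measurable lebesgue"
    using f g by (intro borel_measurable_add borel_measurable_if_I) (auto simp: L2_def domains_lebesgue)
  ultimately have m: "glued f g \<in> borel_measurable (lebesgue_on UNIV)"
    by (simp add: lebesgue_on_UNIV_eq)
  have "integrable lebesgue (\<lambda>x. indicator \<Omega>C x *\<^sub>R (norm (f x))\<^sup>2 + indicator \<Omega>I x *\<^sub>R (norm (g x))\<^sup>2)"
    using f g unfolding L2_def integrable_lebesgue_on_iff[OF domains_lebesgue(2)]
      integrable_lebesgue_on_iff[OF domains_lebesgue(3)]
    by (intro Bochner_Integration.integrable_add) auto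
  also have "(\<lambda>x. indicator \<Omega>C x *\<^sub>R (norm (f x))\<^sup>2 + indicator \<Omega>I x *\<^sub>R (norm (g x))\<^sup>2)
      = (\<lambda>x. (norm (glued f g x))\<^sup>2)"
    using subdomains(3) by (auto simp: glued_def fun_eq_iff)
  finally have "L2 UNIV (glued f g)"
    using m by (simp add: L2_def lebesgue_on_UNIV_eq)
  then show ?thesis
    by (rule L2_subset[rotated 3]) (use domains_lebesgue in auto)
qed

lemma integral_glued_cdot:
  assumes f: "L2 \<Omega>C f" and g: "L2 \<Omega>I g" and h: "L2 \<Omega> h"
  shows "(LINT x|lebesgue_on \<Omega>. cdot (glued f g x) (h x))
    = (LINT x|lebesgue_on \<Omega>C. cdot (f x) (h x)) + (LINT x|lebesgue_on \<Omega>I. cdot (g x) (h x))"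
proof -
  have "(LINT x|lebesgue_on \<Omega>C. cdot (glued f g x) (h x)) = (LINT x|lebesgue_on \<Omega>C. cdot (f x) (h x))"
    "(LINT x|lebesgue_on \<Omega>I. cdot (glued f g x) (h x)) = (LINT x|lebesgue_on \<Omega>I. cdot (g x) (h x))"
    by (auto intro!: Bochner_Integration.integral_cong simp: glued_eq)
  then show ?thesis
    using integral_combine[OF integrable_cdot[OF L2_glued[OF f g] h]] by simp
qed

text \<open>With the sign in \<open>tang_trace_I\<close>, equal traces mean that the two Green
  pairings add up to 0. This is exactly the statement that the glued curls are a weak curl of the
  glued field.\<close>

lemma Hcurl_glue:
  assumes wC: "wC \<in> Hcurl \<Omega>C" and wI: "wI \<in> Hcurl \<Omega>I"
    and tr: "tang_trace_C \<Omega> \<Omega>C wC = tang_trace_I \<Omega> \<Omega>I wI"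
  shows "\<exists>w\<in>Hcurl \<Omega>. eq_ae \<Omega>C w wC \<and> eq_ae \<Omega>I w wI"
proof (intro bexI conjI)
  have "has_weak_curl \<Omega> (glued wC wI) (glued (curl \<Omega>C wC) (curl \<Omega>I wI))"
    unfolding has_weak_curl_def
  proof (intro conjI ballI)
    show "L2 \<Omega> (glued (curl \<Omega>C wC) (curl \<Omega>I wI))"
      by (rule L2_glued[OF HcurlD(3)[OF wC] HcurlD(3)[OF wI]])
    fix \<psi> assume \<psi>: "\<psi> \<in> test_fields \<Omega>"
    note L2 = L2_test_field[OF domains_lebesgue(1) \<psi>]
      L2_test_field[OF domains_lebesgue(1) classical_curl_test_fields[OF \<psi>]]
    have "green_pairing \<Omega>C wC \<psi> = - green_pairing \<Omega>I wI \<psi>"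
      using fun_cong[OF tr, of \<psi>] \<psi> by (simp add: tang_trace_C_def tang_trace_I_def)
    then show "(LINT x|lebesgue_on \<Omega>. cdot (glued wC wI x) (classical_curl \<psi> x))
        = (LINT x|lebesgue_on \<Omega>. cdot (glued (curl \<Omega>C wC) (curl \<Omega>I wI) x) (\<psi> x))"
      unfolding integral_glued_cdot[OF HcurlD(1)[OF wC] HcurlD(1)[OF wI] L2(2)]
        integral_glued_cdot[OF HcurlD(3)[OF wC] HcurlD(3)[OF wI] L2(1)]
        green_pairing_eq[OF open_domains(2) wC \<psi>] green_pairing_eq[OF open_domains(3) wI \<psi>]
      by (simp add: algebra_simps)
  qed
  then show "glued wC wI \<in> Hcurl \<Omega>"
    by (rule HcurlI[OF L2_glued[OF HcurlD(1)[OF wC] HcurlD(1)[OF wI]]])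
  show "eq_ae \<Omega>C (glued wC wI) wC" "eq_ae \<Omega>I (glued wC wI) wI"
    unfolding eq_ae_def by (auto intro!: AE_I2 simp: glued_eq)
qed

lemma Hcurl_C: "w \<in> Hcurl \<Omega> \<Longrightarrow> w \<in> Hcurl \<Omega>C"
  and Hcurl_I: "w \<in> Hcurl \<Omega> \<Longrightarrow> w \<in> Hcurl \<Omega>I"
  using Hcurl_subset open_domains subdomains by blast+

text \<open>Converse of gluing: for a weak curl on all of \<open>\<Omega>\<close> the two Green
  pairings cancel, so there is no tangential jump.\<close>

lemma tang_trace_C_eq_I:
  assumes w: "w \<in> Hcurl \<Omega>"
  shows "tang_trace_C \<Omega> \<Omega>C w = tang_trace_I \<Omega> \<Omega>I w"
proof -
  have "green_pairing \<Omega>C w \<psi> = - green_pairing \<Omega>I w \<psi>" if \<psi>: "\<psi> \<in> test_fields \<Omega>" for \<psi>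
  proof -
    note L2 = L2_test_field[OF domains_lebesgue(1) \<psi>]
      L2_test_field[OF domains_lebesgue(1) classical_curl_test_fields[OF \<psi>]]
    have "(LINT x|lebesgue_on Y. cdot (curl Y w x) (\<psi> x)) = (LINT x|lebesgue_on Y. cdot (curl \<Omega> w x) (\<psi> x))"
      if "open Y" "Y \<subseteq> \<Omega>" for Y
      by (rule integral_cdot_cong_ae[OF open_lebesgue[OF that(1)]
            HcurlD(3)[OF Hcurl_subset[OF open_domains(1) that w]]
            L2_test_field[OF open_lebesgue[OF that(1)] \<psi>] curl_subset[OF open_domains(1) that w] eq_ae_refl])
    note curlC = this[OF open_domains(2) subdomains(1)] and curlI = this[OF open_domains(3) subdomains(2)]
    have "(LINT x|lebesgue_on \<Omega>C. cdot (w x) (classical_curl \<psi> x))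
        + (LINT x|lebesgue_on \<Omega>I. cdot (w x) (classical_curl \<psi> x))
      = (LINT x|lebesgue_on \<Omega>C. cdot (curl \<Omega> w x) (\<psi> x))
        + (LINT x|lebesgue_on \<Omega>I. cdot (curl \<Omega> w x) (\<psi> x))"
      unfolding integral_combine[OF integrable_cdot[OF HcurlD(3)[OF w] L2(1)], symmetric]
        integral_combine[OF integrable_cdot[OF HcurlD(1)[OF w] L2(2)], symmetric]
      using HcurlD(2)[OF w] \<psi> unfolding has_weak_curl_def by blast
    moreover have "r - p = - (s - q)" if "p + q = r + s" for p q r s :: complex
      using that by algebra
    ultimately show ?thesis
      unfolding green_pairing_eq[OF open_domains(2) Hcurl_C[OF w] \<psi>]
        green_pairing_eq[OF open_domains(3) Hcurl_I[OF w] \<psi>] curlC curlI by blast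
  qed
  then show ?thesis
    by (simp add: tang_trace_C_def tang_trace_I_def fun_eq_iff)
qed

lemma tang_trace_C_cong:
  assumes "w \<in> Hcurl \<Omega>C" "eq_ae \<Omega>C w w'"
  shows "tang_trace_C \<Omega> \<Omega>C w' = tang_trace_C \<Omega> \<Omega>C w"
  using green_pairing_cong[OF open_domains(2) assms] by (auto simp: tang_trace_C_def)

lemma tang_trace_I_cong:
  assumes "w \<in> Hcurl \<Omega>I" "eq_ae \<Omega>I w w'"
  shows "tang_trace_I \<Omega> \<Omega>I w' = tang_trace_I \<Omega> \<Omega>I w"
  using green_pairing_cong[OF open_domains(3) assms] by (auto simp: tang_trace_I_def)

lemma tang_trace_C_add:
  assumes "v \<in> Hcurl \<Omega>C" "w \<in> Hcurl \<Omega>C"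
  shows "tang_trace_C \<Omega> \<Omega>C (v + w) = tang_trace_C \<Omega> \<Omega>C v + tang_trace_C \<Omega> \<Omega>C w"
  using green_pairing_add[OF open_domains(2) assms] by (auto simp: tang_trace_C_def)

lemma tang_trace_C_vscale:
  assumes "v \<in> Hcurl \<Omega>C"
  shows "tang_trace_C \<Omega> \<Omega>C (vscale c v) = cscale c (tang_trace_C \<Omega> \<Omega>C v)"
  using green_pairing_vscale[OF open_domains(2) assms] by (auto simp: tang_trace_C_def cscale_def)

lemma tang_trace_C_zero: "tang_trace_C \<Omega> \<Omega>C 0 = 0"
  using tang_trace_C_vscale[OF zero_Hcurl, of 0] by (simp add: cscale_def vscale_def zero_fun_def)

text \<open>Both sides reduce to minus the integral of grad u times curl \<psi>: on the left because
  curl grad u = 0, on the right because div curl \<psi> = 0.\<close>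

lemma tang_trace_C_grad:
  assumes u: "u \<in> H1 \<Omega>" and v: "eq_ae \<Omega> v (grad \<Omega> u)"
  shows "tang_trace_C \<Omega> \<Omega>C v = surface_grad \<Omega> (scalar_trace \<Omega> \<Omega>C u)"
proof
  fix \<psi>
  note C = open_domains(1,2) subdomains(1)
  have uC: "u \<in> H1 \<Omega>C" by (rule H1_subset[OF C u])
  have vC: "eq_ae \<Omega>C (grad \<Omega>C u) v"
    by (rule eq_ae_trans[OF grad_subset[OF C u]
          eq_ae_sym[OF eq_ae_subset[OF domains_lebesgue(1,2) subdomains(1) v]]])
  show "tang_trace_C \<Omega> \<Omega>C v \<psi> = surface_grad \<Omega> (scalar_trace \<Omega> \<Omega>C u) \<psi>"
  proof (cases "\<psi> \<in> test_fields \<Omega>")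
    case True
    note L2 = L2_test_field[OF domains_lebesgue(2) True]
      L2_test_field[OF domains_lebesgue(2) classical_curl_test_fields[OF True]]
    have s: "smooth \<psi>" using True by (simp add: test_fields_def)
    have g: "grad \<Omega>C u \<in> Hcurl \<Omega>C"
      by (rule grad_Hcurl[OF C(2) uC])
    have "green_pairing \<Omega>C v \<psi> = green_pairing \<Omega>C (grad \<Omega>C u) \<psi>"
      by (rule green_pairing_cong[OF C(2) g vC True])
    also have "\<dots> = - (LINT x|lebesgue_on \<Omega>C. cdot (grad \<Omega>C u x) (classical_curl \<psi> x))"
      unfolding green_pairing_eq[OF C(2) g True]
      using integral_cdot_cong_ae[OF domains_lebesgue(2) HcurlD(3)[OF g] L2(1) curl_grad[OF C(2) uC] eq_ae_refl]
      by simp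
    finally show ?thesis
      using True classical_curl_test_fields[OF True]
      by (simp add: tang_trace_C_def surface_grad_def scalar_trace_def classical_div_classical_curl[OF s])
  qed (simp add: tang_trace_C_def surface_grad_def)
qed

text \<open>Cauchy-Schwarz in the Green pairing; the constant depends on \<open>\<psi>\<close>
  alone. It gives control of single values of a trace by any of its extensions.\<close>

lemma tang_trace_C_bound: "\<exists>K\<ge>0. \<forall>w\<in>Hcurl \<Omega>. cmod (tang_trace_C \<Omega> \<Omega>C w \<psi>) \<le> K * Hcurl_norm \<Omega> w"
proof (cases "\<psi> \<in> test_fields \<Omega>")
  case True
  note L2 = L2_test_field[OF domains_lebesgue(2) True]
    L2_test_field[OF domains_lebesgue(2) classical_curl_test_fields[OF True]]
  let ?K = "L2_norm_on \<Omega>C \<psi> + L2_norm_on \<Omega>C (classical_curl \<psi>)"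
  have "cmod (tang_trace_C \<Omega> \<Omega>C w \<psi>) \<le> ?K * Hcurl_norm \<Omega> w" if w: "w \<in> Hcurl \<Omega>" for w
  proof -
    let ?n = "Hcurl_norm \<Omega>C w"
    have "cmod (tang_trace_C \<Omega> \<Omega>C w \<psi>)
        \<le> cmod (LINT x|lebesgue_on \<Omega>C. cdot (curl \<Omega>C w x) (\<psi> x))
          + cmod (LINT x|lebesgue_on \<Omega>C. cdot (w x) (classical_curl \<psi> x))"
      using True by (simp add: tang_trace_C_def green_pairing_eq[OF open_domains(2) Hcurl_C[OF w] True]
          norm_triangle_ineq4)
    also have "\<dots> \<le> L2_norm_on \<Omega>C (curl \<Omega>C w) * L2_norm_on \<Omega>C \<psi>
        + L2_norm_on \<Omega>C w * L2_norm_on \<Omega>C (classical_curl \<psi>)"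
      by (intro add_mono norm_integral_cdot_le HcurlD Hcurl_C w L2)
    also have "\<dots> \<le> ?n * L2_norm_on \<Omega>C \<psi> + ?n * L2_norm_on \<Omega>C (classical_curl \<psi>)"
      by (intro add_mono mult_right_mono L2_norm_on_nonneg L2_norm_le_Hcurl_norm L2_norm_curl_le_Hcurl_norm)
    also have "\<dots> = ?K * ?n"
      by (simp add: algebra_simps)
    also have "\<dots> \<le> ?K * Hcurl_norm \<Omega> w"
      by (intro mult_left_mono Hcurl_norm_mono add_nonneg_nonneg L2_norm_on_nonneg open_domains subdomains w)
    finally show ?thesis .
  qed
  then show ?thesis
    by (intro exI[of _ ?K]) (auto simp: L2_norm_on_nonneg)
qed (auto simp: tang_trace_C_def intro!: exI[of _ 0])

text \<open>Passage from a bound for every extension to the infimum. The constant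
  \<open>M + 1\<close> can be divided by even when M = 0.\<close>

lemma le_trace_norm:
  assumes M: "0 \<le> M" and v: "v \<in> Hcurl \<Omega>" "tang_trace_C \<Omega> \<Omega>C v = g"
    and bound: "\<And>w. w \<in> Hcurl \<Omega> \<Longrightarrow> tang_trace_C \<Omega> \<Omega>C w = g \<Longrightarrow> c \<le> M * Hcurl_norm \<Omega> w"
  shows "c \<le> (M + 1) * trace_norm \<Omega> \<Omega>C g"
proof -
  have "c / (M + 1) \<le> trace_norm \<Omega> \<Omega>C g"
    unfolding trace_norm_def
  proof (rule cINF_greatest)
    show "{w \<in> Hcurl \<Omega>. tang_trace_C \<Omega> \<Omega>C w = g} \<noteq> {}" using v by blast
    fix w assume "w \<in> {w \<in> Hcurl \<Omega>. tang_trace_C \<Omega> \<Omega>C w = g}"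
    then have "c \<le> M * Hcurl_norm \<Omega> w" using bound by blast
    also have "\<dots> \<le> Hcurl_norm \<Omega> w * (M + 1)"
      using Hcurl_norm_nonneg[of \<Omega> w] by (simp add: algebra_simps)
    finally show "c / (M + 1) \<le> Hcurl_norm \<Omega> w"
      using M by (simp add: pos_divide_le_eq)
  qed
  then show ?thesis
    using M by (simp add: pos_divide_le_eq mult.commute)
qed

text \<open>On a part, its own \<open>curl\<close> and the restricted \<open>curl\<close> of
  \<open>\<Omega>\<close> are possibly different representatives; after exchanging them, the
  integral splits.\<close>

lemma curlcurl_form_combine:
  assumes m: "Linfty \<Omega> (\<lambda>x. inverse (\<mu> x))" and v: "v \<in> Hcurl \<Omega>" and w: "w \<in> Hcurl \<Omega>"
  shows "curlcurl_form \<Omega> \<mu> v w = curlcurl_form \<Omega>C \<mu> v w + curlcurl_form \<Omega>I \<mu> v w"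
proof -
  let ?m = "\<lambda>x. inverse (\<mu> x)"
  have "mass_form Y ?m (curl \<Omega> v) (curl \<Omega> w) = curlcurl_form Y \<mu> v w" if Y: "open Y" "Y \<subseteq> \<Omega>" for Y
    unfolding curlcurl_form_eq_mass_form
    by (rule mass_form_cong[symmetric, OF open_lebesgue[OF Y(1)]
          Linfty_subset[OF domains_lebesgue(1) open_lebesgue[OF Y(1)] Y(2) m]
          HcurlD(3)[OF Hcurl_subset[OF open_domains(1) Y v]] HcurlD(3)[OF Hcurl_subset[OF open_domains(1) Y w]]
          curl_subset[OF open_domains(1) Y v] curl_subset[OF open_domains(1) Y w]])
  note part = this[OF open_domains(2) subdomains(1)] this[OF open_domains(3) subdomains(2)]
  have "mass_form \<Omega> ?m (curl \<Omega> v) (curl \<Omega> w)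
      = mass_form \<Omega>C ?m (curl \<Omega> v) (curl \<Omega> w) + mass_form \<Omega>I ?m (curl \<Omega> v) (curl \<Omega> w)"
    unfolding mass_form_def
    by (rule integral_combine[OF integrable_mass_form[OF m HcurlD(3)[OF v] HcurlD(3)[OF w]]])
  then show ?thesis
    unfolding part curlcurl_form_eq_mass_form[of \<Omega>] .
qed

end

text \<open>A point of \<open>\<Omega>\<close> in neither open part lies in one of the closures,
  hence on a frontier, and Lipschitz frontiers are null sets.\<close>

lemma conductor_insulator_geometry_interface:
  assumes "conductor_insulator_geometry \<Omega> \<Omega>C \<Omega>I \<Gamma>"
  shows "interface \<Omega> \<Omega>C \<Omega>I"
proof
  note g = assms[unfolded conductor_insulator_geometry_def]
  show o: "open \<Omega>" "open \<Omega>C" "open \<Omega>I"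
    using g by (auto simp: lipschitz_domain_def)
  show "\<Omega>C \<subseteq> \<Omega>" "\<Omega>I \<subseteq> \<Omega>" "\<Omega>C \<inter> \<Omega>I = {}"
    using g by auto
  have "\<Omega> \<subseteq> closure \<Omega>C \<union> closure \<Omega>I"
    using g closure_subset[of \<Omega>] by auto
  then have "\<Omega> - (\<Omega>C \<union> \<Omega>I) \<subseteq> frontier \<Omega>C \<union> frontier \<Omega>I"
    using o by (auto simp: frontier_def interior_open)
  moreover have "negligible (frontier \<Omega>C \<union> frontier \<Omega>I)"
    using g negligible_frontier_lipschitz_domain by (intro negligible_Un) auto
  ultimately show "negligible (\<Omega> - (\<Omega>C \<union> \<Omega>I))"
    using negligible_subset by blast
qed


section \<open>Linear functionals on finite-dimensional function spaces\<close>

lemma vector_space_cscale: "vector_space cscale"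
  by unfold_locales (auto simp: cscale_def fun_eq_iff algebra_simps)

text \<open>Point evaluations separate the elements of a space of functions, so on a finite-dimensional
  one they span the algebraic dual: a seminorm that bounds every evaluation bounds every linear
  functional. This avoids the equivalence of norms.\<close>

lemma linear_functional_bounded_on_span:
  fixes N :: "('a \<Rightarrow> complex) \<Rightarrow> real" and B :: "('a \<Rightarrow> complex) set"
  defines "W \<equiv> module.span cscale B"
  defines "D \<equiv> dual_space cscale N W"
  assumes fin: "finite B" and N: "\<And>g. g \<in> W \<Longrightarrow> 0 \<le> N g"
    and ev: "\<And>x. (\<lambda>g. g x) \<in> D"
    and lin: "\<And>g h. g \<in> W \<Longrightarrow> h \<in> W \<Longrightarrow> L (g + h) = L g + L h"
      "\<And>c g. g \<in> W \<Longrightarrow> L (cscale c g) = c * L g"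
  shows "L \<in> D"
proof -
  interpret C: vector_space cscale by (rule vector_space_cscale)
  have subW: "C.subspace W" by (simp add: W_def)
  have Dadd: "e (g + h) = e g + e h" if "e \<in> D" "g \<in> W" "h \<in> W" for e g h
    using that unfolding D_def dual_space_def by blast
  have Dscale: "e (cscale c g) = c * e g" if "e \<in> D" "g \<in> W" for e c g
    using that unfolding D_def dual_space_def by blast
  have Ddiff: "e (g - cscale c h) = e g - c * e h" if "e \<in> D" "g \<in> W" "h \<in> W" for e g c h
  proof -
    have "e (g - cscale c h + cscale c h) = e (g - cscale c h) + e (cscale c h)"
      using that subW by (intro Dadd C.subspace_diff C.subspace_scale)
    then show ?thesis using Dscale[OF that(1,3)] by simp
  qed
  \<comment> \<open>An algebraic separation statement with bounded functionals; it is proved by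
    adding one spanning vector at a time.\<close>
  have sep: "\<exists>e\<in>D. (\<forall>g\<in>C.span S. e g = 0) \<and> e b = 1"
    if "finite S" "S \<subseteq> B" "b \<in> W" "b \<notin> C.span S" for S b
    using that
  proof (induction S arbitrary: b rule: finite_induct)
    case empty
    then have "b \<noteq> 0" by (auto simp: C.span_empty)
    then obtain x where x: "b x \<noteq> 0" by (auto simp: fun_eq_iff)
    have "(\<lambda>g. inverse (b x) * g x) \<in> D"
      using ev[of x] unfolding D_def by (rule dual_space_mult)
    then show ?case
      by (intro bexI[of _ "\<lambda>g. inverse (b x) * g x"]) (auto simp: x C.span_empty)
  next
    case (insert s S)
    have sW: "s \<in> W" using insert.prems(1) C.span_base by (auto simp: W_def)
    have SW: "C.span S \<subseteq> W" using insert.prems(1) C.span_mono by (auto simp: W_def)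
    show ?case
    proof (cases "s \<in> C.span S")
      case True
      then have "C.span (insert s S) = C.span S"
        by (rule C.span_redundant)
      then show ?thesis
        using insert.IH[of b] insert.prems by auto
    next
      case False
      obtain e1 where e1: "e1 \<in> D" "\<forall>g\<in>C.span S. e1 g = 0" "e1 s = 1"
        using insert.IH[OF _ sW False] insert.prems(1) by auto
      \<comment> \<open>Subtracting this multiple of s keeps the vector outside the smaller span, so
        the induction hypothesis applies to it. It also makes the corrected functional
        \<open>?e\<close>, built to vanish at s, take the value e2 ?b = 1 at b.\<close>
      let ?b = "b - cscale (e1 b) s"
      have bW: "?b \<in> W"
        using insert.prems(2) sW subW by (intro C.subspace_diff C.subspace_scale)
      have "?b \<notin> C.span S"
        using insert.prems(3) C.span_breakdown_eq by blast
      then obtain e2 where e2: "e2 \<in> D" "\<forall>g\<in>C.span S. e2 g = 0" "e2 ?b = 1"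
        using insert.IH[OF _ bW] insert.prems(1) by blast
      let ?e = "\<lambda>g. e2 g - e2 s * e1 g"
      have "?e \<in> D"
        using e1(1) e2(1) N unfolding D_def by (intro dual_space_diff dual_space_mult)
      moreover have "?e b = 1"
        using Ddiff[OF e2(1) insert.prems(2) sW, of "e1 b"] e2(3) by (simp add: mult.commute)
      moreover have "?e g = 0" if "g \<in> C.span (insert s S)" for g
      proof -
        obtain k where k: "g - cscale k s \<in> C.span S"
          using \<open>g \<in> C.span (insert s S)\<close> C.span_breakdown_eq by blast
        have gW: "g \<in> W"
          using that insert.prems(1) C.span_mono unfolding W_def by blast
        show ?thesis
          using Ddiff[OF e1(1) gW sW, of k] Ddiff[OF e2(1) gW sW, of k] e1 e2 k by simp
      qed
      ultimately show ?thesis by (intro bexI[of _ ?e]) auto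
    qed
  qed
  \<comment> \<open>Interpolation of L by elements of \<open>D\<close>, one spanning vector at a
    time; on the full span the interpolant is L itself.\<close>
  have "\<exists>e\<in>D. \<forall>g\<in>C.span S. e g = L g" if "finite S" "S \<subseteq> B" for S
    using that
  proof (induction S rule: finite_induct)
    case empty
    have z: "0 \<in> W" using subW by (rule C.subspace_0)
    have "L 0 = 0"
      using lin(2)[OF z, of 0] by (simp add: cscale_def zero_fun_def)
    \<comment> \<open>The zero functional, written as a multiple of an evaluation so that
      \<open>ev\<close> places it in \<open>D\<close>; the point is arbitrary.\<close>
    moreover have "(\<lambda>g. 0 * g undefined) \<in> D"
      using ev unfolding D_def by (rule dual_space_mult)
    ultimately show ?case
      by (intro bexI[of _ "\<lambda>g. 0 * g undefined"]) (auto simp: C.span_empty zero_fun_def)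
  next
    case (insert s S)
    have sW: "s \<in> W" using insert.prems C.span_base by (auto simp: W_def)
    obtain e where e: "e \<in> D" "\<forall>g\<in>C.span S. e g = L g"
      using insert.IH insert.prems by auto
    show ?case
    proof (cases "s \<in> C.span S")
      case True
      then have "C.span (insert s S) = C.span S"
        by (rule C.span_redundant)
      then show ?thesis
        using e by auto
    next
      case False
      obtain e1 where e1: "e1 \<in> D" "\<forall>g\<in>C.span S. e1 g = 0" "e1 s = 1"
        using sep[OF insert.hyps(1) _ sW False] insert.prems by auto
      \<comment> \<open>\<open>e1\<close> vanishes on the old span and is 1 at s, so this corrects
        the value at s and nothing else.\<close>
      let ?e = "\<lambda>g. e g + (L s - e s) * e1 g"
      have "?e \<in> D"
        using e(1) e1(1) N unfolding D_def by (intro dual_space_add dual_space_mult)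
      moreover have "?e g = L g" if "g \<in> C.span (insert s S)" for g
      proof -
        obtain k where k: "g - cscale k s \<in> C.span S"
          using \<open>g \<in> C.span (insert s S)\<close> C.span_breakdown_eq by blast
        have gW: "g \<in> W"
          using that insert.prems C.span_mono unfolding W_def by blast
        have "L (g - cscale k s + cscale k s) = L (g - cscale k s) + L (cscale k s)"
          using gW sW subW by (intro lin(1) C.subspace_diff C.subspace_scale)
        then have "L g = L (g - cscale k s) + k * L s"
          using lin(2)[OF sW] by simp
        then show ?thesis
          using Ddiff[OF e(1) gW sW, of k] Ddiff[OF e1(1) gW sW, of k] e(2) e1(2,3) k
          by (simp add: algebra_simps)
      qed
      ultimately show ?thesis by (intro bexI[of _ ?e]) auto
    qed
  qed
  from this[OF fin order_refl] obtain e where e: "e \<in> D" "\<forall>g\<in>W. e g = L g"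
    by (auto simp: W_def)
  then show ?thesis
    using lin unfolding D_def dual_space_def by auto
qed


section \<open>Compatible splittings\<close>

lemma restr_space_refl: "f \<in> W \<Longrightarrow> f \<in> restr_space X W"
  unfolding restr_space_def using eq_ae_refl by blast

lemma restr_space_Hcurl_subspace:
  assumes X: "open X" and Y: "open Y" "Y \<subseteq> X" and W: "Hcurl_subspace X W"
  shows "Hcurl_subspace Y (restr_space Y W)"
proof -
  have WH: "W \<subseteq> Hcurl X" and sub: "module.subspace vscale W"
    using W by (auto simp: Hcurl_subspace_def)
  have "restr_space Y W \<subseteq> Hcurl Y"
  proof
    fix f assume "f \<in> restr_space Y W"
    then obtain g where g: "g \<in> W" "eq_ae Y f g" by (auto simp: restr_space_def)
    show "f \<in> Hcurl Y"
      by (rule Hcurl_cong[OF Y(1) Hcurl_subset[OF X Y] eq_ae_sym[OF g(2)]]) (use g WH in auto)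
  qed
  moreover have "module.subspace vscale (restr_space Y W)"
    unfolding module.subspace_def[OF module_vscale]
  proof (intro conjI allI ballI)
    show "0 \<in> restr_space Y W" by (rule restr_space_refl[OF subspaceD(1)[OF sub]])
    fix f assume f: "f \<in> restr_space Y W"
    then obtain g where g: "g \<in> W" "eq_ae Y f g" by (auto simp: restr_space_def)
    show "vscale c f \<in> restr_space Y W" for c
      using subspaceD(3)[OF sub g(1)] eq_ae_vscale[OF g(2)] unfolding restr_space_def by blast
    fix f' assume "f' \<in> restr_space Y W"
    then obtain g' where g': "g' \<in> W" "eq_ae Y f' g'" by (auto simp: restr_space_def)
    show "f + f' \<in> restr_space Y W"
      using subspaceD(2)[OF sub g(1) g'(1)] eq_ae_add[OF g(2) g'(2)] unfolding restr_space_def by blast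
  qed
  moreover have "ae_closed Y (restr_space Y W)"
    unfolding ae_closed_def restr_space_def using eq_ae_sym eq_ae_trans by blast
  ultimately show ?thesis
    by (simp add: Hcurl_subspace_def)
qed

section \<open>Consequences of a compatible splitting\<close>

locale compatible_split = interface \<Omega> \<Omega>C \<Omega>I
  for \<Omega> \<Omega>C \<Omega>I +
  fixes \<sigma> \<mu> :: "point \<Rightarrow> real" and H V :: "vector_field set" and U :: "scalar_field set"
  assumes coefficients: "admissible_coefficients \<Omega> \<Omega>C \<Omega>I \<sigma> \<mu>"
    and splitting: "splitting \<Omega> \<mu> H U V"
    and cases: "continuous_case \<Omega> H U \<or> discrete_case \<Omega> \<Omega>C \<Omega>I H U V"
    and compatible: "compatible_splitting \<Omega> \<Omega>C \<Omega>I H U V"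
begin

abbreviation "VC \<equiv> restr_space \<Omega>C V"
abbreviation "VI \<equiv> restr_space \<Omega>I V"
abbreviation "tr \<equiv> tang_trace_C \<Omega> \<Omega>C"

lemma Linfty_\<sigma>: "Linfty \<Omega>C \<sigma>"
  using coefficients Linfty_subset[OF domains_lebesgue(1,2) subdomains(1)]
  by (simp add: admissible_coefficients_def)

lemma Linfty_inverse_\<mu>:
  "Linfty \<Omega> (\<lambda>x. inverse (\<mu> x))" "Linfty \<Omega>C (\<lambda>x. inverse (\<mu> x))" "Linfty \<Omega>I (\<lambda>x. inverse (\<mu> x))"
proof -
  show 1: "Linfty \<Omega> (\<lambda>x. inverse (\<mu> x))"
    using coefficients by (intro Linfty_inverse) (auto simp: admissible_coefficients_def)
  show "Linfty \<Omega>C (\<lambda>x. inverse (\<mu> x))" "Linfty \<Omega>I (\<lambda>x. inverse (\<mu> x))"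
    by (rule Linfty_subset[OF domains_lebesgue(1,2) subdomains(1) 1],
        rule Linfty_subset[OF domains_lebesgue(1,3) subdomains(2) 1])
qed

lemma Hcurl_subspaces: "Hcurl_subspace \<Omega> H" "Hcurl_subspace \<Omega> V"
    "Hcurl_subspace \<Omega>C VC" "Hcurl_subspace \<Omega>I VI"
proof -
  show "Hcurl_subspace \<Omega> H" and V: "Hcurl_subspace \<Omega> V"
    using splitting by (simp_all add: splitting_def)
  show "Hcurl_subspace \<Omega>C VC" "Hcurl_subspace \<Omega>I VI"
    by (rule restr_space_Hcurl_subspace[OF open_domains(1,2) subdomains(1) V],
        rule restr_space_Hcurl_subspace[OF open_domains(1,3) subdomains(2) V])
qed

lemma subspace_V: "module.subspace vscale V" and subspace_VI: "module.subspace vscale VI"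
  using Hcurl_subspaces by (auto simp: Hcurl_subspace_def)

lemma V_Hcurl: "v \<in> V \<Longrightarrow> v \<in> Hcurl \<Omega>"
  and VC_Hcurl: "w \<in> VC \<Longrightarrow> w \<in> Hcurl \<Omega>C" and VI_Hcurl: "z \<in> VI \<Longrightarrow> z \<in> Hcurl \<Omega>I"
  using Hcurl_subspaces by (auto simp: Hcurl_subspace_def)

lemma V_C: "v \<in> V \<Longrightarrow> v \<in> Hcurl \<Omega>C" and V_I: "v \<in> V \<Longrightarrow> v \<in> Hcurl \<Omega>I"
  using V_Hcurl Hcurl_C Hcurl_I by blast+

lemma U_H1: "u \<in> U \<Longrightarrow> u \<in> H1 \<Omega>"
  using splitting by (auto simp: splitting_def H1_const_subspace_def)

lemma restr_U_H1:
  assumes "q \<in> restr_space \<Omega>C U"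
  shows "q \<in> H1 \<Omega>C"
proof -
  obtain u where u: "u \<in> U" "eq_ae \<Omega>C q u"
    using assms by (auto simp: restr_space_def)
  show ?thesis
    by (rule H1_cong[OF open_domains(2) H1_subset[OF open_domains(1,2) subdomains(1) U_H1[OF u(1)]]
          eq_ae_sym[OF u(2)]])
qed

lemma H_decompose:
  assumes "w \<in> H"
  obtains a b u where "w = a + b" "b \<in> V" "u \<in> U" "eq_ae \<Omega> a (grad \<Omega> u)"
  using assms splitting unfolding splitting_def direct_sum_def grads_def by blast

text \<open>\<open>direct_sum\<close> describes \<open>H\<close> by sums a + b, so v is written as 0
  + v; this requires 0 to be a gradient, although \<open>grad\<close> of the zero function is merely
  some null field.\<close>

lemma V_subset_H: "V \<subseteq> H"
proof
  fix v assume "v \<in> V"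
  have "(\<lambda>x. 0) \<in> U"
    using splitting by (simp add: splitting_def H1_const_subspace_def)
  moreover have "has_weak_grad \<Omega> (\<lambda>x. 0) 0"
    by (simp add: has_weak_grad_def L2_zero)
  then have "eq_ae \<Omega> 0 (grad \<Omega> (\<lambda>x. 0))"
    using has_weak_grad_unique[OF open_domains(1)] H1D(2)[OF U_H1[OF calculation]] by blast
  ultimately have "0 \<in> grads \<Omega> U"
    by (auto simp: grads_def)
  then have "0 + v \<in> H"
    using \<open>v \<in> V\<close> splitting unfolding splitting_def direct_sum_def by blast
  then show "v \<in> H" by simp
qed

text \<open>For the full space H(curl) this is the gluing theorem; for discrete spaces conformity
  across the interface is part of \<open>discrete_case\<close>.\<close>

lemma H_glues: "glues_across_interface \<Omega> \<Omega>C \<Omega>I H"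
  using cases
proof
  assume "continuous_case \<Omega> H U"
  then have H: "H = Hcurl \<Omega>" by (simp add: continuous_case_def)
  have C: "restr_space \<Omega>C H \<subseteq> Hcurl \<Omega>C"
    using restr_space_Hcurl_subspace[OF open_domains(1,2) subdomains(1) Hcurl_subspaces(1)]
    by (simp add: Hcurl_subspace_def)
  have I: "restr_space \<Omega>I H \<subseteq> Hcurl \<Omega>I"
    using restr_space_Hcurl_subspace[OF open_domains(1,3) subdomains(2) Hcurl_subspaces(1)]
    by (simp add: Hcurl_subspace_def)
  show ?thesis
    unfolding glues_across_interface_def
  proof (intro ballI impI)
    fix wC wI assume "wC \<in> restr_space \<Omega>C H" "wI \<in> restr_space \<Omega>I H" "tr wC = tang_trace_I \<Omega> \<Omega>I wI"
    then show "\<exists>w\<in>H. eq_ae \<Omega>C w wC \<and> eq_ae \<Omega>I w wI"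
      using C I Hcurl_glue unfolding H by blast
  qed
qed (simp add: discrete_case_def)

text \<open>The decomposition w = a + b is global, whereas compatibility is available on one
  subdomain at a time; hence the formulation with a single part \<open>Y\<close>.\<close>

lemma gradient_part_null:
  assumes Y: "open Y" "Y \<subseteq> \<Omega>"
    and ds: "direct_sum (null_fields Y) (restr_space Y H) (grads Y (restr_space Y U)) (restr_space Y V)"
    and w: "w = a + b" "b \<in> V" "u \<in> U" "eq_ae \<Omega> a (grad \<Omega> u)" "eq_ae Y w v" "v \<in> restr_space Y V"
  shows "eq_ae Y b v"
proof -
  have sub: "Hcurl_subspace Y (restr_space Y V)"
    by (rule restr_space_Hcurl_subspace[OF open_domains(1) Y Hcurl_subspaces(2)])
  have "eq_ae Y a (grad Y u)"
    using eq_ae_subset[OF domains_lebesgue(1) open_lebesgue[OF Y(1)] Y(2) w(4)]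
      eq_ae_sym[OF grad_subset[OF open_domains(1) Y U_H1[OF w(3)]]] by (rule eq_ae_trans)
  then have "a \<in> grads Y (restr_space Y U)"
    using restr_space_refl[OF w(3)] by (auto simp: grads_def)
  \<comment> \<open>On \<open>Y\<close> the gradient part is w - b, which agrees there with v -
    b.\<close>
  moreover have "a \<in> restr_space Y V"
  proof -
    have "v - b \<in> restr_space Y V"
      using sub w(6) restr_space_refl[OF w(2)] by (intro subspaceD(4)) (auto simp: Hcurl_subspace_def)
    moreover have "eq_ae Y (v - b) a"
      using eq_ae_diff[OF eq_ae_sym[OF w(5)] eq_ae_refl[of Y b]] by (simp add: w(1))
    ultimately show ?thesis
      using sub unfolding Hcurl_subspace_def ae_closed_def by blast
  qed
  ultimately have "eq_ae Y a 0"
    using ds unfolding direct_sum_def null_fields_def by blast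
  then have "eq_ae Y (w - a) (v - 0)"
    by (rule eq_ae_diff[OF w(5)])
  then show ?thesis by (simp add: w(1))
qed

lemma V_glue:
  assumes wC: "wC \<in> VC" and wI: "wI \<in> VI" and eq: "tr wC = tang_trace_I \<Omega> \<Omega>I wI"
  shows "\<exists>A\<in>V. eq_ae \<Omega>C A wC \<and> eq_ae \<Omega>I A wI"
proof -
  have "wC \<in> restr_space \<Omega>C H" "wI \<in> restr_space \<Omega>I H"
    using wC wI V_subset_H by (auto simp: restr_space_def)
  then obtain w where w: "w \<in> H" "eq_ae \<Omega>C w wC" "eq_ae \<Omega>I w wI"
    using H_glues eq unfolding glues_across_interface_def by blast
  obtain a b u where ab: "w = a + b" "b \<in> V" "u \<in> U" "eq_ae \<Omega> a (grad \<Omega> u)"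
    using H_decompose[OF w(1)] by blast
  have "eq_ae \<Omega>C b wC"
    by (rule gradient_part_null[OF open_domains(2) subdomains(1) _ ab w(2) wC])
      (use compatible in \<open>simp add: compatible_splitting_def\<close>)
  moreover have "eq_ae \<Omega>I b wI"
    by (rule gradient_part_null[OF open_domains(3) subdomains(2) _ ab w(3) wI])
      (use compatible in \<open>simp add: compatible_splitting_def\<close>)
  ultimately show ?thesis using ab(2) by blast
qed

section \<open>Traces of \<open>V\<close> and the boundedness of functionals on them\<close>

lemma tr_V_add: "v \<in> V \<Longrightarrow> w \<in> V \<Longrightarrow> tr (v + w) = tr v + tr w"
  by (intro tang_trace_C_add V_C)

lemma tr_V_vscale: "v \<in> V \<Longrightarrow> tr (vscale c v) = cscale c (tr v)"
  by (intro tang_trace_C_vscale V_C)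

text \<open>A Friedrichs inequality on \<open>V\<close>: coercivity bounds \<alpha> times the
  squared norm by the form, and boundedness of the inverse of \<open>\<mu>\<close> bounds the form
  by B times the squared norm of the curl. The constant is the root of B / \<alpha>.\<close>

lemma Hcurl_norm_le_curl:
  obtains K where "0 \<le> K" "\<And>v. v \<in> V \<Longrightarrow> Hcurl_norm \<Omega> v \<le> K * L2_norm_on \<Omega> (curl \<Omega> v)"
proof -
  obtain \<alpha> where \<alpha>: "0 < \<alpha>"
    "\<And>v. v \<in> V \<Longrightarrow> \<alpha> * (Hcurl_norm \<Omega> v)\<^sup>2 \<le> Re (curlcurl_form \<Omega> \<mu> v (conj_field v))"
    using splitting unfolding splitting_def coercive_on_def by blast
  obtain B where B: "0 \<le> B" "\<And>f g. L2 \<Omega> f \<Longrightarrow> L2 \<Omega> g \<Longrightarrow>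
      norm (mass_form \<Omega> (\<lambda>x. inverse (\<mu> x)) f g) \<le> B * (L2_norm_on \<Omega> f * L2_norm_on \<Omega> g)"
    using mass_form_bound[OF Linfty_inverse_\<mu>(1)] by blast
  have "Hcurl_norm \<Omega> v \<le> sqrt (B / \<alpha>) * L2_norm_on \<Omega> (curl \<Omega> v)" if "v \<in> V" for v
  proof -
    let ?n = "L2_norm_on \<Omega> (curl \<Omega> v)"
    have v: "v \<in> Hcurl \<Omega>" using that by (rule V_Hcurl)
    note cv = Hcurl_conj_field[OF open_domains(1) v]
    have "L2_norm_on \<Omega> (curl \<Omega> (conj_field v)) = L2_norm_on \<Omega> (conj_field (curl \<Omega> v))"
      by (rule L2_norm_on_cong_ae[OF HcurlD(3)[OF cv] L2_conj_field[OF HcurlD(3)[OF v]]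
            curl_conj_field[OF open_domains(1) v]])
    also have "\<dots> = ?n"
      by (simp add: L2_norm_on_def conj_field_def norm_conj_vec)
    finally have n: "L2_norm_on \<Omega> (curl \<Omega> (conj_field v)) = ?n" .
    have "\<alpha> * (Hcurl_norm \<Omega> v)\<^sup>2 \<le> cmod (curlcurl_form \<Omega> \<mu> v (conj_field v))"
      using \<alpha>(2)[OF that] complex_Re_le_cmod order_trans by blast
    also have "\<dots> \<le> B * (?n * ?n)"
      using B(2)[OF HcurlD(3)[OF v] HcurlD(3)[OF cv]] by (simp add: curlcurl_form_eq_mass_form n)
    finally have "(Hcurl_norm \<Omega> v)\<^sup>2 \<le> B / \<alpha> * ?n\<^sup>2"
      using \<alpha>(1) by (simp add: field_simps power2_eq_square)
    then have "sqrt ((Hcurl_norm \<Omega> v)\<^sup>2) \<le> sqrt (B / \<alpha> * ?n\<^sup>2)"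
      by (rule real_sqrt_le_mono)
    then show ?thesis
      using Hcurl_norm_nonneg[of \<Omega> v] L2_norm_on_nonneg[of \<Omega> "curl \<Omega> v"]
      by (simp only: real_sqrt_mult real_sqrt_abs abs_of_nonneg)
  qed
  then show ?thesis
    using that[of "sqrt (B / \<alpha>)"] B(1) \<alpha>(1) by simp
qed

text \<open>In the continuous case any extension w of a trace in \<open>\<V>\<^sub>\<Gamma>\<close> splits as \<open>\<nabla>u + v\<close> where v has the
  same trace by compatibility, and coercivity controls v by \<open>curl w = curl v\<close>.\<close>

lemma V_representative:
  assumes "continuous_case \<Omega> H U"
  obtains K where "0 \<le> K" "\<And>v w. v \<in> V \<Longrightarrow> w \<in> Hcurl \<Omega> \<Longrightarrow> tr w = tr v \<Longrightarrow>
    \<exists>b\<in>V. tr b = tr v \<and> Hcurl_norm \<Omega> b \<le> K * Hcurl_norm \<Omega> w"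
proof -
  obtain K where K: "0 \<le> K" "\<And>v. v \<in> V \<Longrightarrow> Hcurl_norm \<Omega> v \<le> K * L2_norm_on \<Omega> (curl \<Omega> v)"
    using Hcurl_norm_le_curl by blast
  have "\<exists>b\<in>V. tr b = tr v \<and> Hcurl_norm \<Omega> b \<le> K * Hcurl_norm \<Omega> w"
    if v: "v \<in> V" and w: "w \<in> Hcurl \<Omega>" and eq: "tr w = tr v" for v w
  proof -
    have "w \<in> H" using w assms by (simp add: continuous_case_def)
    then obtain a b u where ab: "w = a + b" "b \<in> V" "u \<in> U" "eq_ae \<Omega> a (grad \<Omega> u)"
      by (rule H_decompose)
    have gu: "grad \<Omega> u \<in> Hcurl \<Omega>" "eq_ae \<Omega> (curl \<Omega> (grad \<Omega> u)) 0"
      by (rule grad_Hcurl[OF open_domains(1) U_H1[OF ab(3)]], rule curl_grad[OF open_domains(1) U_H1[OF ab(3)]])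
    have a: "a \<in> Hcurl \<Omega>" "eq_ae \<Omega> (curl \<Omega> a) 0"
      by (rule Hcurl_cong[OF open_domains(1) gu(1) eq_ae_sym[OF ab(4)]],
          rule eq_ae_trans[OF eq_ae_sym[OF curl_cong[OF open_domains(1) gu(1) eq_ae_sym[OF ab(4)]]] gu(2)])
    have b: "b \<in> Hcurl \<Omega>" by (rule V_Hcurl[OF ab(2)])
    have vb: "v + vscale (- 1) b \<in> V"
      by (intro subspaceD[OF subspace_V] v ab(2))
    have "tr w = tr a + tr b"
      unfolding ab(1) by (intro tang_trace_C_add Hcurl_C a b)
    then have "tr a = tr v - tr b"
      by (simp add: eq)
    also have "\<dots> = tr (v + vscale (- 1) b)"
      using tr_V_add[OF v subspaceD(3)[OF subspace_V ab(2)], of "- 1"] tr_V_vscale[OF ab(2), of "- 1"]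
      by (simp add: cscale_def fun_eq_iff)
    \<comment> \<open>The trace of the gradient part is the trace of v - b and also a surface
      gradient; directness of the sum on the interface makes it 0.\<close>
    finally have "tr a \<in> trace_space \<Omega> \<Omega>C V"
      using vb by (auto simp: trace_space_def)
    moreover have "tr a \<in> surface_grad \<Omega> ` scalar_trace \<Omega> \<Omega>C ` U"
      using tang_trace_C_grad[OF U_H1[OF ab(3)] ab(4)] ab(3) by blast
    moreover have "surface_grad \<Omega> ` scalar_trace \<Omega> \<Omega>C ` U \<inter> trace_space \<Omega> \<Omega>C V = {0}"
      using compatible unfolding compatible_splitting_def direct_sum_def by (elim conjE)
    ultimately have "tr a = 0" by blast
    then have trb: "tr b = tr v"
      using \<open>tr a = tr v - tr b\<close> by simp
    have "eq_ae \<Omega> (curl \<Omega> w) (curl \<Omega> a + curl \<Omega> b)"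
      unfolding ab(1) by (rule curl_add[OF open_domains(1) a(1) b])
    then have "eq_ae \<Omega> (curl \<Omega> w) (0 + curl \<Omega> b)"
      using eq_ae_add[OF a(2) eq_ae_refl] by (rule eq_ae_trans)
    then have "L2_norm_on \<Omega> (curl \<Omega> w) = L2_norm_on \<Omega> (curl \<Omega> b)"
      using HcurlD(3)[OF w] HcurlD(3)[OF b] by (intro L2_norm_on_cong_ae) simp_all
    then have "Hcurl_norm \<Omega> b \<le> K * L2_norm_on \<Omega> (curl \<Omega> w)"
      using K(2)[OF ab(2)] by simp
    also have "\<dots> \<le> K * Hcurl_norm \<Omega> w"
      by (intro mult_left_mono L2_norm_curl_le_Hcurl_norm K(1))
    finally show ?thesis using ab(2) trb by blast
  qed
  then show ?thesis using that K(1) by blast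
qed

text \<open>Being the trace of some v makes the infimum range over a nonempty set, without which its
  value would be unspecified.\<close>

lemma trace_norm_nonneg: "0 \<le> trace_norm \<Omega> \<Omega>C (tr v)" if "v \<in> V"
  unfolding trace_norm_def by (rule cINF_greatest) (use V_Hcurl[OF that] Hcurl_norm_nonneg in auto)

text \<open>Finite dimension of \<open>V\<close> holds only up to null sets. Traces do not see null
  sets, so the image space is an exact span.\<close>

lemma trace_space_finite_span:
  assumes "discrete_case \<Omega> \<Omega>C \<Omega>I H U V"
  obtains B where "finite B" "trace_space \<Omega> \<Omega>C V = module.span cscale B"
proof -
  interpret C: vector_space cscale by (rule vector_space_cscale)
  obtain B where B: "finite B" "B \<subseteq> V" "\<forall>f\<in>V. \<exists>g\<in>module.span vscale B. eq_ae \<Omega> f g"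
    using assms unfolding discrete_case_def finite_dim_def by blast
  have "trace_space \<Omega> \<Omega>C V \<subseteq> C.span (tr ` B)"
  proof
    fix t assume "t \<in> trace_space \<Omega> \<Omega>C V"
    then obtain f where f: "f \<in> V" "t = tr f" by (auto simp: trace_space_def)
    then obtain g where g: "g \<in> module.span vscale B" "eq_ae \<Omega> f g" using B(3) by blast
    have "g \<in> V \<and> tr g \<in> C.span (tr ` B)"
      using g(1)
    proof (induction rule: module.span_induct_alt[OF module_vscale, consumes 1, case_names base step])
      case base
      then show ?case
        using subspaceD(1)[OF subspace_V] tang_trace_C_zero C.span_zero by metis
    next
      case (step c x y)
      have x: "x \<in> V" using step.hyps B(2) by blast
      have cx: "vscale c x \<in> V" by (rule subspaceD(3)[OF subspace_V x])
      have y: "y \<in> V" "tr y \<in> C.span (tr ` B)" using step.IH by blast+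
      have "tr (vscale c x + y) = cscale c (tr x) + tr y"
        using tr_V_add[OF cx y(1)] tr_V_vscale[OF x] by (simp only:)
      also have "\<dots> \<in> C.span (tr ` B)"
        by (rule C.span_add[OF C.span_scale[OF C.span_base[OF imageI[OF step.hyps(1)]]] y(2)])
      finally show ?case
        using subspaceD(2)[OF subspace_V cx y(1)] by blast
    qed
    moreover have "tr g = tr f"
      by (rule tang_trace_C_cong[OF V_C[OF f(1)] eq_ae_subset[OF domains_lebesgue(1,2) subdomains(1) g(2)]])
    ultimately show "t \<in> C.span (tr ` B)" by (simp add: f(2))
  qed
  moreover have "C.span (tr ` B) \<subseteq> trace_space \<Omega> \<Omega>C V"
  proof (rule C.span_minimal)
    show "tr ` B \<subseteq> trace_space \<Omega> \<Omega>C V" using B(2) by (auto simp: trace_space_def)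
    show "C.subspace (trace_space \<Omega> \<Omega>C V)"
      unfolding C.subspace_def trace_space_def
    proof (intro conjI allI ballI)
      show "0 \<in> tr ` V"
        using subspaceD(1)[OF subspace_V] tang_trace_C_zero by (metis imageI)
      fix s assume "s \<in> tr ` V"
      then obtain v where v: "v \<in> V" "s = tr v" by blast
      show "cscale c s \<in> tr ` V" for c
        using tr_V_vscale[OF v(1), of c] subspaceD(3)[OF subspace_V v(1)] v(2) by (metis imageI)
      fix t assume "t \<in> tr ` V"
      then obtain w where w: "w \<in> V" "t = tr w" by blast
      show "s + t \<in> tr ` V"
        using tr_V_add[OF v(1) w(1)] subspaceD(2)[OF subspace_V v(1) w(1)] v(2) w(2) by (metis imageI)
    qed
  qed
  ultimately show ?thesis
    using that[of "tr ` B"] B(1) by blast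
qed

text \<open>The evaluation bound holds uniformly over all extensions and so passes to the infimum.
  This is the input for the functional argument in the discrete case.\<close>

lemma trace_evaluation_dual: "(\<lambda>g. g \<psi>) \<in> dual_space cscale (trace_norm \<Omega> \<Omega>C) (trace_space \<Omega> \<Omega>C V)"
proof -
  obtain K where K: "0 \<le> K" "\<forall>w\<in>Hcurl \<Omega>. cmod (tr w \<psi>) \<le> K * Hcurl_norm \<Omega> w"
    using tang_trace_C_bound by blast
  have "cmod (tr v \<psi>) \<le> (K + 1) * trace_norm \<Omega> \<Omega>C (tr v)" if "v \<in> V" for v
  proof (rule le_trace_norm[OF K(1) V_Hcurl[OF that] refl])
    show "cmod (tr v \<psi>) \<le> K * Hcurl_norm \<Omega> w" if "w \<in> Hcurl \<Omega>" "tr w = tr v" for w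
      using K(2) that by metis
  qed
  then show ?thesis
    by (auto simp: dual_space_def trace_space_def cscale_def)
qed

text \<open>\<open>FC\<close> and \<open>FI\<close> stand for the residuals in conductor and
  insulator; \<open>balance\<close> says that they cancel on global fields, which is how the first
  row of (MQS) enters.\<close>

lemma multiplier_exists:
  assumes FC: "FC \<in> dual_space vscale (Hcurl_norm \<Omega>C) VC"
    and FI: "FI \<in> dual_space vscale (Hcurl_norm \<Omega>I) VI"
    and balance: "\<And>v. v \<in> V \<Longrightarrow> FC v + FI v = 0"
  shows "\<exists>\<Lambda> \<in> dual_space cscale (trace_norm \<Omega> \<Omega>C) (trace_space \<Omega> \<Omega>C V). \<forall>v\<in>V. \<Lambda> (tr v) = FC v"
proof -
  have FC_add: "FC (v + w) = FC v + FC w" if "v \<in> V" "w \<in> V" for v w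
    using FC that restr_space_refl unfolding dual_space_def by blast
  have FC_scale: "FC (vscale c v) = c * FC v" if "v \<in> V" for c v
    using FC that restr_space_refl unfolding dual_space_def by blast
  have zero: "FC v = 0" if v: "v \<in> V" "tr v = 0" for v
  proof -
    have 0: "0 \<in> VI" by (rule subspaceD(1)[OF subspace_VI])
    have "tr v = tang_trace_I \<Omega> \<Omega>I 0"
      using v(2) tang_trace_C_eq_I[OF zero_Hcurl] tang_trace_C_zero by simp
    then obtain A where A: "A \<in> V" "eq_ae \<Omega>C A v" "eq_ae \<Omega>I A 0"
      using V_glue[OF restr_space_refl[OF v(1)] 0] by blast
    have "FC A = FC v"
      by (rule dual_space_cong[OF open_domains(2) Hcurl_subspaces(3) FC restr_space_refl[OF v(1)] eq_ae_sym[OF A(2)]])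
    moreover have "FI A = FI 0"
      by (rule dual_space_cong[OF open_domains(3) Hcurl_subspaces(4) FI 0 eq_ae_sym[OF A(3)]])
    \<comment> \<open>Homogeneity with factor 0 at the element 0 of \<open>VI\<close> yields
      \<open>FI 0 = 0\<close>.\<close>
    moreover have "FI (vscale 0 0) = 0 * FI 0"
      using FI 0 unfolding dual_space_def by blast
    then have "FI 0 = 0"
      by (simp add: vscale_def zero_fun_def)
    ultimately show ?thesis
      using balance[OF A(1)] by simp
  qed
  have eq: "FC v = FC w" if vw: "v \<in> V" "w \<in> V" "tr v = tr w" for v w
  proof -
    let ?d = "v + vscale (- 1) w"
    have mw: "vscale (- 1) w \<in> V" by (rule subspaceD(3)[OF subspace_V vw(2)])
    have "?d \<in> V" by (rule subspaceD(2)[OF subspace_V vw(1) mw])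
    moreover have "tr ?d = 0"
      using tr_V_add[OF vw(1) mw] tr_V_vscale[OF vw(2), of "- 1"] vw(3) by (simp add: cscale_def fun_eq_iff)
    ultimately have "FC ?d = 0" by (rule zero)
    then show ?thesis
      using FC_add[OF vw(1) mw] FC_scale[OF vw(2), of "- 1"] by simp
  qed
  \<comment> \<open>The value is taken at an arbitrary preimage in \<open>V\<close>;
    \<open>eq\<close> makes it independent of the choice.\<close>
  define \<Lambda> where "\<Lambda> g = FC (SOME v. v \<in> V \<and> tr v = g)" for g
  have \<Lambda>: "\<Lambda> (tr v) = FC v" if "v \<in> V" for v
  proof -
    have "(SOME w. w \<in> V \<and> tr w = tr v) \<in> V \<and> tr (SOME w. w \<in> V \<and> tr w = tr v) = tr v"
      by (rule someI[of "\<lambda>w. w \<in> V \<and> tr w = tr v" v]) (use that in simp)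
    then show ?thesis
      unfolding \<Lambda>_def using eq that by blast
  qed
  have \<Lambda>_add: "\<Lambda> (g + h) = \<Lambda> g + \<Lambda> h" if gh: "g \<in> trace_space \<Omega> \<Omega>C V" "h \<in> trace_space \<Omega> \<Omega>C V" for g h
  proof -
    obtain v w where vw: "v \<in> V" "g = tr v" "w \<in> V" "h = tr w"
      using gh by (auto simp: trace_space_def)
    then show ?thesis
      using \<Lambda>[OF subspaceD(2)[OF subspace_V vw(1,3)]] \<Lambda> FC_add tr_V_add by simp
  qed
  have \<Lambda>_scale: "\<Lambda> (cscale c g) = c * \<Lambda> g" if g: "g \<in> trace_space \<Omega> \<Omega>C V" for c g
  proof -
    obtain v where v: "v \<in> V" "g = tr v"
      using g by (auto simp: trace_space_def)
    then show ?thesis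
      using \<Lambda>[OF subspaceD(3)[OF subspace_V v(1)], of c] \<Lambda> FC_scale tr_V_vscale by simp
  qed
  have "\<Lambda> \<in> dual_space cscale (trace_norm \<Omega> \<Omega>C) (trace_space \<Omega> \<Omega>C V)"
    using cases
  proof
    assume cont: "continuous_case \<Omega> H U"
    obtain K where K: "0 \<le> K" "\<And>v w. v \<in> V \<Longrightarrow> w \<in> Hcurl \<Omega> \<Longrightarrow> tr w = tr v \<Longrightarrow>
        \<exists>b\<in>V. tr b = tr v \<and> Hcurl_norm \<Omega> b \<le> K * Hcurl_norm \<Omega> w"
      using V_representative[OF cont] by blast
    obtain B where B: "0 \<le> B" "\<And>v. v \<in> VC \<Longrightarrow> cmod (FC v) \<le> B * Hcurl_norm \<Omega>C v"
      using dual_space_bound[OF FC Hcurl_norm_nonneg] by blast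
    \<comment> \<open>An arbitrary extension w is replaced by b in \<open>V\<close> with the same
      trace, hence the same value of \<open>\<Lambda>\<close>. \<open>K\<close> bounds b by w, and
      \<open>B\<close> bounds \<open>FC\<close>.\<close>
    have "cmod (\<Lambda> (tr v)) \<le> (B * K + 1) * trace_norm \<Omega> \<Omega>C (tr v)" if v: "v \<in> V" for v
    proof (rule le_trace_norm[OF _ V_Hcurl[OF v] refl])
      show "0 \<le> B * K" using B(1) K(1) by simp
      fix w assume w: "w \<in> Hcurl \<Omega>" "tr w = tr v"
      obtain b where b: "b \<in> V" "tr b = tr v" "Hcurl_norm \<Omega> b \<le> K * Hcurl_norm \<Omega> w"
        using K(2)[OF v w] by blast
      have "cmod (\<Lambda> (tr v)) = cmod (FC b)"
        using \<Lambda>[OF b(1)] b(2) by simp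
      also have "\<dots> \<le> B * Hcurl_norm \<Omega>C b"
        by (rule B(2)[OF restr_space_refl[OF b(1)]])
      also have "\<dots> \<le> B * Hcurl_norm \<Omega> b"
        by (intro mult_left_mono Hcurl_norm_mono open_domains subdomains V_Hcurl b(1) B(1))
      also have "\<dots> \<le> B * (K * Hcurl_norm \<Omega> w)"
        by (intro mult_left_mono b(3) B(1))
      finally show "cmod (\<Lambda> (tr v)) \<le> B * K * Hcurl_norm \<Omega> w"
        by (simp add: mult.assoc)
    qed
    then show ?thesis
      using \<Lambda>_add \<Lambda>_scale by (auto simp: dual_space_def trace_space_def)
  next
    assume "discrete_case \<Omega> \<Omega>C \<Omega>I H U V"
    then obtain B where B: "finite B" "trace_space \<Omega> \<Omega>C V = module.span cscale B"
      by (rule trace_space_finite_span)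
    show ?thesis
      unfolding B(2)
    proof (rule linear_functional_bounded_on_span[OF B(1)])
      fix g assume "g \<in> module.span cscale B"
      then show "0 \<le> trace_norm \<Omega> \<Omega>C g"
        unfolding B(2)[symmetric] using trace_norm_nonneg by (auto simp: trace_space_def)
    qed (use trace_evaluation_dual \<Lambda>_add \<Lambda>_scale in \<open>simp_all add: B(2)\<close>)
  qed
  with \<Lambda> show ?thesis by blast
qed

end

section \<open>Equivalence of the two formulations\<close>

theorem theorem4p1:
  fixes \<Omega> \<Omega>C \<Omega>I \<Gamma> :: "point set"
    and \<sigma> \<mu> :: "point \<Rightarrow> real"
    and \<omega> :: real
    and H V :: "vector_field set"
    and U :: "scalar_field set"
    and J JC JI :: "vector_field \<Rightarrow> complex"
    and j :: "scalar_field \<Rightarrow> complex"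
    and E :: "scalar_field \<Rightarrow> scalar_field"
  assumes geometry: "conductor_insulator_geometry \<Omega> \<Omega>C \<Omega>I \<Gamma>"
    and coefficients: "admissible_coefficients \<Omega> \<Omega>C \<Omega>I \<sigma> \<mu>"
    and splitting: "splitting \<Omega> \<mu> H U V"
    and cases: "continuous_case \<Omega> H U \<or> discrete_case \<Omega> \<Omega>C \<Omega>I H U V"
    and compatible: "compatible_splitting \<Omega> \<Omega>C \<Omega>I H U V"
    and J: "J \<in> dual_space vscale (Hcurl_norm \<Omega>) (Hcurl \<Omega>)"
    and J_compatible:
      "\<And>q. q \<in> U \<Longrightarrow> eq_ae (\<Omega> \<inter> closure \<Omega>C) q 0 \<Longrightarrow> J (grad \<Omega> q) = 0"
    and E: "extension_operator \<Omega> \<Omega>C U E"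
    and j: "\<And>q. q \<in> restr_space \<Omega>C U \<Longrightarrow> j q = J (grad \<Omega> (E q))"
    and JC: "JC \<in> dual_space vscale (Hcurl_norm \<Omega>C) (restr_space \<Omega>C V)"
    and JI: "JI \<in> dual_space vscale (Hcurl_norm \<Omega>I) (restr_space \<Omega>I V)"
    and J_split: "\<And>v. v \<in> V \<Longrightarrow> J v = JC v + JI v"
  shows "(\<forall>AI AC \<phi> \<Lambda>. solves_TI \<Omega> \<Omega>C \<Omega>I \<sigma> \<mu> \<omega> U V JI JC j AI AC \<phi> \<Lambda> \<longrightarrow>
            (\<exists>A\<in>V. eq_ae \<Omega>I A AI \<and> eq_ae \<Omega>C A AC \<and>
               (\<forall>A'\<in>V. eq_ae \<Omega>I A' AI \<and> eq_ae \<Omega>C A' AC \<longrightarrow> eq_ae \<Omega> A' A) \<and>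
               solves_MQS \<Omega> \<Omega>C \<sigma> \<mu> \<omega> U V J j A \<phi>)) \<and>
         (\<forall>A \<phi>. solves_MQS \<Omega> \<Omega>C \<sigma> \<mu> \<omega> U V J j A \<phi> \<longrightarrow>
            (\<exists>\<Lambda>. solves_TI \<Omega> \<Omega>C \<Omega>I \<sigma> \<mu> \<omega> U V JI JC j A A \<phi> \<Lambda>))"
proof -
  interpret interface \<Omega> \<Omega>C \<Omega>I
    by (rule conductor_insulator_geometry_interface[OF geometry])
  interpret compatible_split \<Omega> \<Omega>C \<Omega>I \<sigma> \<mu> H V U
    by unfold_locales (rule coefficients splitting cases compatible)+
  show ?thesis
  proof (intro conjI allI impI)
    fix AI AC \<phi> \<Lambda> assume TI: "solves_TI \<Omega> \<Omega>C \<Omega>I \<sigma> \<mu> \<omega> U V JI JC j AI AC \<phi> \<Lambda>"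
    then have AI: "AI \<in> VI" and AC: "AC \<in> VC" and \<phi>: "\<phi> \<in> restr_space \<Omega>C U"
      and \<Lambda>: "\<Lambda> \<in> dual_space cscale (trace_norm \<Omega> \<Omega>C) (trace_space \<Omega> \<Omega>C V)"
      and eqI: "\<And>w. w \<in> VI \<Longrightarrow> curlcurl_form \<Omega>I \<mu> AI w + \<Lambda> (- tang_trace_I \<Omega> \<Omega>I w) = JI w"
      and eqC: "\<And>w. w \<in> VC \<Longrightarrow> curlcurl_form \<Omega>C \<mu> AC w + \<i> * \<omega> * mass_form \<Omega>C \<sigma> AC w
          + S_form \<Omega>C \<sigma> w \<phi> + \<Lambda> (tr w) = JC w"
      and eq\<phi>: "\<And>q. q \<in> restr_space \<Omega>C U \<Longrightarrow> \<i> * \<omega> * S_form \<Omega>C \<sigma> AC q + C_form \<Omega>C \<sigma> \<phi> q = j q"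
      and tr: "- tang_trace_I \<Omega> \<Omega>I AI + tr AC = 0"
      unfolding solves_TI_def Let_def by blast+
    have "tr AC = tang_trace_I \<Omega> \<Omega>I AI"
      using tr by (simp add: neg_eq_iff_add_eq_0)
    then obtain A where A: "A \<in> V" "eq_ae \<Omega>C A AC" "eq_ae \<Omega>I A AI"
      using V_glue[OF AC AI] by blast
    have mass: "mass_form \<Omega>C \<sigma> A f = mass_form \<Omega>C \<sigma> AC f" if "L2 \<Omega>C f" for f
      by (rule mass_form_cong[OF domains_lebesgue(2) Linfty_\<sigma> HcurlD(1)[OF V_C[OF A(1)]] that A(2) eq_ae_refl])
    have "solves_MQS \<Omega> \<Omega>C \<sigma> \<mu> \<omega> U V J j A \<phi>"
      unfolding solves_MQS_def
    proof (intro conjI ballI)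
      show "A \<in> V" "\<phi> \<in> restr_space \<Omega>C U" by fact+
      fix w assume w: "w \<in> V"
      have C: "curlcurl_form \<Omega>C \<mu> A w = curlcurl_form \<Omega>C \<mu> AC w"
        by (rule curlcurl_form_cong[OF open_domains(2) Linfty_inverse_\<mu>(2) V_C[OF A(1)] A(2) V_C[OF w] eq_ae_refl])
      have I: "curlcurl_form \<Omega>I \<mu> A w = curlcurl_form \<Omega>I \<mu> AI w"
        by (rule curlcurl_form_cong[OF open_domains(3) Linfty_inverse_\<mu>(3) V_I[OF A(1)] A(3) V_I[OF w] eq_ae_refl])
      \<comment> \<open>A global w has the same trace from both sides and the insulator operator
        carries a minus sign, so the multiplier enters the two rows with opposite signs and drops
        out of their sum.\<close>
      have "tr w \<in> trace_space \<Omega> \<Omega>C V" using w by (simp add: trace_space_def)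
      then have "\<Lambda> (cscale (- 1) (tr w)) = - 1 * \<Lambda> (tr w)"
        using \<Lambda> unfolding dual_space_def by blast
      moreover have "cscale (- 1) (tr w) = - tang_trace_I \<Omega> \<Omega>I w"
        unfolding tang_trace_C_eq_I[OF V_Hcurl[OF w]] by (simp add: cscale_def fun_eq_iff)
      ultimately have "\<Lambda> (- tang_trace_I \<Omega> \<Omega>I w) = - \<Lambda> (tr w)" by simp
      then show "curlcurl_form \<Omega> \<mu> A w + \<i> * \<omega> * mass_form \<Omega>C \<sigma> A w + S_form \<Omega>C \<sigma> w \<phi> = J w"
        unfolding curlcurl_form_combine[OF Linfty_inverse_\<mu>(1) V_Hcurl[OF A(1)] V_Hcurl[OF w]] C I
          mass[OF HcurlD(1)[OF V_C[OF w]]] J_split[OF w]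
          eqI[OF restr_space_refl[OF w], symmetric] eqC[OF restr_space_refl[OF w], symmetric]
        by simp
    next
      fix q assume q: "q \<in> restr_space \<Omega>C U"
      show "\<i> * \<omega> * S_form \<Omega>C \<sigma> A q + C_form \<Omega>C \<sigma> \<phi> q = j q"
        using eq\<phi>[OF q] mass[OF H1D(3)[OF restr_U_H1[OF q]]] by (simp add: S_form_def)
    qed
    \<comment> \<open>The two restrictions determine a field almost everywhere on
      \<open>\<Omega>\<close>, since the interface is a null set.\<close>
    moreover have "eq_ae \<Omega> A' A" if "eq_ae \<Omega>I A' AI" "eq_ae \<Omega>C A' AC" for A'
      using that A eq_ae_sym eq_ae_trans by (blast intro: eq_ae_combine)
    ultimately show "\<exists>A\<in>V. eq_ae \<Omega>I A AI \<and> eq_ae \<Omega>C A AC \<and>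
        (\<forall>A'\<in>V. eq_ae \<Omega>I A' AI \<and> eq_ae \<Omega>C A' AC \<longrightarrow> eq_ae \<Omega> A' A) \<and>
        solves_MQS \<Omega> \<Omega>C \<sigma> \<mu> \<omega> U V J j A \<phi>"
      using A by blast
  next
    fix A \<phi> assume MQS: "solves_MQS \<Omega> \<Omega>C \<sigma> \<mu> \<omega> U V J j A \<phi>"
    then have A: "A \<in> V" and \<phi>: "\<phi> \<in> restr_space \<Omega>C U"
      and eqA: "\<And>w. w \<in> V \<Longrightarrow>
        curlcurl_form \<Omega> \<mu> A w + \<i> * \<omega> * mass_form \<Omega>C \<sigma> A w + S_form \<Omega>C \<sigma> w \<phi> = J w"
      and eq\<phi>: "\<And>q. q \<in> restr_space \<Omega>C U \<Longrightarrow> \<i> * \<omega> * S_form \<Omega>C \<sigma> A q + C_form \<Omega>C \<sigma> \<phi> q = j q"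
      by (simp_all add: solves_MQS_def)
    \<comment> \<open>Arranged so that the conductor row reads \<Lambda> (tr w) = FC w. The
      potential term has its arguments swapped by symmetry, so that w is the linear
      argument.\<close>
    define FC where "FC w = JC w - (curlcurl_form \<Omega>C \<mu> A w
      + (\<i> * \<omega> * mass_form \<Omega>C \<sigma> A w + mass_form \<Omega>C \<sigma> (grad \<Omega>C \<phi>) w))" for w
    define FI where "FI w = JI w - curlcurl_form \<Omega>I \<mu> A w" for w
    have VC: "VC \<subseteq> Hcurl \<Omega>C" and VI: "VI \<subseteq> Hcurl \<Omega>I"
      using VC_Hcurl VI_Hcurl by blast+
    have FC: "FC \<in> dual_space vscale (Hcurl_norm \<Omega>C) VC"
      unfolding FC_def
      by (intro dual_space_diff dual_space_add dual_space_mult JC Hcurl_norm_nonneg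
          curlcurl_form_dual_space mass_form_dual_space open_domains VC Linfty_inverse_\<mu> Linfty_\<sigma>
          V_C A HcurlD(1)[OF V_C] H1D(3) restr_U_H1 \<phi>)
    have FI: "FI \<in> dual_space vscale (Hcurl_norm \<Omega>I) VI"
      unfolding FI_def
      by (intro dual_space_diff JI Hcurl_norm_nonneg curlcurl_form_dual_space open_domains VI
          Linfty_inverse_\<mu> V_I A)
    have balance: "FC w + FI w = 0" if w: "w \<in> V" for w
      using eqA[OF w] J_split[OF w]
        curlcurl_form_combine[OF Linfty_inverse_\<mu>(1) V_Hcurl[OF A] V_Hcurl[OF w]]
      by (simp add: FC_def FI_def S_form_def mass_form_commute[of _ _ _ w] algebra_simps)
    obtain \<Lambda> where \<Lambda>: "\<Lambda> \<in> dual_space cscale (trace_norm \<Omega> \<Omega>C) (trace_space \<Omega> \<Omega>C V)"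
      "\<And>v. v \<in> V \<Longrightarrow> \<Lambda> (tr v) = FC v"
      using multiplier_exists[OF FC FI balance] by blast
    have "solves_TI \<Omega> \<Omega>C \<Omega>I \<sigma> \<mu> \<omega> U V JI JC j A A \<phi> \<Lambda>"
      unfolding solves_TI_def Let_def
    proof (intro conjI ballI)
      show "A \<in> VI" "A \<in> VC" by (rule restr_space_refl[OF A])+
      show "\<phi> \<in> restr_space \<Omega>C U" "\<Lambda> \<in> dual_space cscale (trace_norm \<Omega> \<Omega>C) (trace_space \<Omega> \<Omega>C V)"
        by fact+
      show "- tang_trace_I \<Omega> \<Omega>I A + tr A = 0"
        by (simp add: tang_trace_C_eq_I[OF V_Hcurl[OF A]])
    next
      fix w assume w: "w \<in> VI"
      then obtain v where v: "v \<in> V" "eq_ae \<Omega>I w v" by (auto simp: restr_space_def)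
      \<comment> \<open>The test field w is known only on the insulator; passing to a global v turns
        the insulator trace into the trace on which \<open>\<Lambda>\<close> is known, and
        \<open>balance\<close> then turns - FC v into FI v.\<close>
      have "- tang_trace_I \<Omega> \<Omega>I w = - tr v"
        using tang_trace_I_cong[OF VI_Hcurl[OF w] v(2)] tang_trace_C_eq_I[OF V_Hcurl[OF v(1)]] by simp
      also have "\<dots> = tr (vscale (- 1) v)"
        unfolding tr_V_vscale[OF v(1)] by (simp add: cscale_def fun_eq_iff)
      finally have "\<Lambda> (- tang_trace_I \<Omega> \<Omega>I w) = FC (vscale (- 1) v)"
        using \<Lambda>(2)[OF subspaceD(3)[OF subspace_V v(1)]] by simp
      also have "\<dots> = - 1 * FC v"
        using FC restr_space_refl[OF v(1)] unfolding dual_space_def by blast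
      also have "\<dots> = FI v"
        using balance[OF v(1)] by (simp add: add_eq_0_iff)
      also have "\<dots> = FI w"
        by (rule dual_space_cong[OF open_domains(3) Hcurl_subspaces(4) FI w v(2)])
      finally show "curlcurl_form \<Omega>I \<mu> A w + \<Lambda> (- tang_trace_I \<Omega> \<Omega>I w) = JI w"
        by (simp add: FI_def)
    next
      fix w assume w: "w \<in> VC"
      then obtain v where v: "v \<in> V" "eq_ae \<Omega>C w v" by (auto simp: restr_space_def)
      have "\<Lambda> (tr w) = FC v"
        using tang_trace_C_cong[OF VC_Hcurl[OF w] v(2)] \<Lambda>(2)[OF v(1)] by simp
      also have "\<dots> = FC w"
        by (rule dual_space_cong[OF open_domains(2) Hcurl_subspaces(3) FC w v(2)])
      finally show "curlcurl_form \<Omega>C \<mu> A w + \<i> * \<omega> * mass_form \<Omega>C \<sigma> A w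
          + S_form \<Omega>C \<sigma> w \<phi> + \<Lambda> (tr w) = JC w"
        by (simp add: FC_def S_form_def mass_form_commute[of _ _ w] algebra_simps)
    next
      fix q assume "q \<in> restr_space \<Omega>C U"
      then show "\<i> * \<omega> * S_form \<Omega>C \<sigma> A q + C_form \<Omega>C \<sigma> \<phi> q = j q" by (rule eq\<phi>)
    qed
    then show "\<exists>\<Lambda>. solves_TI \<Omega> \<Omega>C \<Omega>I \<sigma> \<mu> \<omega> U V JI JC j A A \<phi> \<Lambda>" by blast
  qed
qed

end
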